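(* Let $F=\sum_i F_iX^i$ and $G=\sum_i G_iX^i$ be power series with coefficients in $\mathcal{O}_K$ with no common roots and with finite $\mathrm{wideg}$, namely $\mathrm{wideg}(F)=n$ and $\mathrm{wideg}(G)=m$, and suppose that $F_n$ and $G_m$ are units in $\mathcal{O}_{\mathbf{C}_p}$. (i) If $F$ and $G$ lie in $\mathcal{O}_K^o[[X]]$, then for all non-negative integers $t$ $$v_{\pi}\left(\mathrm{Res}^o(F,G)\right)-S' \geq B'(s'+t)-2B'(t)-s',$$ equivalently $$v_p\left(\mathrm{Res}^o(F,G)\right)-S'_K \geq \frac{1}{e}\left(B'(es'_K+t)-2B'(t)-es'_K\right).$$ (ii) If $F$ and $G$ lie in $\mathcal{O}_K^c[[X]]$, then for all non-negative integers $t$ $$v_{\pi}\left(\mathrm{Res}^c(F,G)\right)-S \geq B(s+t)-2B(t)-s,$$ equivalently $$v_p\left(\mathrm{Res}^c(F,G)\right)-S_K \geq \frac{1}{e}\left(B(es_K+t)-2B(t)-es_K\right).$$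
   Context: $p$ is a prime; $K$ is a finite extension of $\mathbf{Q}_p$ with ramification index $e$, residue degree $f$, ring of integers $\mathcal{O}_K$, uniformizer $\pi$, maximal ideal $\mathfrak{m}_K=\pi\mathcal{O}_K$. $\mathbf{C}_p$ is the completion of $\overline{\mathbf{Q}}_p$, $v_p$ its valuation with $v_p(p)=1$, $v_\pi=e\,v_p$; $\mathcal{O}_{\mathbf{C}_p}$ and $\mathfrak{m}_{\mathbf{C}_p}$ are the closed and open unit discs of $\mathbf{C}_p$. $\mathcal{O}_K^o[[X]]$ (resp. $\mathcal{O}_K^c[[X]]$) is the ring of power series in $\mathcal{O}_K[[X]]$ converging on $\mathfrak{m}_{\mathbf{C}_p}$ (resp. on $\mathcal{O}_{\mathbf{C}_p}$). For $F=\sum F_iX^i$, $\mathrm{wideg}(F)$ (resp. $\mathrm{Lwideg}(F)$) is the smallest (resp. largest) index $n$ with $v_p(F_n)=\min_i v_p(F_i)$. With $n=\mathrm{wideg}(F)$, $m=\mathrm{wideg}(G)$, $N=\mathrm{Lwideg}(F)$, $M=\mathrm{Lwideg}(G)$, the resultants are $$\mathrm{Res}^o(F,G)=F_n^{m}\prod_{z\in\mathfrak{m}_{\mathbf{C}_p},\,F(z)=0}G(z),\qquad \mathrm{Res}^c(F,G)=F_N^{M}\prod_{z\in\mathcal{O}_{\mathbf{C}_p},\,F(z)=0}G(z),$$ roots being counted with multiplicity. Put $\phi(x)=\min(v_p(F(x)),v_p(G(x)))$. $S_K$ and $s_K$ are the maximal and minimal values of $\phi$ on $\mathcal{O}_K$,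 and $S=eS_K$, $s=es_K$; $S'_K$ and $s'_K$ are the maximal and minimal values of $\phi$ on $\mathfrak{m}_K$, and $S'=eS'_K$, $s'=es'_K$. Numerical functions: $\alpha(j)=\sum_{k\ge1}\lfloor j/p^{kf}\rfloor$, $\beta(m)=\min\{j:\alpha(j)\ge m\}$, $B(s)=\sum_{m=1}^{s}\beta(m)$; $\alpha'(j)=j+\sum_{k\ge1}\lfloor j/p^{kf}\rfloor$, $\beta'(m)=\min\{j:\alpha'(j)\ge m\}$, $B'(s)=\sum_{m=1}^{s}\beta'(m)$. *)

theory Defs
  imports
    "HOL-Analysis.Analysis"
    "HOL-Computational_Algebra.Computational_Algebra"
begin

text \<open>
  The library has no $p$-adic fields. The field $\mathbf{C}_p$ is given by a type \<open>'a\<close> with a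
  valuation \<open>v\<close> subject to the locale \<open>Cp\<close> below, which determines it up to isomorphism of
  valued fields; completeness is the sort constraint \<^class>\<open>complete_space\<close>, for the metric that
  \<open>v\<close> induces. $\mathbf{Q}_p$ and $\overline{\mathbf{Q}}_p$ are subsets of \<open>'a\<close>.
\<close>

definition Qp :: "'a::{field_char_0, metric_space} set" where
  "Qp = closure \<rat>"

definition Qp_bar :: "'a::{field_char_0, metric_space} set" where
  "Qp_bar = {x. \<exists>P. P \<noteq> 0 \<and> (\<forall>i. coeff P i \<in> Qp) \<and> poly P x = 0}"

locale Cp =
  fixes p :: nat and v :: "'a::{field_char_0, complete_space} \<Rightarrow> ereal"
  assumes prime_p: "prime p"
    and v_infinity: "v x = \<infinity> \<longleftrightarrow> x = 0"
    and v_not_minus_infinity: "v x \<noteq> -\<infinity>"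
    and v_mult: "v (x * y) = v x + v y"
    and v_add: "min (v x) (v y) \<le> v (x + y)"
    and v_p: "v (of_nat p) = 1"
    and dist_v: "x \<noteq> y \<Longrightarrow> dist x y = real p powr (- real_of_ereal (v (x - y)))"
    and Qp_bar_alg_closed:
      "(\<And>i. coeff (P :: 'a poly) i \<in> Qp_bar) \<Longrightarrow> degree P > 0 \<Longrightarrow>
         \<exists>x\<in>Qp_bar. poly P x = 0"
    and Qp_bar_dense: "closure (Qp_bar :: 'a set) = UNIV"

definition finite_extension_Qp :: "'a::{field_char_0, metric_space} set \<Rightarrow> bool" where
  "finite_extension_Qp K \<longleftrightarrow>
     Qp \<subseteq> K \<and>
     (\<forall>x\<in>K. \<forall>y\<in>K. x + y \<in> K \<and> x - y \<in> K \<and> x * y \<in> K) \<and> (\<forall>x\<in>K. inverse x \<in> K) \<and>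
     (\<exists>B. finite B \<and> B \<subseteq> K \<and>
        (\<forall>x\<in>K. \<exists>c. (\<forall>b\<in>B. c b \<in> Qp) \<and> x = (\<Sum>b\<in>B. c b * b)))"

text \<open>For \<open>K = UNIV\<close> these are the closed and the open unit disc of $\mathbf{C}_p$.\<close>

definition val_ring :: "('a::field \<Rightarrow> ereal) \<Rightarrow> 'a set \<Rightarrow> 'a set" where
  "val_ring v K = {x \<in> K. 0 \<le> v x}"

definition val_ideal :: "('a::field \<Rightarrow> ereal) \<Rightarrow> 'a set \<Rightarrow> 'a set" where
  "val_ideal v K = {x \<in> K. 0 < v x}"

definition uniformizer :: "('a::field \<Rightarrow> ereal) \<Rightarrow> 'a set \<Rightarrow> 'a \<Rightarrow> bool" where
  "uniformizer v K \<pi> \<longleftrightarrow> \<pi> \<in> K \<and> val_ideal v K = (\<lambda>x. \<pi> * x) ` val_ring v K"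

text \<open>$p\mathcal{O}_K = \pi^e\mathcal{O}_K$; this does not depend on the uniformizer.\<close>

definition ramification_index :: "nat \<Rightarrow> ('a::field \<Rightarrow> ereal) \<Rightarrow> 'a set \<Rightarrow> nat" where
  "ramification_index p v K =
     (THE e. \<exists>\<pi>. uniformizer v K \<pi> \<and>
        (\<lambda>x. of_nat p * x) ` val_ring v K = (\<lambda>x. \<pi> ^ e * x) ` val_ring v K)"

text \<open>
  The dimension of $\mathcal{O}_K/\mathfrak{m}_K$ over the residue field of $\mathbf{Q}_p$, as the
  least size of a spanning set; both vectors and scalars are represented by lifts.
\<close>

definition residue_degree :: "('a::{field_char_0, metric_space} \<Rightarrow> ereal) \<Rightarrow> 'a set \<Rightarrow> nat" where
  "residue_degree v K =
     (LEAST d. \<exists>B. finite B \<and> card B = d \<and> B \<subseteq> val_ring v K \<and>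
        (\<forall>x\<in>val_ring v K. \<exists>c. (\<forall>b\<in>B. c b \<in> val_ring v Qp) \<and>
           x - (\<Sum>b\<in>B. c b * b) \<in> val_ideal v K))"

text \<open>\<open>eval_fps\<close> and \<open>fps_conv_radius\<close> need a real normed field, which $\mathbf{C}_p$ is not.\<close>

definition fps_converges_on :: "'a::{field, metric_space} fps \<Rightarrow> 'a set \<Rightarrow> bool" where
  "fps_converges_on F D \<longleftrightarrow> (\<forall>x\<in>D. summable (\<lambda>i. fps_nth F i * x ^ i))"

definition fps_value :: "'a::{field, metric_space} fps \<Rightarrow> 'a \<Rightarrow> 'a" where
  "fps_value F x = (\<Sum>i. fps_nth F i * x ^ i)"

definition series_o :: "('a::{field, metric_space} \<Rightarrow> ereal) \<Rightarrow> 'a set \<Rightarrow> 'a fps set" where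
  "series_o v K =
     {F. (\<forall>i. fps_nth F i \<in> val_ring v K) \<and> fps_converges_on F (val_ideal v UNIV)}"

definition series_c :: "('a::{field, metric_space} \<Rightarrow> ereal) \<Rightarrow> 'a set \<Rightarrow> 'a fps set" where
  "series_c v K =
     {F. (\<forall>i. fps_nth F i \<in> val_ring v K) \<and> fps_converges_on F (val_ring v UNIV)}"

definition min_indices :: "('a::field \<Rightarrow> ereal) \<Rightarrow> 'a fps \<Rightarrow> nat set" where
  "min_indices v F = {n. \<forall>i. v (fps_nth F n) \<le> v (fps_nth F i)}"

text \<open>
  As infimum and supremum in \<^typ>\<open>enat\<close>: the smallest index is \<open>\<infinity>\<close> if there is none, the largest
  is \<open>\<infinity>\<close> if there are infinitely many.
\<close>

definition wideg :: "('a::field \<Rightarrow> ereal) \<Rightarrow> 'a fps \<Rightarrow> enat" where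
  "wideg v F = Inf (enat ` min_indices v F)"

definition Lwideg :: "('a::field \<Rightarrow> ereal) \<Rightarrow> 'a fps \<Rightarrow> enat" where
  "Lwideg v F = Sup (enat ` min_indices v F)"

text \<open>
  The cofactor has to converge on the disc \<open>D\<close>: for \<open>z \<noteq> 0\<close> the series \<open>X - z\<close> is a unit in the
  ring of all formal power series.
\<close>

definition root_mult :: "'a::{field, metric_space} set \<Rightarrow> 'a fps \<Rightarrow> 'a \<Rightarrow> nat" where
  "root_mult D F z =
     (GREATEST k. \<exists>H. fps_converges_on H D \<and> F = (fps_X - fps_const z) ^ k * H)"

definition prod_over_roots ::
    "'a::{field, metric_space} set \<Rightarrow> 'a fps \<Rightarrow> 'a fps \<Rightarrow> 'a" where
  "prod_over_roots D F G =
     (\<Prod>z\<in>{z \<in> D. fps_value F z = 0}. fps_value G z ^ root_mult D F z)"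

definition res_o :: "('a::{field, metric_space} \<Rightarrow> ereal) \<Rightarrow> 'a fps \<Rightarrow> 'a fps \<Rightarrow> 'a" where
  "res_o v F G =
     fps_nth F (the_enat (wideg v F)) ^ the_enat (wideg v G) *
     prod_over_roots (val_ideal v UNIV) F G"

definition res_c :: "('a::{field, metric_space} \<Rightarrow> ereal) \<Rightarrow> 'a fps \<Rightarrow> 'a fps \<Rightarrow> 'a" where
  "res_c v F G =
     fps_nth F (the_enat (Lwideg v F)) ^ the_enat (Lwideg v G) *
     prod_over_roots (val_ring v UNIV) F G"

definition no_common_root :: "'a::{field, metric_space} set \<Rightarrow> 'a fps \<Rightarrow> 'a fps \<Rightarrow> bool" where
  "no_common_root D F G \<longleftrightarrow> \<not> (\<exists>z\<in>D. fps_value F z = 0 \<and> fps_value G z = 0)"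

definition phi ::
    "('a::{field, metric_space} \<Rightarrow> ereal) \<Rightarrow> 'a fps \<Rightarrow> 'a fps \<Rightarrow> 'a \<Rightarrow> ereal" where
  "phi v F G x = min (v (fps_value F x)) (v (fps_value G x))"

definition max_phi ::
    "('a::{field, metric_space} \<Rightarrow> ereal) \<Rightarrow> 'a fps \<Rightarrow> 'a fps \<Rightarrow> 'a set \<Rightarrow> ereal" where
  "max_phi v F G A = (GREATEST y. y \<in> phi v F G ` A)"

definition min_phi ::
    "('a::{field, metric_space} \<Rightarrow> ereal) \<Rightarrow> 'a fps \<Rightarrow> 'a fps \<Rightarrow> 'a set \<Rightarrow> ereal" where
  "min_phi v F G A = (LEAST y. y \<in> phi v F G ` A)"

text \<open>The sums over \<open>k \<ge> 1\<close> are infinite sums in \<^typ>\<open>nat\<close> (finitely many nonzero terms), shifted by one.\<close>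

definition alpha :: "nat \<Rightarrow> nat \<Rightarrow> nat \<Rightarrow> nat" where
  "alpha p f j = (\<Sum>k. j div p ^ (Suc k * f))"

definition beta :: "nat \<Rightarrow> nat \<Rightarrow> nat \<Rightarrow> nat" where
  "beta p f m = (LEAST j. alpha p f j \<ge> m)"

definition B :: "nat \<Rightarrow> nat \<Rightarrow> nat \<Rightarrow> nat" where
  "B p f s = (\<Sum>m=1..s. beta p f m)"

definition alpha' :: "nat \<Rightarrow> nat \<Rightarrow> nat \<Rightarrow> nat" where
  "alpha' p f j = j + (\<Sum>k. j div p ^ (Suc k * f))"

definition beta' :: "nat \<Rightarrow> nat \<Rightarrow> nat \<Rightarrow> nat" where
  "beta' p f m = (LEAST j. alpha' p f j \<ge> m)"

definition B' :: "nat \<Rightarrow> nat \<Rightarrow> nat \<Rightarrow> nat" where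
  "B' p f s = (\<Sum>m=1..s. beta' p f m)"

end

theory Submission
  imports Defs "Jordan_Normal_Form.Determinant"
begin

text \<open>
  Over the complete, algebraically closed field with valuation \<open>v\<close>, the Weierstrass preparation
  theorem (\<open>Weierstrass_open\<close>, \<open>Weierstrass_closed\<close>) writes \<open>F = f U\<close> and \<open>G = g W\<close> with monic integral
  polynomials \<open>f\<close> and \<open>g\<close> whose roots are the zeros of \<open>F\<close> and \<open>G\<close> in the disc, and with \<open>U\<close> and \<open>W\<close> of
  absolute value one everywhere on the disc. So \<open>F\<close> and \<open>G\<close> have the same valuations on the disc as
  \<open>f\<close> and \<open>g\<close>, the resultant has the valuation of the product of the values of \<open>g\<close> at the roots of \<open>f\<close>,
  and what is left is a statement on two monic polynomials of degrees \<open>n\<close> and \<open>m\<close>.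

  Let \<open>A\<close> be the ring of integers of \<open>K\<close> or its maximal ideal, and let \<open>x0\<close> be a point of \<open>A\<close> where the
  minimum \<open>\<phi>\<close> of the valuations of \<open>F\<close> and \<open>G\<close> takes its largest value \<open>S / e\<close>; the least value is \<open>s / e\<close>.
  There is a sequence of nodes in \<open>A\<close>, starting with \<open>x0\<close>, such that the \<open>k\<close>-th Newton polynomial \<open>P\<^sub>k\<close>
  has valuation at least \<open>\<alpha>(k) / e\<close> on \<open>A\<close>, and exactly this valuation at the node with index \<open>k\<close>. By
  interpolation, a polynomial has values divisible by a power \<open>\<pi>\<^sup>r\<close> on \<open>A\<close> exactly if its \<open>k\<close>-th
  coordinate in the Newton basis is divisible by \<open>\<pi>\<close> with exponent \<open>r - \<alpha>(k)\<close>, for every \<open>k\<close>.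

  Consider the square matrix with the coordinates of the \<open>n + m\<close> polynomials \<open>P\<^sub>i g\<close> (\<open>i < n\<close>) and \<open>P\<^sub>j f\<close>
  (\<open>j < m\<close>). Its determinant is the resultant of \<open>f\<close> and \<open>g\<close>. To see this, use as nodes the roots of \<open>f\<close>
  followed by the previous nodes: in the new Newton basis, and up to unitriangular changes of rows and
  columns, the matrix is triangular with the values of \<open>g\<close> at the roots of \<open>f\<close> on the diagonal. On the
  other hand, for every \<open>t\<close>, the row of \<open>P\<^sub>j f\<close> multiplied by \<open>\<pi>\<close> with exponent \<open>max 0 (t - \<alpha>(j))\<close> is a
  polynomial with values divisible by \<open>\<pi>\<close> with exponent \<open>s + t\<close>, which bounds its coordinates from below;
  the coordinate with index \<open>0\<close> is its value at \<open>x0\<close>, where the exponent is even \<open>S + t\<close> (or the value is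
  zero). The Leibniz formula gives for \<open>e\<close> times the valuation of the resultant the lower bound
  \<open>S - s\<close>, plus the sum of \<open>max 0 (s + t - \<alpha>(k))\<close> over \<open>k < n + m\<close>, minus the sums of \<open>max 0 (t - \<alpha>(i))\<close>
  over \<open>i < n\<close> and over \<open>i < m\<close> (\<open>resultant_lower_bound\<close>). The sum of \<open>max 0 (s - \<alpha>(k))\<close> over all \<open>k\<close> is
  \<open>B(s)\<close>. So these are the sums \<open>B(s + t)\<close> and \<open>B(t)\<close>, but truncated; the truncation is harmless because
  \<open>\<alpha>\<close> is superadditive and \<open>s \<le> \<alpha>(n)\<close> (\<open>beta_sum_truncation\<close>). With \<open>s = t = 0\<close> the same bound shows
  that \<open>\<phi>\<close> is bounded, so that its maximum exists.

  The arithmetic of \<open>K\<close> is needed only for the nodes. Its value group is generated by \<open>1 / e\<close>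
  (\<open>ramification_index_value_group\<close>) and its residue field has \<open>q = p\<^sup>f\<close> elements (\<open>residue_system\<close>); both
  follow from the finite dimension over \<open>Qp\<close>. The nodes are expansions in powers of a uniformizer with
  the digits of \<open>0, 1, 2, ...\<close> in base \<open>q\<close>, for which the valuations of the Newton polynomials are
  computed as in Legendre's formula (\<open>test_sequence_ring\<close>).
\<close>

section \<open>Valuation calculus, convergence and values of power series\<close>

context Cp
begin

lemma v_zero [simp]: "v 0 = \<infinity>"
  using v_infinity by blast

lemma v_real:
  assumes "x \<noteq> 0" obtains r where "v x = ereal r"
  using assms v_infinity[of x] v_not_minus_infinity[of x] by (cases "v x") auto

lemma v_one [simp]: "v 1 = 0"
proof -
  obtain r where r: "v 1 = ereal r" using v_real[of 1] by auto
  have "v (1 * 1) = v 1 + v 1" by (rule v_mult)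
  then show ?thesis using r by (simp add: zero_ereal_def)
qed

lemma v_minus [simp]: "v (- x) = v x"
proof -
  obtain r where r: "v (-1) = ereal r" using v_real[of "-1"] by auto
  have "v ((-1) * (-1)) = v (-1) + v (-1)" by (rule v_mult)
  then have "v (-1) = 0" using r by (simp add: zero_ereal_def)
  then show ?thesis using v_mult[of "-1" x] by simp
qed

lemma v_minus_commute: "v (x - y) = v (y - x)"
  using v_minus[of "x - y"] by simp

lemma v_add_ge: "c \<le> v x \<Longrightarrow> c \<le> v y \<Longrightarrow> c \<le> v (x + y)"
  by (meson v_add min.bounded_iff order_trans)

lemma v_diff_ge: "c \<le> v x \<Longrightarrow> c \<le> v y \<Longrightarrow> c \<le> v (x - y)"
  using v_add_ge[of c x "-y"] by simp

lemma v_diff_gt: "c < v x \<Longrightarrow> c < v y \<Longrightarrow> c < v (x - y)"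
  by (rule less_le_trans[of c "min (v x) (v y)"]) (auto intro: v_diff_ge)

lemma v_add_gt: "c < v x \<Longrightarrow> c < v y \<Longrightarrow> c < v (x + y)"
  using v_diff_gt[of c x "-y"] by simp

lemma v_sum_ge: "(\<And>i. i \<in> A \<Longrightarrow> c \<le> v (g i)) \<Longrightarrow> c \<le> v (sum g A)"
  by (induction A rule: infinite_finite_induct) (auto intro: v_add_ge)

lemma v_sum_gt: "c < \<infinity> \<Longrightarrow> (\<And>i. i \<in> A \<Longrightarrow> c < v (g i)) \<Longrightarrow> c < v (sum g A)"
  by (induction A rule: infinite_finite_induct) (auto intro: v_add_gt)

lemma v_mult_ge: "ereal c \<le> v x \<Longrightarrow> ereal d \<le> v y \<Longrightarrow> ereal (c + d) \<le> v (x * y)"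
  using add_mono[of "ereal c" "v x" "ereal d" "v y"] by (simp add: v_mult)

lemma v_mult_nonneg: "0 \<le> v x \<Longrightarrow> 0 \<le> v y \<Longrightarrow> 0 \<le> v (x * y)"
  by (simp add: v_mult)

lemma v_mult_ge_left: "c \<le> v x \<Longrightarrow> 0 \<le> v y \<Longrightarrow> c \<le> v (x * y)"
  using add_mono[of c "v x" 0 "v y"] by (simp add: v_mult)

lemma v_mult_ge_right: "0 \<le> v x \<Longrightarrow> c \<le> v y \<Longrightarrow> c \<le> v (x * y)"
  using v_mult_ge_left[of c y x] by (simp add: mult.commute)

lemma v_prod: "v (prod g A) = (\<Sum>i\<in>A. v (g i))"
  by (induction A rule: infinite_finite_induct) (auto simp: v_mult)

lemma v_power: "v (x ^ n) = ereal (real n) * v x"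
proof (cases "x = 0")
  case True then show ?thesis by (cases n) (auto simp: zero_ereal_def[symmetric])
next
  case False
  then obtain r where "v x = ereal r" by (rule v_real)
  then show ?thesis by (induction n) (auto simp: v_mult algebra_simps zero_ereal_def)
qed

lemma v_power_nonneg: "0 \<le> v x \<Longrightarrow> 0 \<le> v (x ^ n)"
  by (simp add: v_power)

lemma v_power_ge: "ereal c \<le> v x \<Longrightarrow> ereal (real n * c) \<le> v (x ^ n)"
  using ereal_mult_left_mono[of "ereal c" "v x" "ereal (real n)"] by (simp add: v_power)

lemma v_add_eq: assumes "v x < v y" shows "v (x + y) = v x"
proof (rule antisym)
  show "v x \<le> v (x + y)" using assms by (intro v_add_ge) auto
  show "v (x + y) \<le> v x"
  proof (rule ccontr)
    assume "\<not> v (x + y) \<le> v x"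
    then have "v x < v (x + y - y)" using assms by (intro v_diff_gt) auto
    then show False by simp
  qed
qed

text \<open>
  \<open>y\<close> is an approximation of \<open>x\<close> that is closer than the size of \<open>x\<close>; it then has the size of \<open>x\<close>.
\<close>

lemma v_eqI: assumes "v x < v (x - y)" shows "v y = v x"
  using v_add_eq[of x "y - x"] assms v_minus_commute[of x y] by simp

lemma v_inverse: assumes "x \<noteq> 0" shows "v (inverse x) = - v x"
proof -
  obtain r where r: "v x = ereal r" using assms by (rule v_real)
  obtain t where t: "v (inverse x) = ereal t" using assms v_real[of "inverse x"] by auto
  have "v (x * inverse x) = v x + v (inverse x)" by (rule v_mult)
  then show ?thesis using r t assms by (simp add: zero_ereal_def)
qed

lemma v_divide_ge: assumes "v y = ereal d" "ereal (c + d) \<le> v x" shows "ereal c \<le> v (x / y)"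
proof -
  have "y \<noteq> 0" using assms by auto
  then have "ereal (c + d + (- d)) \<le> v (x * inverse y)"
    using v_inverse assms by (intro v_mult_ge) auto
  then show ?thesis by (simp add: divide_inverse)
qed

lemma v_inverse_unit: "v x = 0 \<Longrightarrow> v (inverse x) = 0"
  using v_inverse[of x] by (cases "x = 0") auto

lemma eq_zero_if_v_ge: assumes "\<And>N::nat. ereal (real N) \<le> v x" shows "x = 0"
proof (rule ccontr)
  assume "x \<noteq> 0"
  then obtain r where r: "v x = ereal r" by (rule v_real)
  obtain N :: nat where "r < real N" using reals_Archimedean2 by blast
  with assms[of N] r show False by simp
qed

lemma p_gt_1: "p > 1" using prime_p by (rule prime_gt_1_nat)

lemma dist_le_iff: "dist x y \<le> real p powr (- N) \<longleftrightarrow> ereal N \<le> v (x - y)"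
proof (cases "x = y")
  case False
  then obtain r where r: "v (x - y) = ereal r" using v_real[of "x - y"] by auto
  show ?thesis using dist_v[OF False] r p_gt_1 by simp
qed auto

lemma ex_powr_less: assumes "0 < d" obtains N where "real p powr (- real N) < d"
proof -
  have "(\<lambda>N. real p powr (- real N)) \<longlonglongrightarrow> 0"
  proof -
    have "(\<lambda>N. inverse (real p) ^ N) \<longlonglongrightarrow> 0"
      using p_gt_1 by (intro LIMSEQ_power_zero) (simp add: inverse_less_1_iff)
    moreover have "inverse (real p) ^ N = real p powr (- real N)" for N
      using p_gt_1 by (simp add: powr_minus powr_realpow power_inverse)
    ultimately show ?thesis by simp
  qed
  then have "\<forall>\<^sub>F N in sequentially. real p powr (- real N) < d"
    using assms by (simp add: order_tendsto_iff)
  then show ?thesis using that by (meson eventually_sequentially order_refl)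
qed

lemma tendsto_iff_v:
  "s \<longlonglongrightarrow> L \<longleftrightarrow> (\<forall>N::nat. \<forall>\<^sub>F n in sequentially. ereal (real N) \<le> v (s n - L))"
proof
  assume "s \<longlonglongrightarrow> L"
  show "\<forall>N::nat. \<forall>\<^sub>F n in sequentially. ereal (real N) \<le> v (s n - L)"
  proof
    fix N :: nat
    have "\<forall>\<^sub>F n in sequentially. dist (s n) L < real p powr (- real N)"
      using \<open>s \<longlonglongrightarrow> L\<close> p_gt_1 unfolding tendsto_iff by simp
    then show "\<forall>\<^sub>F n in sequentially. ereal (real N) \<le> v (s n - L)"
      by eventually_elim (simp flip: dist_le_iff)
  qed
next
  assume R: "\<forall>N::nat. \<forall>\<^sub>F n in sequentially. ereal (real N) \<le> v (s n - L)"
  show "s \<longlonglongrightarrow> L" unfolding tendsto_iff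
  proof (intro allI impI)
    fix d :: real assume "0 < d"
    then obtain N where N: "real p powr (- real N) < d" by (rule ex_powr_less)
    have "\<forall>\<^sub>F n in sequentially. ereal (real N) \<le> v (s n - L)" using R by simp
    then show "\<forall>\<^sub>F n in sequentially. dist (s n) L < d"
      by eventually_elim (use N in \<open>simp flip: dist_le_iff\<close>)
  qed
qed

lemma closure_iff_v: "x \<in> closure A \<longleftrightarrow> (\<forall>N::nat. \<exists>y\<in>A. ereal (real N) \<le> v (x - y))"
proof
  assume L: "x \<in> closure A"
  show "\<forall>N::nat. \<exists>y\<in>A. ereal (real N) \<le> v (x - y)"
  proof
    fix N :: nat
    have "real p powr (- real N) > 0" using p_gt_1 by simp
    then obtain y where "y \<in> A" "dist y x < real p powr (- real N)"
      using L unfolding closure_approachable by blast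
    then show "\<exists>y\<in>A. ereal (real N) \<le> v (x - y)"
      using dist_le_iff[of x y "real N"] by (auto simp: dist_commute)
  qed
next
  assume R: "\<forall>N::nat. \<exists>y\<in>A. ereal (real N) \<le> v (x - y)"
  show "x \<in> closure A" unfolding closure_approachable
  proof (intro allI impI)
    fix d :: real assume "0 < d"
    then obtain N where N: "real p powr (- real N) < d" by (rule ex_powr_less)
    obtain y where "y \<in> A" "ereal (real N) \<le> v (x - y)" using R by blast
    then have "dist y x < d" using N dist_le_iff[of x y "real N"] by (simp add: dist_commute)
    with \<open>y \<in> A\<close> show "\<exists>y\<in>A. dist y x < d" by blast
  qed
qed

text \<open>
  Once \<open>s n\<close> is closer to \<open>L\<close> than \<open>L\<close> is to \<open>a\<close>, the differences \<open>s n - a\<close> and \<open>L - a\<close> have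
  the same valuation.
\<close>

lemma tendsto_v_ge:
  assumes "s \<longlonglongrightarrow> L" "\<forall>\<^sub>F n in sequentially. c \<le> v (s n - a)"
  shows "c \<le> v (L - a)"
proof (rule ccontr)
  assume "\<not> c \<le> v (L - a)"
  then have *: "v (L - a) < c" by simp
  then have "L - a \<noteq> 0" by auto
  then obtain r where r: "v (L - a) = ereal r" by (rule v_real)
  obtain N :: nat where N: "r < real N" using reals_Archimedean2 by blast
  have "\<forall>\<^sub>F n in sequentially. ereal (real N) \<le> v (s n - L)" using assms(1) tendsto_iff_v by blast
  then have "\<forall>\<^sub>F n in sequentially. False"
    using assms(2)
  proof eventually_elim
    case (elim n)
    have "v (L - a) < ereal (real N)" using r N by simp
    also have "\<dots> \<le> v (s n - L)" using elim by simp
    finally have "v (L - a) < v (s n - L)" .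
    then have "v ((L - a) + (s n - L)) = v (L - a)" by (rule v_add_eq)
    then show False using elim * by simp
  qed
  then show False by simp
qed

text \<open>
  By the ultrametric inequality the consecutive differences bound all differences, so it
  suffices for a Cauchy sequence that they tend to zero.
\<close>

lemma convergent_if_steps:
  assumes "\<And>N::nat. \<forall>\<^sub>F n in sequentially. ereal (real N) \<le> v (s (Suc n) - s n)"
  shows "\<exists>L. s \<longlonglongrightarrow> L"
proof -
  have step: "ereal (real N) \<le> v (s (m + k) - s m)"
    if "\<And>n. n \<ge> m \<Longrightarrow> ereal (real N) \<le> v (s (Suc n) - s n)" for N m k
  proof (induction k)
    case (Suc k)
    have "ereal (real N) \<le> v ((s (Suc (m + k)) - s (m + k)) + (s (m + k) - s m))"
      using that Suc by (intro v_add_ge) auto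
    then show ?case by simp
  qed simp
  have "Cauchy s" unfolding Cauchy_altdef
  proof (intro allI impI)
    fix d :: real assume "0 < d"
    then obtain N where N: "real p powr (- real N) < d" by (rule ex_powr_less)
    obtain M where M: "\<And>n. n \<ge> M \<Longrightarrow> ereal (real N) \<le> v (s (Suc n) - s n)"
      using assms[of N] unfolding eventually_sequentially by blast
    show "\<exists>M. \<forall>m\<ge>M. \<forall>n>m. dist (s m) (s n) < d"
    proof (intro exI[of _ M] allI impI)
      fix m n assume "M \<le> m" "m < n"
      then have "ereal (real N) \<le> v (s (m + (n - m)) - s m)" using M by (intro step) auto
      then have "dist (s n) (s m) \<le> real p powr (- real N)" using \<open>m < n\<close> dist_le_iff by simp
      then show "dist (s m) (s n) < d" using N by (simp add: dist_commute)
    qed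
  qed
  then show ?thesis using Cauchy_convergent convergent_def by blast
qed

lemma tendsto_add_v:
  fixes s t :: "nat \<Rightarrow> 'a"
  assumes "s \<longlonglongrightarrow> L" "t \<longlonglongrightarrow> M" shows "(\<lambda>n. s n + t n) \<longlonglongrightarrow> L + M"
  unfolding tendsto_iff_v
proof
  fix N :: nat
  have "\<forall>\<^sub>F n in sequentially. ereal (real N) \<le> v (s n - L)" "\<forall>\<^sub>F n in sequentially. ereal (real N) \<le> v (t n - M)"
    using assms tendsto_iff_v by blast+
  then show "\<forall>\<^sub>F n in sequentially. ereal (real N) \<le> v (s n + t n - (L + M))"
  proof eventually_elim
    case (elim n)
    have "ereal (real N) \<le> v ((s n - L) + (t n - M))" using elim by (rule v_add_ge)
    then show ?case by (simp add: algebra_simps)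
  qed
qed

lemma tendsto_mult_const_v:
  fixes s :: "nat \<Rightarrow> 'a"
  assumes "s \<longlonglongrightarrow> L" shows "(\<lambda>n. c * s n) \<longlonglongrightarrow> c * L"
proof (cases "c = 0")
  case False
  then obtain r where r: "v c = ereal r" by (rule v_real)
  show ?thesis unfolding tendsto_iff_v
  proof
    fix N :: nat
    obtain M :: nat where M: "real N - r < real M" using reals_Archimedean2 by blast
    have "\<forall>\<^sub>F n in sequentially. ereal (real M) \<le> v (s n - L)"
      using assms tendsto_iff_v by blast
    then show "\<forall>\<^sub>F n in sequentially. ereal (real N) \<le> v (c * s n - c * L)"
    proof eventually_elim
      case (elim n)
      have "ereal (r + real M) \<le> v (c * (s n - L))" using elim r by (intro v_mult_ge) auto
      moreover have "ereal (real N) \<le> ereal (r + real M)" using M by simp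
      ultimately show ?case by (metis order_trans right_diff_distrib)
    qed
  qed
qed simp

definition null :: "(nat \<Rightarrow> 'a) \<Rightarrow> bool" where
  "null s \<longleftrightarrow> (\<forall>N::nat. \<forall>\<^sub>F n in sequentially. ereal (real N) \<le> v (s n))"

lemma null_shift: "null s \<Longrightarrow> null (\<lambda>n. s (n + k))"
  unfolding null_def eventually_sequentially by (meson le_add1 order_trans)

lemma null_diff: assumes "null s" "null t" shows "null (\<lambda>n. s n - t n)"
  unfolding null_def
proof
  fix N :: nat
  have "\<forall>\<^sub>F n in sequentially. ereal (real N) \<le> v (s n)" "\<forall>\<^sub>F n in sequentially. ereal (real N) \<le> v (t n)"
    using assms by (auto simp: null_def)
  then show "\<forall>\<^sub>F n in sequentially. ereal (real N) \<le> v (s n - t n)"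
    by eventually_elim (rule v_diff_ge)
qed

lemma null_mult_bounded: assumes "null s" "\<And>n. 0 \<le> v (t n)" shows "null (\<lambda>n. s n * t n)"
  unfolding null_def
proof
  fix N :: nat
  have "\<forall>\<^sub>F n in sequentially. ereal (real N) \<le> v (s n)"
    using assms by (auto simp: null_def)
  then show "\<forall>\<^sub>F n in sequentially. ereal (real N) \<le> v (s n * t n)"
    by eventually_elim (use assms v_mult_ge_left in blast)
qed

lemma null_bounded: assumes "null s" obtains c::real where "c \<le> 0" "\<And>n. ereal c \<le> v (s n)"
proof -
  obtain M where M: "\<And>n. n \<ge> M \<Longrightarrow> ereal (real 0) \<le> v (s n)"
    using assms unfolding null_def eventually_sequentially by blast
  have "\<exists>c. c \<le> 0 \<and> (\<forall>n<M. ereal c \<le> v (s n))"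
  proof (induction M)
    case (Suc M)
    then obtain c where c: "c \<le> 0" "\<forall>n<M. ereal c \<le> v (s n)" by blast
    obtain d :: real where "ereal d \<le> v (s M)" "d \<le> 0"
    proof (cases "v (s M)")
      case (real r) then show ?thesis using that[of "min 0 r"] by auto
    next
      case PInf then show ?thesis using that[of 0] by auto
    next
      case MInf then show ?thesis using v_not_minus_infinity by auto
    qed
    then have "\<forall>n<Suc M. ereal (min c d) \<le> v (s n)"
      using c by (auto simp: less_Suc_eq min_def intro: order_trans[of _ "ereal c"] order_trans[of _ "ereal d"])
    then show ?case using c by (intro exI[of _ "min c d"]) auto
  qed (auto intro: exI[of _ 0])
  then obtain c where c: "c \<le> 0" "\<forall>n<M. ereal c \<le> v (s n)" by blast
  show ?thesis
  proof (rule that[OF c(1)])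
    fix n show "ereal c \<le> v (s n)"
    proof (cases "n < M")
      case False
      then have "ereal (real 0) \<le> v (s n)" using M by simp
      moreover have "ereal c \<le> ereal (real 0)" using c(1) by simp
      ultimately show ?thesis by (rule order_trans[rotated])
    qed (use c in auto)
  qed
qed

text \<open>
  The differences of consecutive partial sums are the terms, so terms that tend to zero suffice
  for convergence in an ultrametric space.
\<close>

lemma summable_iff_null: "summable s \<longleftrightarrow> null s"
proof
  assume "null s"
  then have "\<exists>L. (\<lambda>n. sum s {..<n}) \<longlonglongrightarrow> L"
    by (intro convergent_if_steps) (simp add: null_def)
  then show "summable s" by (auto simp: summable_def sums_def)
next
  assume "summable s"
  then obtain L where L: "(\<lambda>n. sum s {..<n}) \<longlonglongrightarrow> L" by (auto simp: summable_def sums_def)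
  show "null s" unfolding null_def
  proof
    fix N :: nat
    obtain M where M: "\<And>n. n \<ge> M \<Longrightarrow> ereal (real N) \<le> v (sum s {..<n} - L)"
      using L unfolding tendsto_iff_v eventually_sequentially by blast
    show "\<forall>\<^sub>F n in sequentially. ereal (real N) \<le> v (s n)"
      unfolding eventually_sequentially
    proof (intro exI[of _ M] allI impI)
      fix n assume "M \<le> n"
      then have "ereal (real N) \<le> v ((sum s {..<Suc n} - L) - (sum s {..<n} - L))"
        using M[of n] M[of "Suc n"] \<open>M \<le> n\<close> v_diff_ge by (metis le_SucI)
      then show "ereal (real N) \<le> v (s n)" by simp
    qed
  qed
qed

lemma suminf_tendsto: "null s \<Longrightarrow> (\<lambda>n. sum s {..<n}) \<longlonglongrightarrow> suminf s"
  using summable_sums[of s] summable_iff_null sums_def by blast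

lemma suminf_eqI: "(\<lambda>n. sum s {..<n}) \<longlonglongrightarrow> (L::'a) \<Longrightarrow> suminf s = L"
  using sums_unique[of s L] by (simp add: sums_def)

lemma v_suminf_ge:
  assumes "null s" "\<And>i. c \<le> v (s i)" shows "c \<le> v (suminf s)"
  using tendsto_v_ge[OF suminf_tendsto[OF assms(1)], of c 0] assms(2) by (simp add: v_sum_ge)

lemma suminf_diff_v:
  assumes "null s" "null t" shows "suminf (\<lambda>i. s i - t i) = suminf s - suminf t"
proof (rule suminf_eqI)
  have "(\<lambda>n. sum s {..<n} + (-1) * sum t {..<n}) \<longlonglongrightarrow> suminf s + (-1) * suminf t"
    by (intro tendsto_add_v tendsto_mult_const_v suminf_tendsto assms)
  then show "(\<lambda>n. \<Sum>i<n. s i - t i) \<longlonglongrightarrow> suminf s - suminf t" by (simp add: sum_subtractf)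
qed

lemma suminf_mult_const_v:
  assumes "null s" shows "suminf (\<lambda>i. c * s i) = c * suminf s"
proof (rule suminf_eqI)
  have "(\<lambda>n. c * sum s {..<n}) \<longlonglongrightarrow> c * suminf s"
    by (intro tendsto_mult_const_v suminf_tendsto assms)
  then show "(\<lambda>n. \<Sum>i<n. c * s i) \<longlonglongrightarrow> c * suminf s" by (simp add: sum_distrib_left)
qed

lemma suminf_head_v:
  assumes "null s" shows "suminf s = s 0 + suminf (\<lambda>i. s (Suc i))"
proof (rule suminf_eqI)
  have "null (\<lambda>n. s (n + 1))" using assms by (rule null_shift)
  then have "(\<lambda>n. (\<Sum>i<n. s (Suc i)) + s 0) \<longlonglongrightarrow> suminf (\<lambda>i. s (Suc i)) + s 0"
    by (intro tendsto_add_v suminf_tendsto) auto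
  then have "(\<lambda>n. sum s {..<Suc n}) \<longlonglongrightarrow> s 0 + suminf (\<lambda>i. s (Suc i))"
    by (simp add: sum.lessThan_Suc_shift add.commute del: sum.lessThan_Suc)
  then show "(\<lambda>n. sum s {..<n}) \<longlonglongrightarrow> s 0 + suminf (\<lambda>i. s (Suc i))"
    by (subst (asm) filterlim_sequentially_Suc)
qed

lemma converges_iff: "fps_converges_on H D \<longleftrightarrow> (\<forall>x\<in>D. null (\<lambda>i. fps_nth H i * x ^ i))"
  by (simp add: fps_converges_on_def summable_iff_null)

text \<open>
  Evaluation respects multiplication by a linear factor. Iterated over the roots, this is how
  a Weierstrass factorization is evaluated.
\<close>

lemma fps_value_linear_mult:
  assumes "null (\<lambda>i. fps_nth H i * x ^ i)"
  shows "null (\<lambda>i. fps_nth ((fps_X - fps_const z) * H) i * x ^ i)"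
    and "fps_value ((fps_X - fps_const z) * H) x = (x - z) * fps_value H x"
proof -
  define h where "h i = fps_nth H i * x ^ i" for i
  define g where "g i = fps_nth (fps_X * H) i * x ^ i" for i
  have g: "g 0 = 0" "\<And>i. g (Suc i) = x * h i" by (auto simp: g_def h_def)
  have h: "null h" using assms by (simp add: h_def[abs_def])
  have nc: "null (\<lambda>i. c * h i)" for c
  proof -
    have "(\<lambda>n. sum (\<lambda>i. c * h i) {..<n}) \<longlonglongrightarrow> c * suminf h"
      using tendsto_mult_const_v[OF suminf_tendsto[OF h], of c] by (simp add: sum_distrib_left)
    then show ?thesis by (auto simp flip: summable_iff_null simp: summable_def sums_def)
  qed
  have ng: "null g" unfolding null_def
  proof
    fix N :: nat
    have "\<forall>\<^sub>F n in sequentially. ereal (real N) \<le> v (g (Suc n))"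
      using nc[of x] by (simp add: g null_def)
    then show "\<forall>\<^sub>F n in sequentially. ereal (real N) \<le> v (g n)"
      by (subst (asm) eventually_sequentially_Suc)
  qed
  have eq: "fps_nth ((fps_X - fps_const z) * H) i * x ^ i = g i - z * h i" for i
    by (simp add: g_def h_def algebra_simps)
  show "null (\<lambda>i. fps_nth ((fps_X - fps_const z) * H) i * x ^ i)"
    unfolding eq by (intro null_diff ng nc)
  have "suminf g = x * suminf h"
    using suminf_head_v[OF ng] suminf_mult_const_v[OF h, of x] by (simp add: g)
  then show "fps_value ((fps_X - fps_const z) * H) x = (x - z) * fps_value H x"
    unfolding fps_value_def eq suminf_diff_v[OF ng nc] suminf_mult_const_v[OF h]
    by (simp add: h_def[abs_def] left_diff_distrib)
qed

end

section \<open>Monic polynomials with integral coefficients split\<close>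

context Cp
begin

lemma coeff_mult_ge:
  assumes "\<And>i. c \<le> v (coeff P i)" "\<And>i. 0 \<le> v (coeff Q i)"
  shows "c \<le> v (coeff (P * Q) i)"
  unfolding coeff_mult by (intro v_sum_ge v_mult_ge_left assms)

lemma poly_ge:
  assumes "\<And>i. c \<le> v (coeff P i)" "0 \<le> v x"
  shows "c \<le> v (poly P x)"
  unfolding poly_altdef by (intro v_sum_ge v_mult_ge_left v_power_nonneg assms)

lemma poly_lipschitz:
  assumes "\<And>i. 0 \<le> v (coeff P i)" "0 \<le> v x" "0 \<le> v y"
  shows "v (x - y) \<le> v (poly P x - poly P y)"
  using assms(1)
proof (induction P)
  case (pCons a P)
  have P: "0 \<le> v (coeff P i)" for i using pCons.prems[of "Suc i"] by simp
  have "v (x - y) \<le> v (x * (poly P x - poly P y) + (x - y) * poly P y)"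
    using P by (intro v_add_ge v_mult_ge_left v_mult_ge_right pCons.IH poly_ge assms) auto
  then show ?case by (simp add: algebra_simps)
qed simp

text \<open>
  Otherwise the leading term \<open>r ^ degree P\<close> would have strictly smaller valuation than each of
  the other terms, and \<open>poly P r\<close> could not vanish.
\<close>

lemma monic_root_dominated:
  assumes "lead_coeff P = 1" "poly P r = 0"
  shows "\<exists>i<degree P. v (coeff P i * r ^ i) \<le> v (r ^ degree P)"
proof (rule ccontr)
  assume *: "\<not> ?thesis"
  have d: "degree P \<noteq> 0" using assms by (cases "degree P = 0") (auto elim: degree_eq_zeroE)
  with * have "r \<noteq> 0" by (force simp: zero_power)
  then obtain t where t: "v (r ^ degree P) = ereal t" using v_real[of "r ^ degree P"] by auto
  have "v (r ^ degree P) < v (- (\<Sum>i<degree P. coeff P i * r ^ i))"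
    unfolding v_minus using * t by (intro v_sum_gt) auto
  moreover have "0 = (\<Sum>i<degree P. coeff P i * r ^ i) + r ^ degree P"
    using assms by (simp add: poly_altdef lessThan_Suc_atMost[symmetric])
  ultimately show False by (metis add_eq_0_iff minus_minus less_irrefl)
qed

lemma monic_root_integral:
  assumes "lead_coeff P = 1" "\<And>i. 0 \<le> v (coeff P i)" "poly P r = 0"
  shows "0 \<le> v r"
proof (rule ccontr)
  assume "\<not> 0 \<le> v r"
  then have r: "v r < 0" by simp
  obtain i where i: "i < degree P" "v (coeff P i * r ^ i) \<le> v (r ^ degree P)"
    using monic_root_dominated assms by blast
  have "r \<noteq> 0" using r by auto
  then obtain t where t: "v r = ereal t" by (rule v_real)
  have "v (r ^ i) \<le> v (coeff P i * r ^ i)" using assms by (intro v_mult_ge_right) auto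
  also note i(2)
  finally have "real i * t \<le> real (degree P) * t" using t by (simp add: v_power)
  moreover have "t < 0" using r t by simp
  ultimately show False using i(1) by simp
qed

lemma monic_root_maximal:
  assumes "lead_coeff P = 1" "\<And>i. 0 \<le> v (coeff P i)" "\<And>i. i < degree P \<Longrightarrow> 0 < v (coeff P i)"
    "poly P r = 0"
  shows "0 < v r"
proof (rule ccontr)
  assume "\<not> 0 < v r"
  then have "v r = 0" using monic_root_integral[of P r] assms by force
  obtain i where i: "i < degree P" "v (coeff P i * r ^ i) \<le> v (r ^ degree P)"
    using monic_root_dominated assms by blast
  then have "v (coeff P i) \<le> 0" using \<open>v r = 0\<close> by (simp add: v_mult v_power)
  then show False using assms(3)[OF i(1)] by simp
qed

text \<open>
  By Horner's recursion each coefficient of the quotient is a coefficient of \<open>P\<close> plus \<open>r\<close> times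
  the next higher coefficient of the quotient, so integrality descends from the top.
\<close>

lemma monic_divide_root:
  assumes "lead_coeff P = 1" "degree P = Suc n" "\<And>i. 0 \<le> v (coeff P i)" "poly P r = 0"
  obtains Q where "P = [:-r, 1:] * Q" "lead_coeff Q = 1" "degree Q = n" "\<And>i. 0 \<le> v (coeff Q i)"
proof -
  obtain Q where Q: "P = [:-r, 1:] * Q" using assms(4) poly_eq_0_iff_dvd by (metis dvdE)
  have "Q \<noteq> 0" using Q assms(2) by auto
  then have d: "degree Q = n" using assms(2) unfolding Q by (subst (asm) degree_mult_eq) auto
  have l: "lead_coeff Q = 1" using assms(1) unfolding Q lead_coeff_mult by simp
  have r: "0 \<le> v r" using monic_root_integral assms by blast
  have rec: "coeff Q i = coeff P (Suc i) + r * coeff Q (Suc i)" for i unfolding Q by simp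
  have "\<forall>i. n < i + k \<longrightarrow> 0 \<le> v (coeff Q i)" for k
  proof (induction k)
    case 0 then show ?case using d by (simp add: coeff_eq_0)
  next
    case (Suc k)
    show ?case
    proof (intro allI impI)
      fix i assume "n < i + Suc k"
      then have "0 \<le> v (coeff Q (Suc i))" using Suc by simp
      then show "0 \<le> v (coeff Q i)"
        unfolding rec[of i] using assms(3) r by (intro v_add_ge v_mult_nonneg) auto
    qed
  qed
  from this[of "Suc n"] have "0 \<le> v (coeff Q i)" for i by auto
  then show ?thesis using that Q l d by blast
qed

abbreviation (input) linear_prod :: "'a list \<Rightarrow> 'a poly" where
  "linear_prod zs \<equiv> (\<Prod>z\<leftarrow>zs. [:-z, 1:])"

lemma linear_prod_integral:
  assumes "\<forall>z\<in>set zs. 0 \<le> v z" shows "0 \<le> v (coeff (linear_prod zs) i)"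
  using assms
proof (induction zs arbitrary: i)
  case (Cons z zs)
  have "0 \<le> v (coeff [:-z, 1:] i)" for i
    using Cons.prems by (auto simp: coeff_pCons split: nat.splits)
  then show ?case using Cons by (simp only: list.map prod_list.Cons) (intro coeff_mult_ge, auto)
qed (auto simp: coeff_1)

lemma Rats_subset_Qp_bar: "\<rat> \<subseteq> (Qp_bar :: 'a set)"
proof
  fix x :: 'a assume x: "x \<in> \<rat>"
  have sub: "\<rat> \<subseteq> (Qp :: 'a set)" unfolding Qp_def by (rule closure_subset)
  have "coeff [:-x, 1:] i \<in> \<rat>" for i
    using x by (auto simp: coeff_pCons split: nat.splits)
  then have "\<forall>i. coeff [:-x, 1:] i \<in> Qp" using sub by blast
  moreover have "poly [:-x, 1:] x = 0" "[:-x, 1:] \<noteq> 0" by auto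
  ultimately show "x \<in> Qp_bar" unfolding Qp_bar_def by blast
qed

text \<open>
  The hypothesis on \<open>Qp_bar\<close> provides a root only for polynomials with coefficients in \<open>Qp_bar\<close>,
  and the quotient by the linear factor of a root need not visibly have such coefficients. It is
  therefore replaced by a new approximation after every division. Since all factors are integral,
  the errors are not enlarged.
\<close>

lemma approximate_splitting:
  assumes "lead_coeff P = 1" "degree P = n" "\<And>i. 0 \<le> v (coeff P i)"
  shows "\<exists>zs. length zs = n \<and> (\<forall>z\<in>set zs. 0 \<le> v z) \<and>
           (\<forall>i. ereal (real N) \<le> v (coeff (P - linear_prod zs) i))"
  using assms
proof (induction n arbitrary: P)
  case 0
  then have "P = 1" by (metis degree_0_id one_pCons degree_eq_zeroE coeff_pCons_0)
  then show ?case by (intro exI[of _ "[]"]) auto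
next
  case (Suc n)
  have "\<exists>y\<in>Qp_bar. ereal (real N) \<le> v (coeff P i - y)" for i
    using Qp_bar_dense closure_iff_v[of "coeff P i" Qp_bar] by auto
  then obtain y where y: "\<And>i. y i \<in> Qp_bar" "\<And>i. ereal (real N) \<le> v (coeff P i - y i)" by metis
  define P' where "P' = Poly (map y [0..<Suc n] @ [1])"
  have c: "coeff P' i = (if i < Suc n then y i else if i = Suc n then 1 else 0)" for i
    unfolding P'_def coeff_Poly_eq by (auto simp: nth_default_def nth_append less_Suc_eq)
  have cP: "coeff P (Suc n) = 1" using Suc.prems by simp
  have diff: "ereal (real N) \<le> v (coeff (P - P') i)" for i
  proof -
    consider "i < Suc n" | "i = Suc n" | "i > Suc n" by linarith
    then show ?thesis
    proof cases
      case 3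
      then have "coeff P i = 0" using Suc.prems by (simp add: coeff_eq_0)
      with 3 show ?thesis by (simp add: c)
    qed (use y cP in \<open>auto simp: c\<close>)
  qed
  have N0: "(0::ereal) \<le> ereal (real N)" by simp
  have int': "0 \<le> v (coeff P' i)" for i
    using v_diff_ge[of 0 "coeff P i" "coeff (P - P') i"] Suc.prems(3) order_trans[OF N0 diff] by simp
  have deg': "degree P' = Suc n"
    by (rule antisym) (auto intro!: degree_le le_degree simp: c)
  have mon': "lead_coeff P' = 1" unfolding deg' by (simp add: c)
  have "\<And>i. coeff P' i \<in> Qp_bar"
    using y Rats_subset_Qp_bar by (auto simp: c)
  then obtain r where r: "poly P' r = 0" using Qp_bar_alg_closed[of P'] deg' by auto
  obtain Q where Q: "P' = [:-r, 1:] * Q" "lead_coeff Q = 1" "degree Q = n" "\<And>i. 0 \<le> v (coeff Q i)"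
    using monic_divide_root[OF mon' deg' int' r] by blast
  obtain zs where zs: "length zs = n" "\<forall>z\<in>set zs. 0 \<le> v z"
      "\<And>i. ereal (real N) \<le> v (coeff (Q - linear_prod zs) i)"
    using Suc.IH[OF Q(2,3,4)] by blast
  have r0: "0 \<le> v r" using monic_root_integral[OF mon' int' r] .
  then have r1: "0 \<le> v (coeff [:-r, 1:] i)" for i by (auto simp: coeff_pCons split: nat.splits)
  have "ereal (real N) \<le> v (coeff ((P - P') + (Q - linear_prod zs) * [:-r, 1:]) i)" for i
    unfolding coeff_add by (intro v_add_ge diff coeff_mult_ge zs r1)
  moreover have "(P - P') + (Q - linear_prod zs) * [:-r, 1:] = P - linear_prod (r # zs)"
    unfolding Q(1) list.map prod_list.Cons by (simp only: algebra_simps)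
  ultimately have "\<And>i. ereal (real N) \<le> v (coeff (P - linear_prod (r # zs)) i)" by metis
  then show ?case using zs r0 by (intro exI[of _ "r # zs"]) auto
qed

text \<open>
  Used in contraposition: where the product is small, one of the roots is near.
\<close>

lemma v_linear_prod_far:
  assumes "zs \<noteq> []" "\<And>z. z \<in> set zs \<Longrightarrow> v (x - z) < ereal k"
  shows "v (poly (linear_prod zs) x) < ereal (real (length zs) * k)"
  using assms
proof (induction zs)
  case (Cons z zs)
  have ne: "x \<noteq> z" using Cons.prems by force
  then obtain t where t: "v (x - z) = ereal t" using v_real[of "x - z"] by auto
  have eq: "v (poly (linear_prod (z # zs)) x) = v (x - z) + v (poly (linear_prod zs) x)"
    by (simp add: v_mult[symmetric] algebra_simps)
  show ?case
  proof (cases "zs = []")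
    case True then show ?thesis using Cons.prems by simp
  next
    case False
    then have "v (poly (linear_prod zs) x) < ereal (real (length zs) * k)" using Cons by auto
    moreover have "v (x - z) < ereal k" using Cons.prems by simp
    ultimately have "v (x - z) + v (poly (linear_prod zs) x) < ereal k + ereal (real (length zs) * k)"
      using t by (cases "v (poly (linear_prod zs) x)") auto
    then show ?thesis unfolding eq by (simp add: algebra_simps)
  qed
qed simp

text \<open>
  The root is a limit of roots of approximate splittings with increasing precision. A value of
  precision \<open>Suc n * k\<close> at \<open>x\<close> forces one of the \<open>Suc n\<close> roots of the next splitting to be at
  distance of precision \<open>k\<close> from \<open>x\<close>, so these roots can be chosen to form a Cauchy sequence.
\<close>

lemma monic_integral_has_root:
  assumes "lead_coeff P = 1" "degree P = Suc n" "\<And>i. 0 \<le> v (coeff P i)"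
  shows "\<exists>z. poly P z = 0"
proof -
  define L where "L k = real (Suc n * k)" for k
  \<comment> \<open>\<open>z\<close> is a root up to an error of valuation at least \<open>Suc n * k\<close>.\<close>
  define good where "good k z \<longleftrightarrow> 0 \<le> v z \<and> ereal (L k) \<le> v (poly P z)" for k z
  have "\<exists>s. \<forall>k. good k (s k) \<and> ereal (real k) \<le> v (s (Suc k) - s k)"
  proof (rule dependent_nat_choice)
    show "\<exists>x. good 0 x"
      by (rule exI[of _ 0]) (auto simp: good_def L_def zero_ereal_def[symmetric] intro: poly_ge assms)
  next
    fix x k assume x: "good k x"
    obtain zs where zs: "length zs = Suc n" "\<forall>z\<in>set zs. 0 \<le> v z"
      "\<And>i. ereal (L (Suc k)) \<le> v (coeff (P - linear_prod zs) i)"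
      using approximate_splitting[OF assms, of "Suc n * Suc k"] unfolding L_def by blast
    have err: "ereal (L (Suc k)) \<le> v (poly P z - poly (linear_prod zs) z)" if "0 \<le> v z" for z
      using poly_ge[OF zs(3) that] by simp
    have "L k \<le> L (Suc k)" by (simp add: L_def)
    have "ereal (L k) \<le> v (poly P x - (poly P x - poly (linear_prod zs) x))"
    proof (rule v_diff_ge)
      show "ereal (L k) \<le> v (poly P x)" using x by (simp add: good_def)
      have "ereal (L k) \<le> ereal (L (Suc k))" using \<open>L k \<le> L (Suc k)\<close> by simp
      then show "ereal (L k) \<le> v (poly P x - poly (linear_prod zs) x)"
        using err x good_def order_trans by blast
    qed
    then have close: "ereal (L k) \<le> v (poly (linear_prod zs) x)" by simp
    have "\<exists>z\<in>set zs. ereal (real k) \<le> v (x - z)"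
    proof (rule ccontr)
      assume "\<not> ?thesis"
      then have "v (poly (linear_prod zs) x) < ereal (real (length zs) * real k)"
        using zs(1) by (intro v_linear_prod_far) (auto simp: not_le)
      then show False using close zs(1) unfolding L_def of_nat_mult by simp
    qed
    then obtain z where z: "z \<in> set zs" "ereal (real k) \<le> v (x - z)" by blast
    have "poly (linear_prod zs) z = 0" using z(1) by (induction zs) auto
    then have "good (Suc k) z" unfolding good_def using err[of z] zs(2) z(1) by auto
    then show "\<exists>y. good (Suc k) y \<and> ereal (real k) \<le> v (y - x)"
      using z(2) v_minus_commute[of x z] by auto
  qed
  then obtain s where s: "\<And>k. good k (s k)" "\<And>k. ereal (real k) \<le> v (s (Suc k) - s k)" by blast
  have "\<exists>z. s \<longlonglongrightarrow> z"
  proof (rule convergent_if_steps)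
    fix N :: nat
    show "\<forall>\<^sub>F k in sequentially. ereal (real N) \<le> v (s (Suc k) - s k)"
      unfolding eventually_sequentially
      using s(2) by (intro exI[of _ N] allI impI) (meson ereal_less_eq(3) of_nat_le_iff order_trans)
  qed
  then obtain z where z: "s \<longlonglongrightarrow> z" by blast
  have z0: "0 \<le> v z"
    using tendsto_v_ge[OF z, of 0 0] s(1) by (simp add: good_def)
  have "poly P z = 0"
  proof (rule eq_zero_if_v_ge)
    fix N :: nat
    have "\<forall>\<^sub>F k in sequentially. ereal (real N) \<le> v (s k - z)" using z tendsto_iff_v by blast
    then obtain k where k: "k \<ge> N" "ereal (real N) \<le> v (s k - z)"
      unfolding eventually_sequentially by (meson nat_le_linear order_refl)
    have "ereal (real N) \<le> v (poly P (s k) - (poly P (s k) - poly P z))"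
    proof (rule v_diff_ge)
      have "N \<le> Suc n * k" using k(1) by simp
      then have "real N \<le> L k" unfolding L_def by linarith
      then show "ereal (real N) \<le> v (poly P (s k))"
        using s(1)[of k] unfolding good_def by (meson ereal_less_eq(3) order_trans)
      show "ereal (real N) \<le> v (poly P (s k) - poly P z)"
        using poly_lipschitz[OF assms(3), of "s k" z] s(1)[of k] z0 k(2) order_trans
        unfolding good_def by blast
    qed
    then show "ereal (real N) \<le> v (poly P z)" by simp
  qed
  then show ?thesis by blast
qed

lemma monic_integral_splits:
  assumes "lead_coeff P = 1" "degree P = n" "\<And>i. 0 \<le> v (coeff P i)"
  shows "\<exists>zs. length zs = n \<and> P = linear_prod zs"
  using assms
proof (induction n arbitrary: P)
  case 0
  then have "P = 1" by (metis degree_0_id one_pCons degree_eq_zeroE coeff_pCons_0)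
  then show ?case by (intro exI[of _ "[]"]) auto
next
  case (Suc n)
  obtain z where z: "poly P z = 0" using monic_integral_has_root[OF Suc.prems] by blast
  obtain Q where Q: "P = [:-z, 1:] * Q" "lead_coeff Q = 1" "degree Q = n" "\<And>i. 0 \<le> v (coeff Q i)"
    using monic_divide_root[OF Suc.prems z] by blast
  obtain zs where "length zs = n" "Q = linear_prod zs" using Suc.IH[OF Q(2,3,4)] by blast
  then show ?case using Q(1) by (intro exI[of _ "z # zs"]) auto
qed

end

section \<open>Weierstrass preparation on the open disc\<close>

context Cp
begin

text \<open>
  All but finitely many terms have valuation at least one.
\<close>

lemma null_uniformly_positive:
  assumes "null s" "\<And>i. 0 < v (s i)"
  obtains eps :: real where "0 < eps" "\<And>i. ereal eps \<le> v (s i)"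
proof -
  obtain M where M: "\<And>n. n \<ge> M \<Longrightarrow> ereal (real 1) \<le> v (s n)"
    using assms(1) unfolding null_def eventually_sequentially by blast
  have "\<exists>eps>0. \<forall>n<M. ereal eps \<le> v (s n)"
  proof (induction M)
    case (Suc M)
    then obtain c where c: "0 < c" "\<forall>n<M. ereal c \<le> v (s n)" by blast
    obtain d :: real where d: "0 < ereal d" "ereal d < v (s M)"
      using ereal_dense2[OF assms(2)[of M]] by blast
    have "ereal (min c d) \<le> v (s n)" if "n < Suc M" for n
    proof (cases "n = M")
      case True
      have "ereal (min c d) \<le> ereal d" by simp
      also have "\<dots> \<le> v (s M)" using d by simp
      finally show ?thesis using True by simp
    next
      case False
      have "ereal (min c d) \<le> ereal c" by simp
      also have "\<dots> \<le> v (s n)" using c False that by auto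
      finally show ?thesis .
    qed
    then show ?case using c d by (intro exI[of _ "min c d"]) auto
  qed (auto intro: exI[of _ 1])
  then obtain c where c: "0 < c" "\<forall>n<M. ereal c \<le> v (s n)" by blast
  have "ereal (min c 1) \<le> v (s i)" for i
  proof (cases "i < M")
    case True
    have "ereal (min c 1) \<le> ereal c" by simp
    then show ?thesis using True c order_trans by blast
  next
    case False
    have "ereal (min c 1) \<le> ereal (real 1)" by simp
    then show ?thesis using False M order_trans not_le by blast
  qed
  then show ?thesis using that[of "min c 1"] c by simp
qed

lemma v_suminf_unit:
  assumes "null s" "v (s 0) = 0" "\<And>i. i > 0 \<Longrightarrow> 0 < v (s i)"
  shows "v (suminf s) = 0"
proof -
  have n: "null (\<lambda>i. s (Suc i))" using null_shift[OF assms(1), of 1] by simp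
  obtain eps :: real where eps: "0 < eps" "\<And>i. ereal eps \<le> v (s (Suc i))"
    using null_uniformly_positive[OF n] assms(3) by blast
  have "ereal eps \<le> v (suminf (\<lambda>i. s (Suc i)))" by (rule v_suminf_ge[OF n eps(2)])
  then have "v (s 0) < v (suminf (\<lambda>i. s (Suc i)))" using eps(1) assms(2)
    by (metis ereal_less(2) less_le_trans)
  then show ?thesis using suminf_head_v[OF assms(1)] v_add_eq assms(2) by simp
qed

lemma fps_mult_ge:
  assumes "\<And>i. ereal c \<le> v (fps_nth g i)" "\<And>i. ereal d \<le> v (fps_nth h i)"
  shows "ereal (c + d) \<le> v (fps_nth (g * h) i)"
  unfolding fps_mult_nth by (intro v_sum_ge v_mult_ge assms)

lemma fps_mult_integral:
  assumes "\<And>i. 0 \<le> v (fps_nth g i)" "\<And>i. 0 \<le> v (fps_nth h i)"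
  shows "0 \<le> v (fps_nth (g * h) i)"
  unfolding fps_mult_nth by (intro v_sum_ge v_mult_nonneg assms)

lemma null_fps_mult:
  assumes "null (fps_nth g)" "null (fps_nth h)"
  shows "null (fps_nth (g * h))"
proof -
  obtain c1 where c1: "c1 \<le> 0" "\<And>n. ereal c1 \<le> v (fps_nth g n)" using null_bounded[OF assms(1)] by blast
  obtain c2 where c2: "c2 \<le> 0" "\<And>n. ereal c2 \<le> v (fps_nth h n)" using null_bounded[OF assms(2)] by blast
  show ?thesis unfolding null_def
  proof
    fix N :: nat
    obtain L :: nat where L: "real N - c1 - c2 < real L" using reals_Archimedean2 by blast
    obtain M1 where M1: "\<And>n. n \<ge> M1 \<Longrightarrow> ereal (real L) \<le> v (fps_nth g n)"
      using assms(1) unfolding null_def eventually_sequentially by blast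
    obtain M2 where M2: "\<And>n. n \<ge> M2 \<Longrightarrow> ereal (real L) \<le> v (fps_nth h n)"
      using assms(2) unfolding null_def eventually_sequentially by blast
    show "\<forall>\<^sub>F n in sequentially. ereal (real N) \<le> v (fps_nth (g * h) n)"
      unfolding eventually_sequentially
    proof (intro exI[of _ "M1 + M2"] allI impI)
      fix n assume n: "M1 + M2 \<le> n"
      show "ereal (real N) \<le> v (fps_nth (g * h) n)"
        unfolding fps_mult_nth
      proof (rule v_sum_ge)
        fix i assume "i \<in> {0..n}"
        then consider "M1 \<le> i" | "M2 \<le> n - i" using n by fastforce
        then show "ereal (real N) \<le> v (fps_nth g i * fps_nth h (n - i))"
        proof cases
          case 1
          then have "ereal (real L + c2) \<le> v (fps_nth g i * fps_nth h (n - i))"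
            using M1 c2 by (intro v_mult_ge) auto
          moreover have "ereal (real N) \<le> ereal (real L + c2)" using L c1 by simp
          ultimately show ?thesis by (rule order_trans[rotated])
        next
          case 2
          then have "ereal (c1 + real L) \<le> v (fps_nth g i * fps_nth h (n - i))"
            using M2 c1 by (intro v_mult_ge) auto
          moreover have "ereal (real N) \<le> ereal (c1 + real L)" using L c2 by simp
          ultimately show ?thesis by (rule order_trans[rotated])
        qed
      qed
    qed
  qed
qed

lemma integral_inverse:
  assumes "\<And>i. 0 \<le> v (fps_nth U i)" "v (fps_nth U 0) = 0"
  shows "0 \<le> v (fps_nth (inverse U) i)"
proof (induction i rule: less_induct)
  case (less n)
  have U0: "fps_nth U 0 \<noteq> 0" using assms(2) by auto
  have "fps_nth (U * inverse U) n = (if n = 0 then 1 else 0)"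
    using U0 by (simp add: inverse_mult_eq_1')
  then have "fps_nth U 0 * fps_nth (inverse U) n
      = (if n = 0 then 1 else 0) - (\<Sum>i=1..n. fps_nth U i * fps_nth (inverse U) (n - i))"
    by (simp add: fps_mult_nth sum.atLeast_Suc_atMost eq_diff_eq)
  moreover have "0 \<le> v ((if n = 0 then 1 else 0) - (\<Sum>i=1..n. fps_nth U i * fps_nth (inverse U) (n - i)))"
    by (intro v_diff_ge v_sum_ge v_mult_nonneg assms less) auto
  ultimately have "0 \<le> v (fps_nth U 0 * fps_nth (inverse U) n)" by simp
  then show ?case using assms(2) by (simp add: v_mult)
qed

text \<open>
  Banach's fixed point theorem for the map that sends \<open>Z\<close> to \<open>1 - T Z\<close>, in the supremum norm on
  the coefficients. It is applied to the space of all series and to the space of series whose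
  coefficients tend to zero. That \<open>T\<close> commutes with limits is a consequence of the contraction
  property for differences.
\<close>

lemma fixed_point:
  fixes E :: "'a fps set"
  assumes eps: "0 < eps" and one: "1 \<in> E"
    and diff: "\<And>g h. g \<in> E \<Longrightarrow> h \<in> E \<Longrightarrow> g - h \<in> E"
    and closed: "\<And>g. (\<And>N::nat. \<exists>h\<in>E. \<forall>i. ereal (real N) \<le> v (fps_nth (g - h) i)) \<Longrightarrow> g \<in> E"
    and TE: "\<And>h. h \<in> E \<Longrightarrow> T h \<in> E"
    and Tdiff: "\<And>g h. g \<in> E \<Longrightarrow> h \<in> E \<Longrightarrow> T (g - h) = T g - T h"
    and contr: "\<And>h c i. h \<in> E \<Longrightarrow> (\<And>i. ereal c \<le> v (fps_nth h i)) \<Longrightarrow> ereal (c + eps) \<le> v (fps_nth (T h) i)"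
  obtains Z where "Z \<in> E" "Z + T Z = 1" "\<And>i. ereal eps \<le> v (fps_nth (Z - 1) i)"
proof -
  define s where "s = rec_nat (1::'a fps) (\<lambda>_ h. 1 - T h)"
  have s0: "s 0 = 1" and sS: "\<And>k. s (Suc k) = 1 - T (s k)" by (auto simp: s_def)
  have sE: "s k \<in> E" for k by (induction k) (auto simp: s0 sS intro: one diff TE)
  have step: "ereal (real (Suc k) * eps) \<le> v (fps_nth (s (Suc k) - s k) i)" for k i
  proof (induction k arbitrary: i)
    case 0
    have "ereal (0 + eps) \<le> v (fps_nth (T 1) i)" by (intro contr one) simp
    then show ?case by (simp add: s0 sS)
  next
    case (Suc k)
    have "ereal (real (Suc k) * eps + eps) \<le> v (fps_nth (T (s (Suc k) - s k)) i)"
      by (intro contr diff sE Suc)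
    also have "T (s (Suc k) - s k) = - (s (Suc (Suc k)) - s (Suc k))"
      unfolding sS[of "Suc k"] by (subst (3) sS) (simp add: Tdiff sE)
    finally show ?case by (simp only: fps_neg_nth v_minus) (simp add: algebra_simps)
  qed
  have mono: "ereal (real (Suc k) * eps) \<le> v (fps_nth (s (k + j)) i - fps_nth (s k) i)" for k j i
  proof (induction j)
    case (Suc j)
    have "real (Suc k) * eps \<le> real (Suc (k + j)) * eps" using eps by (intro mult_right_mono) auto
    then have "ereal (real (Suc k) * eps) \<le> ereal (real (Suc (k + j)) * eps)" by simp
    also have "\<dots> \<le> v (fps_nth (s (Suc (k + j))) i - fps_nth (s (k + j)) i)"
      using step[of "k + j" i] by simp
    finally have "ereal (real (Suc k) * eps) \<le> v (fps_nth (s (Suc (k + j))) i - fps_nth (s (k + j)) i)" .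
    from v_add_ge[OF this Suc] show ?case by simp
  qed simp
  have large: "\<exists>k. real N \<le> real (Suc k) * eps" for N
  proof -
    obtain k :: nat where "real N < real k * eps" using reals_Archimedean3[OF eps] by blast
    also have "\<dots> \<le> real (Suc k) * eps" using eps by (intro mult_right_mono) auto
    finally show ?thesis by (intro exI[of _ k]) simp
  qed
  have "\<exists>l. (\<lambda>k. fps_nth (s k) i) \<longlonglongrightarrow> l" for i
  proof (rule convergent_if_steps)
    fix N :: nat
    obtain k0 where k0: "real N \<le> real (Suc k0) * eps" using large by blast
    show "\<forall>\<^sub>F k in sequentially. ereal (real N) \<le> v (fps_nth (s (Suc k)) i - fps_nth (s k) i)"
      unfolding eventually_sequentially
    proof (intro exI[of _ k0] allI impI)
      fix k assume "k0 \<le> k"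
      then have "real (Suc k0) * eps \<le> real (Suc k) * eps" using eps by (intro mult_right_mono) auto
      with k0 have "ereal (real N) \<le> ereal (real (Suc k) * eps)" by simp
      also have "\<dots> \<le> v (fps_nth (s (Suc k)) i - fps_nth (s k) i)" using step[of k i] by simp
      finally show "ereal (real N) \<le> v (fps_nth (s (Suc k)) i - fps_nth (s k) i)" .
    qed
  qed
  then obtain z where z: "\<And>i. (\<lambda>k. fps_nth (s k) i) \<longlonglongrightarrow> z i" by metis
  define Z where "Z = Abs_fps z"
  have Zs: "ereal (real (Suc k) * eps) \<le> v (fps_nth (Z - s k) i)" for k i
  proof -
    have "\<forall>\<^sub>F n in sequentially. ereal (real (Suc k) * eps) \<le> v (fps_nth (s n) i - fps_nth (s k) i)"
      unfolding eventually_sequentially using mono[of k _ i] le_Suc_ex by (metis add.commute)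
    from tendsto_v_ge[OF z this] show ?thesis by (simp add: Z_def)
  qed
  have ZE: "Z \<in> E"
  proof (rule closed)
    fix N :: nat
    obtain k where k: "real N \<le> real (Suc k) * eps" using large by blast
    have "\<forall>i. ereal (real N) \<le> v (fps_nth (Z - s k) i)"
      using Zs[of k] k by (meson ereal_less_eq(3) order_trans)
    then show "\<exists>h\<in>E. \<forall>i. ereal (real N) \<le> v (fps_nth (Z - h) i)" using sE by blast
  qed
  have "Z + T Z - 1 = 0"
  proof (rule fps_ext)
    fix i
    have "fps_nth (Z + T Z - 1) i = 0"
    proof (rule eq_zero_if_v_ge)
      fix N :: nat
      obtain k where k: "real N \<le> real (Suc k) * eps" using large by blast
      have eq: "Z + T Z - 1 = (Z - s (Suc k)) + T (Z - s k)"
        unfolding Tdiff[OF ZE sE] sS by simp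
      have "ereal (real (Suc k) * eps + eps) \<le> v (fps_nth (T (Z - s k)) i)"
        by (intro contr diff ZE sE Zs)
      moreover have "ereal (real (Suc k) * eps + eps) \<le> v (fps_nth (Z - s (Suc k)) i)"
        using Zs[of "Suc k" i] by (simp add: algebra_simps)
      ultimately have "ereal (real (Suc k) * eps + eps) \<le> v (fps_nth (Z + T Z - 1) i)"
        unfolding eq fps_add_nth by (intro v_add_ge)
      moreover have "ereal (real N) \<le> ereal (real (Suc k) * eps + eps)" using k eps by simp
      ultimately show "ereal (real N) \<le> v (fps_nth (Z + T Z - 1) i)" by (rule order_trans[rotated])
    qed
    then show "fps_nth (Z + T Z - 1) i = fps_nth 0 i" by simp
  qed
  then have "Z + T Z = 1" by simp
  moreover have "\<And>i. ereal eps \<le> v (fps_nth (Z - 1) i)" using Zs[of 0] by (simp add: s0)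
  ultimately show ?thesis using that ZE by blast
qed

lemma fps_is_monic_poly:
  fixes g :: "'a fps"
  assumes "fps_nth g n = 1" "\<And>i. i > n \<Longrightarrow> fps_nth g i = 0"
  obtains P where "fps_of_poly P = g" "degree P = n" "lead_coeff P = 1"
proof -
  define P where "P = (\<Sum>i\<le>n. monom (fps_nth g i) i)"
  have c: "coeff P i = fps_nth g i" for i
    unfolding P_def coeff_sum using assms(2)[of i] by (cases "i \<le> n") (auto simp: sum.If_cases)
  have "degree P = n"
    by (rule antisym) (auto intro!: degree_le le_degree simp: c assms)
  moreover from this have "lead_coeff P = 1" by (simp add: c assms)
  moreover have "fps_of_poly P = g" by (rule fps_ext) (simp add: c)
  ultimately show ?thesis using that by blast
qed

text \<open>
  Split \<open>F = A + U * fps_X ^ n\<close>: the finitely many coefficients of \<open>A\<close> are uniformly small, and \<open>U\<close>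
  is invertible over the integral series. A multiple \<open>q * F\<close> is a monic polynomial of degree \<open>n\<close>
  exactly if its part from degree \<open>n\<close> on is \<open>1\<close>. In terms of \<open>Z = q * U\<close> this condition is
  \<open>Z + fps_shift n (Z * A / U) = 1\<close>, a fixed point equation with a contraction. The lower
  coefficients of the polynomial are small, so its roots lie in the open disc.
\<close>

lemma Weierstrass_open:
  assumes int: "\<And>i. 0 \<le> v (fps_nth F i)" and low: "\<And>i. i < n \<Longrightarrow> 0 < v (fps_nth F i)"
    and unit: "v (fps_nth F n) = 0"
  obtains zs V where "length zs = n" "\<And>z. z \<in> set zs \<Longrightarrow> 0 < v z"
    "F = fps_of_poly (linear_prod zs) * V" "\<And>i. 0 \<le> v (fps_nth V i)" "v (fps_nth V 0) = 0"
proof -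
  define A where "A = fps_cutoff n F"
  define U where "U = fps_shift n F"
  have F: "F = A + U * fps_X ^ n" unfolding A_def U_def
    using fps_shift_cutoff[of n F] by (simp only: add.commute)
  have U: "\<And>i. 0 \<le> v (fps_nth U i)" "v (fps_nth U 0) = 0" using int unit by (auto simp: U_def)
  then have U0: "fps_nth U 0 \<noteq> 0" by auto
  note iU = integral_inverse[OF U]
  have UU: "U * inverse U = 1" using U0 by (rule inverse_mult_eq_1')
  have "null (fps_nth A)" unfolding null_def eventually_sequentially A_def
    by (intro allI exI[of _ n]) auto
  moreover have "0 < v (fps_nth A i)" for i using low by (simp add: A_def)
  ultimately obtain eps where eps: "0 < eps" "\<And>i. ereal eps \<le> v (fps_nth A i)"
    by (rule null_uniformly_positive) blast
  \<comment> \<open>\<open>A * inverse U\<close> is small, so \<open>T\<close> is a contraction.\<close>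
  define T where "T h = fps_shift n (h * (A * inverse U))" for h
  have AU: "ereal (eps + 0) \<le> v (fps_nth (A * inverse U) i)" for i
    using iU eps by (intro fps_mult_ge) (auto simp: zero_ereal_def)
  obtain Z where Z: "Z + T Z = 1" "\<And>i. ereal eps \<le> v (fps_nth (Z - 1) i)"
  proof (rule fixed_point[of eps UNIV T])
    show "T (g - h) = T g - T h" for g h unfolding T_def by (rule fps_ext) (simp add: left_diff_distrib)
    show "ereal (c + eps) \<le> v (fps_nth (T h) i)" if "\<And>i. ereal c \<le> v (fps_nth h i)" for h c i
      unfolding T_def using fps_mult_ge[OF that, of "eps + 0" "A * inverse U" "i + n"] AU by simp
  qed (use eps in auto)
  have Zint: "0 \<le> v (fps_nth Z i)" for i
  proof -
    have "0 \<le> v (fps_nth (Z - 1) i + fps_nth 1 i)"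
      using Z(2)[of i] eps(1) by (intro v_add_ge) (auto intro: order_trans[of _ "ereal eps"])
    then show ?thesis by simp
  qed
  have Z0: "v (fps_nth Z 0) = 0"
  proof -
    have "v (1::'a) < v (fps_nth (Z - 1) 0)"
      using eps(1) Z(2)[of 0] by (metis ereal_less(2) less_le_trans v_one)
    then show ?thesis using v_add_eq[of 1 "fps_nth (Z - 1) 0"] by simp
  qed
  define q where "q = Z * inverse U"
  have qint: "\<And>i. 0 \<le> v (fps_nth q i)" unfolding q_def by (intro fps_mult_integral Zint iU)
  have q0: "v (fps_nth q 0) = 0" using Z0 v_inverse_unit[OF U(2)] U0 by (simp add: q_def v_mult)
  have qF: "q * F = Z * (A * inverse U) + Z * fps_X ^ n"
  proof -
    have "q * F = Z * (A * inverse U) + Z * (U * inverse U) * fps_X ^ n"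
      unfolding q_def by (subst F) (simp only: algebra_simps)
    then show ?thesis by (simp add: UU)
  qed
  have "fps_shift n (q * F) = 1"
    unfolding qF using Z(1) by (simp add: T_def fps_shift_add add.commute)
  then have sh: "fps_nth (q * F) (i + n) = (if i = 0 then 1 else 0)" for i
    by (metis fps_one_nth fps_shift_nth)
  obtain P where P: "fps_of_poly P = q * F" "degree P = n" "lead_coeff P = 1"
  proof (rule fps_is_monic_poly)
    show "fps_nth (q * F) n = 1" using sh[of 0] by simp
    show "fps_nth (q * F) i = 0" if "i > n" for i using sh[of "i - n"] that by simp
  qed blast
  have cP: "coeff P i = fps_nth (q * F) i" for i by (metis P(1) fps_of_poly_nth)
  have intP: "0 \<le> v (coeff P i)" for i unfolding cP by (intro fps_mult_integral qint int)
  have lowP: "0 < v (coeff P i)" if "i < degree P" for i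
    unfolding cP fps_mult_nth
  proof (rule v_sum_gt)
    fix j assume "j \<in> {0..i}"
    then have "0 < v (fps_nth F (i - j))" using low that P(2) by auto
    then show "0 < v (fps_nth q j * fps_nth F (i - j))"
      using v_mult_ge_right[OF qint order_refl] less_le_trans by blast
  qed simp
  obtain zs where zs: "length zs = n" "P = linear_prod zs"
    using monic_integral_splits[OF P(3,2) intP] by blast
  define V where "V = inverse q"
  have "q * V = 1" unfolding V_def using q0 by (intro inverse_mult_eq_1') auto
  then have "F = fps_of_poly P * V" unfolding P(1) by (metis mult.assoc mult.commute mult.right_neutral)
  moreover have "0 < v z" if "z \<in> set zs" for z
  proof (rule monic_root_maximal[OF P(3) intP lowP])
    show "poly P z = 0" unfolding zs(2) using that by (induction zs) auto
  qed
  moreover have "\<And>i. 0 \<le> v (fps_nth V i)" unfolding V_def by (rule integral_inverse[OF qint q0])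
  moreover have "v (fps_nth V 0) = 0" unfolding V_def using q0 v_inverse_unit by simp
  ultimately show ?thesis using that zs by blast
qed

end

section \<open>Weierstrass preparation on the closed disc, and the roots of a series\<close>

context Cp
begin

lemma null_value:
  assumes "null (fps_nth h)" "0 \<le> v a"
  shows "null (\<lambda>i. fps_nth h i * a ^ i)"
  using assms by (intro null_mult_bounded v_power_nonneg)

lemma null_fps_shift: "null (fps_nth h) \<Longrightarrow> null (fps_nth (fps_shift k h))"
  using null_shift[of "fps_nth h" k] by (simp add: fps_shift_nth[abs_def])

lemma fps_value_shift:
  assumes "null (fps_nth h)" "0 \<le> v a"
  shows "fps_value h a = fps_nth h 0 + a * fps_value (fps_shift 1 h) a"
proof -
  have "fps_value h a = fps_nth h 0 * a ^ 0 + (\<Sum>i. fps_nth h (Suc i) * a ^ Suc i)"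
    unfolding fps_value_def by (rule suminf_head_v[OF null_value[OF assms]])
  also have "(\<Sum>i. fps_nth h (Suc i) * a ^ Suc i) = (\<Sum>i. a * (fps_nth (fps_shift 1 h) i * a ^ i))"
    by (simp add: mult_ac)
  also have "\<dots> = a * fps_value (fps_shift 1 h) a"
    unfolding fps_value_def by (intro suminf_mult_const_v null_value null_fps_shift assms)
  finally show ?thesis by simp
qed

lemma fps_value_diff:
  assumes "null (fps_nth g)" "null (fps_nth h)" "0 \<le> v a"
  shows "fps_value (g - h) a = fps_value g a - fps_value h a"
  unfolding fps_value_def fps_sub_nth left_diff_distrib
  by (intro suminf_diff_v null_value assms)

lemma fps_value_ge:
  assumes "null (fps_nth h)" "0 \<le> v a" "\<And>i. c \<le> v (fps_nth h i)"
  shows "c \<le> v (fps_value h a)"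
  unfolding fps_value_def
  by (intro v_suminf_ge null_value v_mult_ge_left v_power_nonneg assms)

text \<open>
  Horner's scheme from above: the quotient of \<open>h\<close> by \<open>X - a\<close>. The coefficients are values at \<open>a\<close> of
  the tails of \<open>h\<close>.
\<close>

definition synthetic_quotient :: "'a \<Rightarrow> 'a fps \<Rightarrow> 'a fps" where
  "synthetic_quotient a h = Abs_fps (\<lambda>i. fps_value (fps_shift (Suc i) h) a)"

lemma null_synthetic_quotient:
  assumes "null (fps_nth h)" "0 \<le> v a"
  shows "null (fps_nth (synthetic_quotient a h))"
  unfolding null_def
proof
  fix N :: nat
  obtain M where M: "\<And>n. n \<ge> M \<Longrightarrow> ereal (real N) \<le> v (fps_nth h n)"
    using assms(1) unfolding null_def eventually_sequentially by blast
  show "\<forall>\<^sub>F n in sequentially. ereal (real N) \<le> v (fps_nth (synthetic_quotient a h) n)"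
    unfolding eventually_sequentially synthetic_quotient_def fps_nth_Abs_fps
    by (intro exI[of _ M] allI impI fps_value_ge null_fps_shift assms) (simp add: M)
qed

lemma synthetic_division:
  assumes "null (fps_nth h)" "0 \<le> v a"
  shows "(fps_X - fps_const a) * synthetic_quotient a h = h - fps_const (fps_value h a)"
proof (rule fps_ext)
  fix i
  have *: "fps_value (fps_shift k h) a = fps_nth h k + a * fps_value (fps_shift (Suc k) h) a" for k
    using fps_value_shift[OF null_fps_shift[OF assms(1), of k] assms(2)]
    by (simp add: fps_shift_fps_shift[symmetric])
  show "fps_nth ((fps_X - fps_const a) * synthetic_quotient a h) i = fps_nth (h - fps_const (fps_value h a)) i"
    using *[of i] by (cases i) (auto simp: left_diff_distrib synthetic_quotient_def)
qed

lemma fps_of_poly_linear: "fps_of_poly [:-z, 1:] = fps_X - fps_const (z::'a)"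
  by (simp add: fps_of_poly_pCons)

text \<open>
  \<open>Q h\<close> is the quotient in a Weierstrass division of \<open>h\<close> by the polynomial \<open>A\<close>: the difference of
  \<open>h\<close> and \<open>A * Q h\<close> has degree less than that of \<open>A\<close>. Additivity and the bound on the coefficients
  make this operator usable in a fixed point argument.
\<close>

definition quotient_operator :: "'a poly \<Rightarrow> ('a fps \<Rightarrow> 'a fps) \<Rightarrow> bool" where
  "quotient_operator A Q \<longleftrightarrow>
     (\<forall>h. null (fps_nth h) \<longrightarrow> null (fps_nth (Q h))) \<and>
     (\<forall>g h. null (fps_nth g) \<longrightarrow> null (fps_nth h) \<longrightarrow> Q (g - h) = Q g - Q h) \<and>
     (\<forall>h c i. null (fps_nth h) \<longrightarrow> (\<forall>j. c \<le> v (fps_nth h j)) \<longrightarrow> c \<le> v (fps_nth (Q h) i)) \<and>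
     (\<forall>h i. null (fps_nth h) \<longrightarrow> i \<ge> degree A \<longrightarrow>
        fps_nth (fps_of_poly A * Q h) i = fps_nth h i)"

lemma quotient_operatorD:
  assumes "quotient_operator A Q" "null (fps_nth h)"
  shows "null (fps_nth (Q h))"
    and "null (fps_nth g) \<Longrightarrow> Q (h - g) = Q h - Q g"
    and "(\<And>j. c \<le> v (fps_nth h j)) \<Longrightarrow> c \<le> v (fps_nth (Q h) i)"
    and "i \<ge> degree A \<Longrightarrow> fps_nth (fps_of_poly A * Q h) i = fps_nth h i"
  using assms unfolding quotient_operator_def by blast+

lemma degree_linear_prod: "degree (linear_prod zs) = length zs"
proof (induction zs)
  case (Cons z zs)
  have "linear_prod zs \<noteq> 0" by (auto simp: prod_list_zero_iff)
  then have "degree ([:-z, 1:] * linear_prod zs) = Suc (length zs)"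
    using Cons by (subst degree_mult_eq) auto
  then show ?case by simp
qed simp

text \<open>
  Division by a product of linear factors is iterated synthetic division.
\<close>

lemma ex_quotient_operator:
  assumes "\<forall>z\<in>set zs. 0 \<le> v z"
  shows "\<exists>Q. quotient_operator (linear_prod zs) Q"
  using assms
proof (induction zs)
  case Nil
  then show ?case by (intro exI[of _ "\<lambda>h. h"]) (simp add: quotient_operator_def)
next
  case (Cons z zs)
  then have z: "0 \<le> v z" by simp
  obtain Q where "quotient_operator (linear_prod zs) Q" using Cons by auto
  note Q = quotient_operatorD[OF this, unfolded degree_linear_prod]
  let ?d = "synthetic_quotient z"
  note nd = null_synthetic_quotient[OF _ z]
  have 1: "Q (?d (g - h)) = Q (?d g) - Q (?d h)" if "null (fps_nth g)" "null (fps_nth h)" for g h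
  proof -
    have "?d (g - h) = ?d g - ?d h"
      using fps_value_diff[OF null_fps_shift[OF that(1)] null_fps_shift[OF that(2)] z]
      by (intro fps_ext) (simp add: synthetic_quotient_def fps_shift_diff)
    then show ?thesis using Q(2) nd that by simp
  qed
  have 2: "c \<le> v (fps_nth (Q (?d h)) i)" if "null (fps_nth h)" "\<And>i. c \<le> v (fps_nth h i)" for h c i
  proof (rule Q(3)[OF nd[OF that(1)]])
    show "c \<le> v (fps_nth (?d h) i)" for i
      using that by (auto simp: synthetic_quotient_def intro!: fps_value_ge null_fps_shift z)
  qed
  have 3: "fps_nth (fps_of_poly (linear_prod (z # zs)) * Q (?d h)) i = fps_nth h i"
    if h: "null (fps_nth h)" and i: "i \<ge> length (z # zs)" for h i
  proof -
    define r where "r = fps_of_poly (linear_prod zs) * Q (?d h) - ?d h"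
    have r: "fps_nth r i = 0" if "i \<ge> length zs" for i
      using Q(4)[OF nd[OF h] that] by (simp add: r_def)
    have "fps_of_poly (linear_prod (z # zs)) * Q (?d h) = (fps_X - fps_const z) * (?d h + r)"
      unfolding r_def by (simp add: fps_of_poly_mult fps_of_poly_linear mult.assoc del: mult_pCons_left)
    also have "\<dots> = h - fps_const (fps_value h z) + (fps_X * r - fps_const z * r)"
      using synthetic_division[OF h z] by (simp only: distrib_left left_diff_distrib)
    finally show ?thesis using i r[of i] r[of "i - 1"] by (cases i) auto
  qed
  show ?case
    unfolding quotient_operator_def degree_linear_prod
    by (rule exI[of _ "\<lambda>h. Q (?d h)"]) (use 1 2 3 Q(1) nd in blast)
qed

text \<open>
  On the closed disc it is the high coefficients that are small: after division by \<open>fps_nth F n\<close>,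
  the series is \<open>A + B\<close> with \<open>A\<close> a monic polynomial of degree \<open>n\<close> and \<open>B\<close> uniformly small. If \<open>Q\<close>
  denotes the quotient in the division by \<open>A\<close>, then \<open>q * (A + B)\<close> is \<open>A\<close> plus a polynomial of
  smaller degree exactly if \<open>q + Q (q * B) = 1\<close>. The cofactor is the inverse of \<open>q\<close>. It has to
  converge on the closed disc, so it is obtained from a second fixed point equation within the
  series whose coefficients tend to zero.
\<close>

lemma Weierstrass_closed:
  assumes int: "\<And>i. 0 \<le> v (fps_nth F i)" and nullF: "null (fps_nth F)"
    and unit: "v (fps_nth F n) = 0" and high: "\<And>i. i > n \<Longrightarrow> 0 < v (fps_nth F i)"
  obtains zs V where "length zs = n" "\<And>z. z \<in> set zs \<Longrightarrow> 0 \<le> v z"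
    "F = fps_of_poly (linear_prod zs) * V" "null (fps_nth V)"
    "v (fps_nth V 0) = 0" "\<And>i. i > 0 \<Longrightarrow> 0 < v (fps_nth V i)"
proof -
  define c where "c = fps_nth F n"
  have c0: "c \<noteq> 0" using unit by (auto simp: c_def)
  define F' where "F' = fps_const (inverse c) * F"
  have vF': "v (fps_nth F' i) = v (fps_nth F i)" for i
    using unit c0 v_inverse_unit[of c] by (simp add: F'_def v_mult c_def)
  have nullF': "null (fps_nth F')" using nullF by (simp add: null_def vF')
  have F: "F = fps_const c * F'" unfolding F'_def using c0
    by (simp add: mult.assoc[symmetric] fps_const_mult)
  define g where "g = Abs_fps (\<lambda>i. if i \<le> n then fps_nth F' i else 0)"
  obtain A where A: "fps_of_poly A = g" "degree A = n" "lead_coeff A = 1"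
    by (rule fps_is_monic_poly[of g n]) (use c0 in \<open>auto simp: g_def F'_def c_def\<close>)
  have cA: "coeff A i = fps_nth g i" for i by (metis A(1) fps_of_poly_nth)
  have intA: "0 \<le> v (coeff A i)" for i unfolding cA g_def using int vF' by simp
  obtain as where as: "length as = n" "A = linear_prod as"
    using monic_integral_splits[OF A(3,2) intA] by blast
  have as0: "\<forall>z\<in>set as. 0 \<le> v z"
  proof
    fix z assume "z \<in> set as"
    then have "poly A z = 0" unfolding as(2) by (induction as) auto
    then show "0 \<le> v z" using monic_root_integral[OF A(3) intA] by blast
  qed
  define B where "B = F' - fps_of_poly A"
  have B: "fps_nth B i = (if i \<le> n then 0 else fps_nth F' i)" for i
    unfolding B_def A(1) by (simp add: g_def)
  have nullB: "null (fps_nth B)"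
    using nullF' unfolding null_def by (auto simp: B elim!: eventually_mono)
  have "0 < v (fps_nth B i)" for i using high by (simp add: B vF')
  then obtain eps where eps: "0 < eps" "\<And>i. ereal eps \<le> v (fps_nth B i)"
    using null_uniformly_positive[OF nullB] by blast
  obtain Q where "quotient_operator A Q" using ex_quotient_operator[OF as0] as by auto
  note Q = quotient_operatorD[OF this, unfolded A(2)]
  define E where "E = {h::'a fps. null (fps_nth h)}"
  have E1: "1 \<in> E" unfolding E_def null_def eventually_sequentially
    by (auto intro!: exI[of _ 1])
  have Ediff: "g - h \<in> E" if "g \<in> E" "h \<in> E" for g h
    using null_diff[of "fps_nth g" "fps_nth h"] that by (simp add: E_def fps_sub_nth[abs_def])
  have Eclosed: "g \<in> E" if *: "\<And>N::nat. \<exists>h\<in>E. \<forall>i. ereal (real N) \<le> v (fps_nth (g - h) i)" for g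
    unfolding E_def null_def
  proof (intro CollectI allI)
    fix N :: nat
    obtain h where h: "h \<in> E" "\<And>i. ereal (real N) \<le> v (fps_nth (g - h) i)" using * by blast
    have "\<forall>\<^sub>F n in sequentially. ereal (real N) \<le> v (fps_nth h n)"
      using h(1) by (simp add: E_def null_def)
    then show "\<forall>\<^sub>F n in sequentially. ereal (real N) \<le> v (fps_nth g n)"
    proof eventually_elim
      case (elim n)
      from v_add_ge[OF h(2)[of n] elim] show ?case by simp
    qed
  qed
  have Emult: "g * h \<in> E" if "g \<in> E" "h \<in> E" for g h
    using null_fps_mult that by (auto simp: E_def)
  have BE: "B \<in> E" using nullB by (simp add: E_def)
  obtain q where q: "q \<in> E" "q + Q (q * B) = 1" "\<And>i. ereal eps \<le> v (fps_nth (q - 1) i)"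
  proof (rule fixed_point[of eps E "\<lambda>h. Q (h * B)"])
    show "Q (h * B) \<in> E" if "h \<in> E" for h using Emult[OF that BE] Q(1) by (simp add: E_def)
    show "Q ((g - h) * B) = Q (g * B) - Q (h * B)" if "g \<in> E" "h \<in> E" for g h
      unfolding left_diff_distrib using Emult[OF that(1) BE] Emult[OF that(2) BE]
      by (intro Q(2)) (auto simp: E_def)
    show "ereal (c + eps) \<le> v (fps_nth (Q (h * B)) i)"
      if "h \<in> E" "\<And>i. ereal c \<le> v (fps_nth h i)" for h c i
      using Emult[OF that(1) BE] by (intro Q(3) fps_mult_ge that eps) (simp add: E_def)
  qed (use eps E1 Ediff Eclosed in blast)+
  have near1: "0 \<le> v (fps_nth Z i)" "v (fps_nth Z 0) = 0" "i > 0 \<Longrightarrow> 0 < v (fps_nth Z i)"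
    if *: "\<And>i. ereal eps \<le> v (fps_nth (Z - 1) i)" for Z i
  proof -
    have p: "0 < v (fps_nth (Z - 1) i)" for i using * eps(1) by (metis ereal_less(2) less_le_trans)
    then have "v (1::'a) < v (fps_nth (Z - 1) 0)" using p[of 0] by (simp only: v_one)
    from v_add_eq[OF this] show Z0: "v (fps_nth Z 0) = 0" by simp
    show "i > 0 \<Longrightarrow> 0 < v (fps_nth Z i)" using p[of i] by simp
    then show "0 \<le> v (fps_nth Z i)" using \<open>v (fps_nth Z 0) = 0\<close> by (cases "i = 0") auto
  qed
  have q1E: "q - 1 \<in> E" using Ediff q(1) E1 by blast
  obtain Z where Z: "Z \<in> E" "Z + Z * (q - 1) = 1" "\<And>i. ereal eps \<le> v (fps_nth (Z - 1) i)"
  proof (rule fixed_point[of eps E "\<lambda>h. h * (q - 1)"])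
    show "h * (q - 1) \<in> E" if "h \<in> E" for h using Emult[OF that q1E] .
    show "ereal (c + eps) \<le> v (fps_nth (h * (q - 1)) i)"
      if "h \<in> E" "\<And>i. ereal c \<le> v (fps_nth h i)" for h c i
      by (intro fps_mult_ge that q)
  qed (use eps E1 Ediff Eclosed in \<open>auto simp: left_diff_distrib\<close>)
  have Zq: "Z * q = 1" using Z(2) by (simp add: algebra_simps)
  have nqB: "null (fps_nth (q * B))" using Emult[OF q(1) BE] by (simp add: E_def)
  \<comment> \<open>The error of the division is a polynomial of degree less than \<open>n\<close>; the equation for \<open>q\<close> cancels
    all the rest of the product.\<close>
  have "q * F' = fps_of_poly A * (q + Q (q * B)) + (q * B - fps_of_poly A * Q (q * B))"
    unfolding B_def by (simp add: algebra_simps)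
  then have qF: "q * F' = fps_of_poly A + (q * B - fps_of_poly A * Q (q * B))"
    unfolding q(2) by simp
  have qFn: "fps_nth (q * F') i = coeff A i" if "i \<ge> n" for i
    unfolding qF using Q(4)[OF nqB that] by simp
  obtain P where P: "fps_of_poly P = q * F'" "degree P = n" "lead_coeff P = 1"
  proof (rule fps_is_monic_poly)
    show "fps_nth (q * F') n = 1" using qFn A by simp
    show "fps_nth (q * F') i = 0" if "i > n" for i using qFn[of i] A that by (simp add: coeff_eq_0)
  qed blast
  have cP: "coeff P i = fps_nth (q * F') i" for i by (metis P(1) fps_of_poly_nth)
  have intP: "0 \<le> v (coeff P i)" for i unfolding cP
    by (intro fps_mult_integral near1(1)[OF q(3)]) (simp add: vF' int)
  obtain zs where zs: "length zs = n" "P = linear_prod zs"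
    using monic_integral_splits[OF P(3,2) intP] by blast
  define V where "V = fps_const c * Z"
  have vV: "v (fps_nth V i) = v (fps_nth Z i)" for i using unit by (simp add: V_def v_mult c_def)
  have "fps_of_poly P * V = fps_const c * F' * (Z * q)" unfolding P(1) V_def by (simp only: mult_ac)
  then have "F = fps_of_poly (linear_prod zs) * V" using Zq F zs by simp
  moreover have "0 \<le> v z" if "z \<in> set zs" for z
  proof (rule monic_root_integral[OF P(3) intP])
    show "poly P z = 0" unfolding zs(2) using that by (induction zs) auto
  qed
  moreover have "null (fps_nth V)" using Z(1) by (simp add: null_def vV E_def)
  moreover have "v (fps_nth V 0) = 0" "\<And>i. i > 0 \<Longrightarrow> 0 < v (fps_nth V i)"
    unfolding vV using near1[OF Z(3)] by auto
  ultimately show ?thesis using that zs by blast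
qed

text \<open>
  The common result of the two preparation theorems. On the disc, only the absolute value of the
  cofactor matters.
\<close>

definition factors_on :: "'a set \<Rightarrow> 'a fps \<Rightarrow> 'a list \<Rightarrow> 'a fps \<Rightarrow> bool" where
  "factors_on D F zs V \<longleftrightarrow> set zs \<subseteq> D \<and> F = fps_of_poly (linear_prod zs) * V \<and>
     fps_converges_on V D \<and> (\<forall>x\<in>D. v (fps_value V x) = 0)"

lemma fps_value_linear_prod_mult:
  assumes "null (\<lambda>i. fps_nth V i * x ^ i)"
  shows "null (\<lambda>i. fps_nth (fps_of_poly (linear_prod zs) * V) i * x ^ i) \<and>
    fps_value (fps_of_poly (linear_prod zs) * V) x = poly (linear_prod zs) x * fps_value V x"
proof (induction zs)
  case (Cons z zs)
  define W where "W = fps_of_poly (linear_prod zs) * V"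
  have eq: "fps_of_poly (linear_prod (z # zs)) * V = (fps_X - fps_const z) * W"
    by (simp add: W_def fps_of_poly_mult fps_of_poly_linear mult.assoc del: mult_pCons_left)
  have W: "null (\<lambda>i. fps_nth W i * x ^ i)" "fps_value W x = poly (linear_prod zs) x * fps_value V x"
    using Cons by (auto simp: W_def)
  show ?case unfolding eq using fps_value_linear_mult[OF W(1), of z] W(2) by (simp add: algebra_simps)
qed (use assms in simp)

lemma poly_linear_prod: "poly (linear_prod zs) x = (\<Prod>z\<leftarrow>zs. x - z)"
  by (induction zs) (auto simp: algebra_simps)

lemma factors_on_value:
  assumes "factors_on D F zs V" "x \<in> D"
  shows "fps_value F x = poly (linear_prod zs) x * fps_value V x"
    and "v (fps_value F x) = v (poly (linear_prod zs) x)"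
    and "fps_value F x = 0 \<longleftrightarrow> x \<in> set zs"
proof -
  have n: "null (\<lambda>i. fps_nth V i * x ^ i)" using assms by (simp add: factors_on_def converges_iff)
  show 1: "fps_value F x = poly (linear_prod zs) x * fps_value V x"
    using fps_value_linear_prod_mult[OF n] assms by (simp add: factors_on_def)
  have u: "v (fps_value V x) = 0" using assms by (simp add: factors_on_def)
  show "v (fps_value F x) = v (poly (linear_prod zs) x)" unfolding 1 by (simp add: v_mult u)
  have "fps_value V x \<noteq> 0" using u by auto
  then show "fps_value F x = 0 \<longleftrightarrow> x \<in> set zs" unfolding 1 poly_linear_prod
    by (auto simp: prod_list_zero_iff)
qed

lemma linear_prod_removeAll:
  "linear_prod zs = [:-z, 1:] ^ count_list zs z * linear_prod (removeAll z zs)"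
proof (induction zs)
  case (Cons x zs)
  have eq: "linear_prod (x # zs) = [:-x, 1:] * ([:-z, 1:] ^ count_list zs z * linear_prod (removeAll z zs))"
    using Cons by (simp only: list.map prod_list.Cons)
  show ?case
  proof (cases "x = z")
    case True then show ?thesis unfolding eq by (simp only: count_list.simps removeAll.simps if_True power_Suc mult.assoc simp_thms Suc_eq_plus1[symmetric])
  next
    case False
    then have "z \<noteq> x" by simp
    with False show ?thesis unfolding eq
      by (simp only: count_list.simps removeAll.simps if_False list.map prod_list.Cons mult.left_commute)
  qed
qed simp

text \<open>
  The factorization shows that the multiplicity is at least the number of occurrences of \<open>z\<close>. If it
  were larger, cancelling in the domain of formal power series and evaluating at \<open>z\<close> would give a
  zero of the unit \<open>V\<close> or a root \<open>z\<close> in the list that has all its occurrences removed.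
\<close>

lemma root_mult_factors:
  assumes "factors_on D F zs V" "z \<in> D"
  shows "root_mult D F z = count_list zs z"
  unfolding root_mult_def
proof (rule Greatest_equality)
  let ?c = "count_list zs z" and ?L = "linear_prod (removeAll z zs)"
  let ?X = "fps_X - fps_const z"
  have nV: "\<And>x. x \<in> D \<Longrightarrow> null (\<lambda>i. fps_nth V i * x ^ i)"
    using assms by (simp add: factors_on_def converges_iff)
  have F: "F = ?X ^ ?c * (fps_of_poly ?L * V)"
    using assms(1) unfolding factors_on_def
    by (subst (asm) linear_prod_removeAll[of zs z])
      (auto simp: fps_of_poly_mult fps_of_poly_power fps_of_poly_linear mult.assoc)
  show "\<exists>H. fps_converges_on H D \<and> F = ?X ^ ?c * H"
    using F fps_value_linear_prod_mult nV by (auto simp: converges_iff)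
  fix k assume "\<exists>H. fps_converges_on H D \<and> F = ?X ^ k * H"
  then obtain H where H: "fps_converges_on H D" "F = ?X ^ k * H" by blast
  show "k \<le> ?c"
  proof (rule ccontr)
    assume "\<not> k \<le> ?c"
    then obtain j where j: "k = ?c + Suc j" by (metis add_Suc_right less_imp_Suc_add not_le)
    have "?X \<noteq> 0"
    proof
      assume "?X = 0" then have "fps_nth ?X 1 = 0" by simp
      then show False by simp
    qed
    moreover have "?X ^ ?c * (?X * (fps_of_poly (linear_prod (replicate j z)) * H)) = ?X ^ ?c * (fps_of_poly ?L * V)"
      using H(2) F unfolding j
      by (simp add: power_add fps_of_poly_linear fps_of_poly_power prod_list_replicate mult_ac)
    ultimately have eq: "?X * (fps_of_poly (linear_prod (replicate j z)) * H) = fps_of_poly ?L * V" by simp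
    have "fps_value (?X * (fps_of_poly (linear_prod (replicate j z)) * H)) z = 0"
      using fps_value_linear_mult(2)[of "fps_of_poly (linear_prod (replicate j z)) * H" z z]
        fps_value_linear_prod_mult[of H z "replicate j z"] H(1) assms(2) by (simp add: converges_iff)
    moreover have "fps_value (fps_of_poly ?L * V) z = poly ?L z * fps_value V z"
      using fps_value_linear_prod_mult nV assms(2) by blast
    moreover have "fps_value V z \<noteq> 0" using assms by (auto simp: factors_on_def)
    moreover have "poly ?L z \<noteq> 0" unfolding poly_linear_prod by (auto simp: prod_list_zero_iff)
    ultimately show False using eq by simp
  qed
qed

lemma prod_count_list:
  fixes g :: "'b \<Rightarrow> 'c::comm_monoid_mult"
  assumes "finite S" "set zs \<subseteq> S"
  shows "(\<Prod>z\<in>S. g z ^ count_list zs z) = (\<Prod>z\<leftarrow>zs. g z)"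
  using assms(2)
proof (induction zs)
  case (Cons x zs)
  have "(\<Prod>z\<in>S. g z ^ count_list (x # zs) z) = (\<Prod>z\<in>S. (if z = x then g z else 1) * g z ^ count_list zs z)"
    by (intro prod.cong) auto
  also have "\<dots> = g x * (\<Prod>z\<in>S. g z ^ count_list zs z)"
    using Cons.prems assms(1) by (simp add: prod.distrib)
  finally show ?case using Cons by simp
qed simp

lemma prod_over_roots_factors:
  assumes "factors_on D F zs V"
  shows "prod_over_roots D F G = (\<Prod>z\<leftarrow>zs. fps_value G z)"
proof -
  have "{z \<in> D. fps_value F z = 0} = set zs"
    using factors_on_value(3)[OF assms] assms by (auto simp: factors_on_def)
  then have "prod_over_roots D F G = (\<Prod>z\<in>set zs. fps_value G z ^ count_list zs z)"
    unfolding prod_over_roots_def using root_mult_factors[OF assms] assms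
    by (intro prod.cong) (auto simp: factors_on_def)
  then show ?thesis by (simp add: prod_count_list)
qed

lemma open_disc_factorization:
  assumes "\<And>i. 0 \<le> v (fps_nth F i)" "\<And>i. i < n \<Longrightarrow> 0 < v (fps_nth F i)" "v (fps_nth F n) = 0"
  obtains zs V where "length zs = n" "factors_on (val_ideal v UNIV) F zs V"
proof -
  obtain zs V where V: "length zs = n" "\<And>z. z \<in> set zs \<Longrightarrow> 0 < v z"
    "F = fps_of_poly (linear_prod zs) * V" "\<And>i. 0 \<le> v (fps_nth V i)" "v (fps_nth V 0) = 0"
    using Weierstrass_open[OF assms] by blast
  have n: "null (\<lambda>i. fps_nth V i * x ^ i)" if x: "0 < v x" for x
  proof -
    obtain r where r: "0 < ereal r" "ereal r < v x" using ereal_dense2[OF x] by blast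
    have "null (\<lambda>i. x ^ i)" unfolding null_def
    proof
      fix N :: nat
      obtain M :: nat where M: "real N < real M * r" using reals_Archimedean3[of r] r by auto
      show "\<forall>\<^sub>F n in sequentially. ereal (real N) \<le> v (x ^ n)"
        unfolding eventually_sequentially
      proof (intro exI[of _ M] allI impI)
        fix n assume n: "M \<le> n"
        have "real N \<le> real M * r" using M by simp
        also have "\<dots> \<le> real n * r" using n r by (intro mult_right_mono) auto
        finally have "ereal (real N) \<le> ereal (real n * r)" by simp
        also have "\<dots> \<le> v (x ^ n)" using r by (intro v_power_ge) auto
        finally show "ereal (real N) \<le> v (x ^ n)" .
      qed
    qed
    from null_mult_bounded[of _ "fps_nth V", OF this V(4)] show ?thesis by (simp add: mult.commute)
  qed
  have "v (fps_value V x) = 0" if x: "0 < v x" for x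
    unfolding fps_value_def
  proof (rule v_suminf_unit[OF n[OF x]])
    show "v (fps_nth V 0 * x ^ 0) = 0" using V(5) by simp
    fix i :: nat assume "i > 0"
    then have "0 < v (x ^ i)" using x by (simp add: v_power ereal_zero_less_0_iff)
    also have "\<dots> \<le> v (fps_nth V i * x ^ i)" using V(4) by (intro v_mult_ge_right) auto
    finally show "0 < v (fps_nth V i * x ^ i)" .
  qed
  then have "factors_on (val_ideal v UNIV) F zs V"
    unfolding factors_on_def using V n by (auto simp: converges_iff val_ideal_def)
  then show ?thesis using that V(1) by blast
qed

lemma closed_disc_factorization:
  assumes "\<And>i. 0 \<le> v (fps_nth F i)" "null (fps_nth F)" "v (fps_nth F n) = 0"
    "\<And>i. i > n \<Longrightarrow> 0 < v (fps_nth F i)"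
  obtains zs V where "length zs = n" "factors_on (val_ring v UNIV) F zs V"
proof -
  obtain zs V where V: "length zs = n" "\<And>z. z \<in> set zs \<Longrightarrow> 0 \<le> v z"
    "F = fps_of_poly (linear_prod zs) * V" "null (fps_nth V)"
    "v (fps_nth V 0) = 0" "\<And>i. i > 0 \<Longrightarrow> 0 < v (fps_nth V i)"
    using Weierstrass_closed[OF assms] by blast
  have n: "null (\<lambda>i. fps_nth V i * x ^ i)" if "0 \<le> v x" for x
    using null_value V(4) that by blast
  have "v (fps_value V x) = 0" if x: "0 \<le> v x" for x
    unfolding fps_value_def
  proof (rule v_suminf_unit[OF n[OF x]])
    show "v (fps_nth V 0 * x ^ 0) = 0" using V(5) by simp
    fix i :: nat assume "i > 0"
    then have "0 < v (fps_nth V i)" using V by simp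
    also have "\<dots> \<le> v (fps_nth V i * x ^ i)" using x by (intro v_mult_ge_left v_power_nonneg) auto
    finally show "0 < v (fps_nth V i * x ^ i)" .
  qed
  then have "factors_on (val_ring v UNIV) F zs V"
    unfolding factors_on_def using V n by (auto simp: converges_iff val_ring_def)
  then show ?thesis using that V(1) by blast
qed

end

section \<open>The field of p-adic numbers and linear algebra over it\<close>

context Cp
begin

lemma v_of_nat_nonneg: "0 \<le> v (of_nat n)"
  by (induction n) (auto intro!: v_add_ge)

lemma v_of_int_nonneg: "0 \<le> v (of_int n)"
  using v_of_nat_nonneg[of "nat \<bar>n\<bar>"] v_minus[of "of_int n"] by (cases "n \<ge> 0") auto

text \<open>
  By Bezout's identity \<open>1\<close> is an integral combination of \<open>n\<close> and \<open>p\<close>, so they cannot both have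
  positive valuation.
\<close>

lemma v_of_int_coprime:
  assumes "\<not> int p dvd n" shows "v (of_int n) = 0"
proof (rule ccontr)
  assume "v (of_int n) \<noteq> 0"
  then have pos: "0 < v (of_int n)" using v_of_int_nonneg[of n] by simp
  have "coprime (int p) n" using assms prime_p by (simp add: prime_imp_coprime)
  then obtain a b where ab: "a * int p + b * n = 1"
    by (metis bezout_int coprime_imp_gcd_eq_1)
  have "0 < v (of_int a * of_int (int p) + of_int b * of_int n)"
    using pos by (intro v_add_gt order.strict_trans2[OF _ v_mult_ge_right[OF v_of_int_nonneg order_refl]])
       (auto simp: v_p)
  also have "of_int a * of_int (int p) + of_int b * of_int n = (of_int (a * int p + b * n) :: 'a)" by simp
  finally show False unfolding ab by simp
qed

lemma v_of_int_dvd: assumes "int p dvd n" shows "1 \<le> v (of_int n)"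
proof -
  obtain m where "n = int p * m" using assms by blast
  then have "v (of_int n) = 1 + v (of_int m)" by (simp add: v_mult v_p)
  then show ?thesis using v_of_int_nonneg[of m] add_left_mono[of 0 "v (of_int m)" 1] by simp
qed

lemma v_of_nat_int: "n > 0 \<Longrightarrow> \<exists>k::int. v (of_nat n) = ereal (of_int k)"
proof (induction n rule: less_induct)
  case (less n)
  show ?case
  proof (cases "p dvd n")
    case True
    then obtain m where m: "n = p * m" by blast
    then have "m < n" "0 < m" using less.prems p_gt_1 by auto
    then obtain k :: int where "v (of_nat m) = ereal (of_int k)" using less.IH by blast
    then show ?thesis by (intro exI[of _ "k + 1"]) (simp add: m v_mult v_p one_ereal_def)
  next
    case False
    then have "v (of_int (int n)) = 0" by (intro v_of_int_coprime) auto
    then show ?thesis by (intro exI[of _ 0]) simp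
  qed
qed

lemma v_of_int_int: assumes "n \<noteq> 0" shows "\<exists>k::int. v (of_int n) = ereal (of_int k)"
  using v_of_nat_int[of "nat \<bar>n\<bar>"] v_minus[of "of_int n"] assms by (cases "n \<ge> 0") auto

lemma Rats_fraction:
  assumes "(x::'a) \<in> \<rat>" obtains a b where "b \<noteq> 0" "coprime a b" "x = of_int a / of_int b"
proof -
  obtain r where r: "x = of_rat r" using assms by (auto elim: Rats_cases)
  obtain a b where ab: "quotient_of r = (a, b)" by force
  then have "r = of_int a / of_int b" "coprime a b" "b > 0"
    using quotient_of_div quotient_of_coprime quotient_of_denom_pos by blast+
  then show ?thesis using that[of b a] r by (simp add: of_rat_divide)
qed

lemma v_Rats_int: assumes "x \<in> \<rat>" "x \<noteq> 0" shows "\<exists>k::int. v x = ereal (of_int k)"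
proof -
  obtain a b where ab: "b \<noteq> 0" "x = of_int a / of_int b" using assms Rats_fraction by metis
  then have "a \<noteq> 0" using assms by auto
  obtain k :: int where k: "v (of_int a) = ereal (of_int k)" using v_of_int_int \<open>a \<noteq> 0\<close> by blast
  obtain l :: int where l: "v (of_int b) = ereal (of_int l)" using v_of_int_int ab by blast
  have "v x = ereal (of_int (k - l))"
    using ab k l v_inverse[of "of_int b"] by (simp add: divide_inverse v_mult)
  then show ?thesis by blast
qed

lemma Qp_iff: "x \<in> Qp \<longleftrightarrow> (\<forall>N::nat. \<exists>y\<in>\<rat>. ereal (real N) \<le> v (x - y))"
  unfolding Qp_def by (rule closure_iff_v)

lemma Rats_Qp: "x \<in> \<rat> \<Longrightarrow> x \<in> (Qp :: 'a set)"
  unfolding Qp_def using closure_subset by blast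

lemma Qp_approx: assumes "x \<in> Qp" obtains y where "y \<in> \<rat>" "ereal c \<le> v (x - y)"
proof -
  obtain N :: nat where N: "c \<le> real N" using real_arch_simple by blast
  obtain y where "y \<in> \<rat>" "ereal (real N) \<le> v (x - y)" using assms Qp_iff by blast
  then show ?thesis using that N by (meson ereal_less_eq(3) order_trans)
qed

lemma Qp_diff: assumes "(x::'a) \<in> Qp" "y \<in> Qp" shows "x - y \<in> Qp"
  unfolding Qp_iff
proof
  fix N :: nat
  obtain r where r: "r \<in> \<rat>" "ereal (real N) \<le> v (x - r)" using assms Qp_approx by blast
  obtain s where s: "s \<in> \<rat>" "ereal (real N) \<le> v (y - s)" using assms Qp_approx by blast
  have "ereal (real N) \<le> v ((x - r) - (y - s))" by (rule v_diff_ge[OF r(2) s(2)])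
  then show "\<exists>z\<in>\<rat>. ereal (real N) \<le> v (x - y - z)"
    using r s by (intro bexI[of _ "r - s"]) (auto simp: algebra_simps)
qed

lemma v_lower_bound: obtains c :: real where "c \<le> 0" "ereal c \<le> v x"
proof (cases "x = 0")
  case False
  then obtain r where "v x = ereal r" by (rule v_real)
  then show ?thesis using that[of "min 0 r"] by simp
qed (use that[of 0] in simp)

lemma Qp_mult: assumes "(x::'a) \<in> Qp" "y \<in> Qp" shows "x * y \<in> Qp"
  unfolding Qp_iff
proof
  fix N :: nat
  obtain c where c: "c \<le> 0" "ereal c \<le> v x" by (rule v_lower_bound)
  obtain d where d: "d \<le> 0" "ereal d \<le> v y" by (rule v_lower_bound)
  define M where "M = real N - c - d"
  obtain r where r: "r \<in> \<rat>" "ereal M \<le> v (x - r)" using assms Qp_approx by blast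
  obtain s where s: "s \<in> \<rat>" "ereal M \<le> v (y - s)" using assms Qp_approx by blast
  have "ereal d \<le> v (y - (y - s))"
  proof (rule v_diff_ge[OF d(2)])
    have "ereal d \<le> ereal M" using c d by (simp add: M_def)
    then show "ereal d \<le> v (y - s)" using s(2) by (rule order_trans)
  qed
  then have "ereal (d + M) \<le> v (s * (x - r))" using r by (intro v_mult_ge) auto
  moreover have "ereal (c + M) \<le> v (x * (y - s))" using c s by (intro v_mult_ge) auto
  moreover have "ereal (real N) \<le> ereal (d + M)" "ereal (real N) \<le> ereal (c + M)"
    using c d by (auto simp: M_def)
  ultimately have "ereal (real N) \<le> v (x * (y - s) + s * (x - r))"
    by (intro v_add_ge) (blast intro: order_trans)+
  also have "x * (y - s) + s * (x - r) = x * y - r * s" by (simp add: algebra_simps)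
  finally show "\<exists>z\<in>\<rat>. ereal (real N) \<le> v (x * y - z)"
    by (rule bexI) (rule Rats_mult[OF r(1) s(1)])
qed

lemma Qp_inverse: assumes "(x::'a) \<in> Qp" shows "inverse x \<in> Qp"
proof (cases "x = 0")
  case True then show ?thesis using Rats_Qp[of 0] by simp
next
  case False
  then obtain t where t: "v x = ereal t" by (rule v_real)
  show ?thesis unfolding Qp_iff
  proof
    fix N :: nat
    obtain r where r: "r \<in> \<rat>" "ereal (max (real N + t + t) (t + 1)) \<le> v (x - r)"
      using assms Qp_approx by blast
    have "v x < ereal (max (real N + t + t) (t + 1))" unfolding t less_ereal.simps by simp
    then have "v x < v (x - r)" using r(2) by (rule less_le_trans)
    then have vr: "v r = ereal t" using v_eqI[of x r] t by simp
    then have r0: "r \<noteq> 0" by auto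
    have "v (x * r) = ereal (t + t)" using t vr by (simp add: v_mult)
    moreover have "ereal (real N + (t + t)) \<le> v (r - x)"
      using r(2) unfolding v_minus_commute[of r x]
      by (rule order_trans[rotated]) (simp add: max_def)
    ultimately have "ereal (real N) \<le> v ((r - x) / (x * r))" by (rule v_divide_ge)
    also have "(r - x) / (x * r) = inverse x - inverse r" using False r0 by (simp add: field_simps)
    finally show "\<exists>z\<in>\<rat>. ereal (real N) \<le> v (inverse x - z)" using r by auto
  qed
qed

lemma v_Qp_int: assumes "x \<in> Qp" "x \<noteq> 0" shows "\<exists>k::int. v x = ereal (of_int k)"
proof -
  obtain t where t: "v x = ereal t" using assms(2) by (rule v_real)
  obtain y where y: "y \<in> \<rat>" "ereal (t + 1) \<le> v (x - y)" using Qp_approx assms(1) by blast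
  have "v x < ereal (t + 1)" using t by simp
  then have "v y = v x" using y(2) v_eqI less_le_trans by blast
  moreover from this have "y \<noteq> 0" using t by auto
  ultimately show ?thesis using v_Rats_int y(1) by metis
qed

text \<open>
  The residue field of \<open>Qp\<close> has the representatives \<open>0, ..., p - 1\<close>. A rational approximation
  \<open>a / b\<close> of \<open>c\<close> in lowest terms has denominator prime to \<open>p\<close>, hence invertible modulo \<open>p\<close>.
\<close>

lemma Qp_residue:
  assumes "c \<in> Qp" "0 \<le> v c" shows "\<exists>k<p. 0 < v (c - of_nat k)"
proof -
  obtain r where r: "r \<in> \<rat>" "ereal 1 \<le> v (c - r)" using Qp_approx assms(1) by blast
  have "0 \<le> v (c - r)" using r(2) by (rule order_trans[rotated]) simp
  then have "0 \<le> v (c - (c - r))" by (rule v_diff_ge[OF assms(2)])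
  then have vr: "0 \<le> v r" by simp
  obtain a b where ab: "b \<noteq> 0" "coprime a b" "r = of_int a / of_int b"
    using r(1) by (rule Rats_fraction)
  have pb: "\<not> int p dvd b"
  proof
    assume "int p dvd b"
    then have "1 \<le> v (of_int b)" "\<not> int p dvd a"
      using v_of_int_dvd ab(2) p_gt_1 not_coprimeI[of "int p" a b] by auto
    then have "v (of_int a) = 0" using v_of_int_coprime by simp
    moreover have "of_int a = r * of_int b" using ab by simp
    ultimately have "0 = v r + v (of_int b)" by (metis v_mult)
    moreover have "1 \<le> v r + v (of_int b)"
      using add_mono[OF vr \<open>1 \<le> v (of_int b)\<close>] by simp
    ultimately show False by simp
  qed
  then have "coprime (int p) b" using prime_p by (simp add: prime_imp_coprime)
  then obtain s t where st: "s * int p + t * b = 1"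
    by (metis bezout_int coprime_imp_gcd_eq_1)
  define k where "k = nat ((a * t) mod int p)"
  have k: "int k = (a * t) mod int p" "k < p"
    using p_gt_1 by (auto simp: k_def nat_less_iff)
  have "int p dvd a - int k * b"
  proof -
    have "a - int k * b = a * (s * int p + t * b) - int k * b" using st by simp
    also have "\<dots> = int p * (a * s) + (a * t - int k) * b" by (simp add: algebra_simps)
    also have "int p dvd \<dots>" unfolding k(1) by (simp add: minus_mod_eq_mult_div)
    finally show ?thesis .
  qed
  then have 1: "1 \<le> v (of_int (a - int k * b))" by (rule v_of_int_dvd)
  have b0: "v (of_int b) = ereal 0" using v_of_int_coprime[OF pb] by (simp add: zero_ereal_def)
  have "r - of_nat k = of_int (a - int k * b) / of_int b" using ab by (simp add: field_simps)
  then have "ereal 1 \<le> v (r - of_nat k)"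
    using v_divide_ge[OF b0, of 1] 1 by (simp add: one_ereal_def)
  then have "ereal 1 \<le> v ((c - r) + (r - of_nat k))" using r(2) by (intro v_add_ge)
  then have "ereal 1 \<le> v (c - of_nat k)" by simp
  then have "0 < v (c - of_nat k)" by (rule less_le_trans[rotated]) simp
  then show ?thesis using k(2) by blast
qed

end

text \<open>
  Gaussian elimination: a pivot for the equation \<open>b0\<close> expresses one of the coefficients by the
  others and leaves a system with one equation and one unknown fewer. The scalars are the elements
  of a subfield \<open>k\<close>, given as a set.
\<close>

lemma more_vectors_than_equations_dependent:
  fixes c :: "'i \<Rightarrow> 'b \<Rightarrow> 'a::field" and B :: "'b set"
  assumes k: "0 \<in> k" "1 \<in> k" "\<And>x y. x \<in> k \<Longrightarrow> y \<in> k \<Longrightarrow> x - y \<in> k" "\<And>x y. x \<in> k \<Longrightarrow> y \<in> k \<Longrightarrow> x * y \<in> k"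
     "\<And>x. x \<in> k \<Longrightarrow> inverse x \<in> k"
  and "finite B" "finite I" "card B < card I" "\<And>i b. i \<in> I \<Longrightarrow> b \<in> B \<Longrightarrow> c i b \<in> k"
  shows "\<exists>d. (\<forall>i\<in>I. d i \<in> k) \<and> (\<exists>i\<in>I. d i \<noteq> 0) \<and> (\<forall>b\<in>B. (\<Sum>i\<in>I. d i * c i b) = 0)"
  using assms(6-9)
proof (induction B arbitrary: I c rule: finite_induct)
  case empty
  then have "I \<noteq> {}" by auto
  then show ?case using k(2) by (intro exI[of _ "\<lambda>_. 1"]) auto
next
  case (insert b0 B)
  show ?case
  proof (cases "\<forall>i\<in>I. c i b0 = 0")
    case True
    obtain d where "(\<forall>i\<in>I. d i \<in> k) \<and> (\<exists>i\<in>I. d i \<noteq> 0) \<and> (\<forall>b\<in>B. (\<Sum>i\<in>I. d i * c i b) = 0)"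
      using insert.IH[of I c] insert.prems insert.hyps by auto
    then show ?thesis using True by (intro exI[of _ d]) auto
  next
    case False
    then obtain i0 where i0: "i0 \<in> I" "c i0 b0 \<noteq> 0" by blast
    let ?J = "I - {i0}"
    define l where "l i = c i b0 * inverse (c i0 b0)" for i
    have l: "l i \<in> k" if "i \<in> I" for i using that k insert.prems i0 by (simp add: l_def)
    have "card B < card ?J" using insert.prems insert.hyps i0 by simp
    then obtain d where d: "\<forall>i\<in>?J. d i \<in> k" "\<exists>i\<in>?J. d i \<noteq> 0"
        "\<forall>b\<in>B. (\<Sum>i\<in>?J. d i * (c i b - l i * c i0 b)) = 0"
      using insert.IH[of ?J "\<lambda>i b. c i b - l i * c i0 b"] insert.prems l k i0 by auto
    have sum_k: "sum g A \<in> k" if "\<And>i. i \<in> A \<Longrightarrow> g i \<in> k" for g and A :: "'i set"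
    proof -
      have "x + y \<in> k" if "x \<in> k" "y \<in> k" for x y
        using k(3)[OF that(1) k(3)[OF k(1) that(2)]] by simp
      then show ?thesis using that by (induction A rule: infinite_finite_induct) (auto simp: k)
    qed
    define d0 where "d0 = 0 - (\<Sum>i\<in>?J. d i * l i)"
    define d' where "d' i = (if i = i0 then d0 else d i)" for i
    have "d0 \<in> k" unfolding d0_def by (intro k sum_k) (use d l in auto)
    have split: "(\<Sum>i\<in>I. d' i * c i b) = (\<Sum>i\<in>?J. d i * (c i b - l i * c i0 b))" for b
    proof -
      have "(\<Sum>i\<in>I. d' i * c i b) = d' i0 * c i0 b + (\<Sum>i\<in>?J. d' i * c i b)"
        using i0 insert.prems by (subst sum.remove[of _ i0]) auto
      also have "(\<Sum>i\<in>?J. d' i * c i b) = (\<Sum>i\<in>?J. d i * c i b)"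
        by (intro sum.cong) (auto simp: d'_def)
      finally show ?thesis
        by (simp add: d'_def d0_def right_diff_distrib sum_subtractf sum_distrib_right mult.assoc)
    qed
    have "(\<Sum>i\<in>I. d' i * c i b0) = 0"
      unfolding split using i0 by (intro sum.neutral) (auto simp: l_def)
    moreover have "\<forall>b\<in>B. (\<Sum>i\<in>I. d' i * c i b) = 0" unfolding split using d by simp
    ultimately show ?thesis
      using d \<open>d0 \<in> k\<close> by (intro exI[of _ d']) (auto simp: d'_def)
  qed
qed

context Cp
begin

lemma finite_extension_dimension_bound:
  fixes K :: "'a set"
  assumes "finite_extension_Qp K"
  shows "\<exists>D. \<forall>X. finite X \<longrightarrow> X \<subseteq> K \<longrightarrow> D < card X \<longrightarrow>
    (\<exists>d. (\<forall>x\<in>X. d x \<in> Qp) \<and> (\<exists>x\<in>X. d x \<noteq> 0) \<and> (\<Sum>x\<in>X. d x * x) = 0)"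
proof -
  obtain B where B: "finite B" "B \<subseteq> K"
     "\<forall>x\<in>K. \<exists>c. (\<forall>b\<in>B. c b \<in> Qp) \<and> x = (\<Sum>b\<in>B. c b * b)"
    using assms by (auto simp: finite_extension_Qp_def)
  then obtain c where c: "\<And>x. x \<in> K \<Longrightarrow> (\<forall>b\<in>B. c x b \<in> Qp) \<and> x = (\<Sum>b\<in>B. c x b * b)"
    by metis
  show ?thesis
  proof (intro exI[of _ "card B"] allI impI)
    fix X assume X: "finite X" "X \<subseteq> K" "card B < card X"
    have "\<exists>d. (\<forall>x\<in>X. d x \<in> Qp) \<and> (\<exists>x\<in>X. d x \<noteq> 0) \<and> (\<forall>b\<in>B. (\<Sum>x\<in>X. d x * c x b) = 0)"
    proof (rule more_vectors_than_equations_dependent[where k = Qp and B = B and I = X and c = c])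
      show "0 \<in> (Qp :: 'a set)" "1 \<in> (Qp :: 'a set)" by (rule Rats_Qp, simp)+
      show "c x b \<in> Qp" if "x \<in> X" "b \<in> B" for x b using that c X by blast
    qed (use B(1) X in \<open>auto intro: Qp_diff Qp_mult Qp_inverse\<close>)
    then obtain d where d: "\<forall>x\<in>X. d x \<in> Qp" "\<exists>x\<in>X. d x \<noteq> 0" "\<forall>b\<in>B. (\<Sum>x\<in>X. d x * c x b) = 0"
      by blast
    have "(\<Sum>x\<in>X. d x * x) = (\<Sum>x\<in>X. \<Sum>b\<in>B. d x * c x b * b)"
    proof (intro sum.cong refl)
      fix x assume "x \<in> X"
      then have "x = (\<Sum>b\<in>B. c x b * b)" using c X(2) by blast
      then have "d x * x = d x * (\<Sum>b\<in>B. c x b * b)" by (rule arg_cong)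
      then show "d x * x = (\<Sum>b\<in>B. d x * c x b * b)" by (simp add: sum_distrib_left mult.assoc)
    qed
    also have "\<dots> = (\<Sum>b\<in>B. (\<Sum>x\<in>X. d x * c x b) * b)"
      by (subst sum.swap) (simp add: sum_distrib_right)
    also have "\<dots> = 0" using d(3) by simp
    finally show "\<exists>d. (\<forall>x\<in>X. d x \<in> Qp) \<and> (\<exists>x\<in>X. d x \<noteq> 0) \<and> (\<Sum>x\<in>X. d x * x) = 0"
      using d by blast
  qed
qed

text \<open>
  The summand of smallest valuation determines the valuation of the sum.
\<close>

lemma sum_distinct_valuations_nonzero:
  assumes "finite X" "X \<noteq> {}" "inj_on (\<lambda>x. v (g x)) X" "\<And>x. x \<in> X \<Longrightarrow> g x \<noteq> 0"
  shows "sum g X \<noteq> 0"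
proof -
  obtain x0 where x0: "x0 \<in> X" "\<And>x. x \<in> X \<Longrightarrow> v (g x0) \<le> v (g x)"
  proof -
    have "Min ((\<lambda>x. v (g x)) ` X) \<in> (\<lambda>x. v (g x)) ` X" using assms(1,2) by (intro Min_in) auto
    then obtain x0 where "x0 \<in> X" "v (g x0) = Min ((\<lambda>x. v (g x)) ` X)" by auto
    moreover have "Min ((\<lambda>x. v (g x)) ` X) \<le> v (g x)" if "x \<in> X" for x
      using assms(1) that by (intro Min_le) auto
    ultimately show ?thesis using that by simp
  qed
  have "v (g x0) < v (sum g (X - {x0}))"
  proof (rule v_sum_gt)
    show "v (g x0) < \<infinity>" using assms(4)[OF x0(1)] v_infinity[of "g x0"] by (simp add: less_top[symmetric] top_ereal_def)
    fix i assume i: "i \<in> X - {x0}"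
    then have "v (g x0) \<noteq> v (g i)" using assms(3) x0(1) by (auto dest: inj_onD)
    then show "v (g x0) < v (g i)" using x0(2)[of i] i by simp
  qed
  then have "v (g x0 + sum g (X - {x0})) = v (g x0)" by (rule v_add_eq)
  moreover have "sum g X = g x0 + sum g (X - {x0})" using x0(1) assms(1) by (rule sum.remove[rotated])
  ultimately have "v (sum g X) = v (g x0)" by simp
  then show ?thesis using assms(4)[OF x0(1)] v_infinity by (metis v_zero)
qed

end

section \<open>Ramification index and residue degree of a finite extension\<close>

context Cp
begin

lemma finite_extensionD:
  fixes K :: "'a set"
  assumes "finite_extension_Qp K"
  shows "Qp \<subseteq> K" "x \<in> K \<Longrightarrow> y \<in> K \<Longrightarrow> x + y \<in> K" "x \<in> K \<Longrightarrow> y \<in> K \<Longrightarrow> x - y \<in> K"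
    "x \<in> K \<Longrightarrow> y \<in> K \<Longrightarrow> x * y \<in> K" "x \<in> K \<Longrightarrow> inverse x \<in> K"
    "x \<in> K \<Longrightarrow> y \<in> K \<Longrightarrow> x / y \<in> K" "0 \<in> K" "1 \<in> K" "x \<in> K \<Longrightarrow> x ^ n \<in> K" "of_nat n \<in> K"
proof -
  show sub: "Qp \<subseteq> K" and m: "\<And>x y. x \<in> K \<Longrightarrow> y \<in> K \<Longrightarrow> x * y \<in> K"
    and i: "\<And>x. x \<in> K \<Longrightarrow> inverse x \<in> K"
    and "x \<in> K \<Longrightarrow> y \<in> K \<Longrightarrow> x + y \<in> K" "x \<in> K \<Longrightarrow> y \<in> K \<Longrightarrow> x - y \<in> K" for x y
    using assms by (auto simp: finite_extension_Qp_def)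
  show "x \<in> K \<Longrightarrow> y \<in> K \<Longrightarrow> x / y \<in> K" using m i by (simp add: divide_inverse)
  show "0 \<in> K" "of_nat n \<in> K" using sub Rats_Qp by auto
  show one: "1 \<in> K" using sub Rats_Qp by auto
  show "x \<in> K \<Longrightarrow> x ^ n \<in> K" by (induction n) (auto intro: m one)
qed

lemma sum_in_extension:
  fixes K :: "'a set"
  assumes "finite_extension_Qp K" "\<And>i. i \<in> A \<Longrightarrow> g i \<in> K" shows "sum g A \<in> K"
  using assms(2)
  by (induction A rule: infinite_finite_induct)
    (auto intro: finite_extensionD(2)[OF assms(1)] simp: finite_extensionD(7)[OF assms(1)])

text \<open>
  Elements of \<open>K\<close> whose valuations are distinct modulo the integers are linearly independent over
  \<open>Qp\<close>, since a linear combination has summands of distinct valuations. So there are only finitely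
  many values between \<open>0\<close> and \<open>1\<close>, and the smallest positive one generates the value group by
  division with remainder.
\<close>

lemma value_group_generator:
  assumes K: "finite_extension_Qp K"
  obtains \<gamma> \<pi> where "0 < \<gamma>" "\<pi> \<in> K" "v \<pi> = ereal \<gamma>"
    "\<And>x. x \<in> K \<Longrightarrow> x \<noteq> 0 \<Longrightarrow> \<exists>k::int. v x = ereal (\<gamma> * of_int k)"
proof -
  note KD = finite_extensionD[OF K]
  obtain D where D: "\<forall>X. finite X \<longrightarrow> X \<subseteq> K \<longrightarrow> D < card X \<longrightarrow>
    (\<exists>d. (\<forall>x\<in>X. d x \<in> Qp) \<and> (\<exists>x\<in>X. d x \<noteq> 0) \<and> (\<Sum>x\<in>X. d x * x) = 0)"
    by (rule exE[OF finite_extension_dimension_bound[OF K]])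
  define W where "W = {r. 0 < r \<and> r \<le> 1 \<and> (\<exists>x\<in>K. v x = ereal r)}"
  have "finite W"
  proof (rule ccontr)
    assume "infinite W"
    then obtain R where R: "R \<subseteq> W" "finite R" "card R = Suc D"
      using infinite_arbitrarily_large by metis
    have "\<forall>r\<in>R. \<exists>x. x \<in> K \<and> v x = ereal r" using R(1) by (auto simp: W_def)
    then obtain x where x: "\<And>r. r \<in> R \<Longrightarrow> x r \<in> K \<and> v (x r) = ereal r" by metis
    have inj: "inj_on x R" by (rule inj_onI) (metis x ereal.inject)
    have "\<exists>d. (\<forall>y\<in>x ` R. d y \<in> Qp) \<and> (\<exists>y\<in>x ` R. d y \<noteq> 0) \<and> (\<Sum>y\<in>x ` R. d y * y) = 0"
      using R x inj by (intro D[rule_format]) (auto simp: card_image)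
    then obtain d where d: "\<forall>y\<in>x ` R. d y \<in> Qp" "\<exists>y\<in>x ` R. d y \<noteq> 0" "(\<Sum>y\<in>x ` R. d y * y) = 0"
      by blast
    \<comment> \<open>The coefficients in \<open>Qp\<close> have integral valuations, and the values in \<open>R\<close> are distinct modulo
      the integers.\<close>
    define R' where "R' = {r \<in> R. d (x r) \<noteq> 0}"
    define g where "g r = d (x r) * x r" for r
    have dv: "\<exists>k::int. v (d (x r)) = ereal (of_int k)" if "r \<in> R'" for r
      using that d(1) by (intro v_Qp_int) (auto simp: R'_def)
    have "sum g R' \<noteq> 0"
    proof (rule sum_distinct_valuations_nonzero)
      show "finite R'" "R' \<noteq> {}" using R d(2) by (auto simp: R'_def)
      show "g r \<noteq> 0" if "r \<in> R'" for r using that x by (force simp: R'_def g_def)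
      show "inj_on (\<lambda>r. v (g r)) R'"
      proof (rule inj_onI)
        fix r s assume rs: "r \<in> R'" "s \<in> R'" "v (g r) = v (g s)"
        obtain k :: int where k: "v (d (x r)) = ereal (of_int k)" using dv rs(1) by blast
        obtain l :: int where l: "v (d (x s)) = ereal (of_int l)" using dv rs(2) by blast
        have "of_int k + r = of_int l + s"
          using rs k l x by (auto simp: g_def v_mult R'_def)
        moreover have "0 < r" "r \<le> 1" "0 < s" "s \<le> 1" using rs R(1) by (auto simp: R'_def W_def)
        ultimately have "k = l" by linarith
        then show "r = s" using \<open>of_int k + r = of_int l + s\<close> by simp
      qed
    qed
    moreover have "sum g R' = sum g R"
      using R(2) by (intro sum.mono_neutral_left) (auto simp: R'_def g_def)
    moreover have "sum g R = (\<Sum>y\<in>x ` R. d y * y)"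
      unfolding g_def using inj by (simp add: sum.reindex)
    ultimately show False using d(3) by simp
  qed
  moreover have one: "1 \<in> W"
    using KD(10)[of p] v_p by (auto simp: W_def one_ereal_def)
  ultimately have min: "Min W \<in> W" "\<And>r. r \<in> W \<Longrightarrow> Min W \<le> r" by (auto intro: Min_in)
  define \<gamma> where "\<gamma> = Min W"
  obtain \<pi> where pi: "\<pi> \<in> K" "v \<pi> = ereal \<gamma>" and g: "0 < \<gamma>" "\<gamma> \<le> 1"
    using min(1) unfolding W_def \<gamma>_def by blast
  have pi0: "\<pi> \<noteq> 0" using pi by auto
  show ?thesis
  proof (rule that[OF g(1) pi])
    fix x assume x: "x \<in> K" "x \<noteq> 0"
    obtain r where r: "v x = ereal r" using x(2) by (rule v_real)
    define k where "k = \<lfloor>r / \<gamma>\<rfloor>"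
    define s where "s = r - \<gamma> * of_int k"
    have s: "0 \<le> s" "s < \<gamma>"
    proof -
      have "of_int k \<le> r / \<gamma>" "r / \<gamma> < of_int k + 1" unfolding k_def by linarith+
      then show "0 \<le> s" "s < \<gamma>" using g by (auto simp: s_def field_simps)
    qed
    \<comment> \<open>The power of \<open>\<pi>\<close> that brings the valuation of \<open>x\<close> into the interval from \<open>0\<close> to \<open>\<gamma>\<close>.\<close>
    define u where "u = (if k \<ge> 0 then inverse \<pi> ^ nat k else \<pi> ^ nat (- k))"
    have "u \<in> K" unfolding u_def using KD pi by simp
    moreover have "v u = ereal (- \<gamma> * of_int k)"
      using pi v_inverse[OF pi0] by (auto simp: u_def v_power)
    ultimately have xu: "x * u \<in> K" "v (x * u) = ereal s"
      using x KD(4) r by (auto simp: v_mult s_def)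
    have "s = 0"
    proof (rule ccontr)
      assume "s \<noteq> 0"
      then have "s \<in> W" unfolding W_def using s g xu by auto
      then show False using min(2)[of s] s(2) by (simp add: \<gamma>_def)
    qed
    then show "\<exists>k::int. v x = ereal (\<gamma> * of_int k)" using r by (auto simp: s_def)
  qed
qed

text \<open>
  Principal ideals are equal exactly if their generators have the same valuation, so the
  ramification index is the integer \<open>e\<close> with \<open>v p = e * v \<pi>\<close>.
\<close>

lemma ramification_index_value_group:
  assumes K: "finite_extension_Qp K" and e: "e = ramification_index p v K"
  obtains \<pi> where "e > 0" "\<pi> \<in> K" "v \<pi> = ereal (1 / real e)"
    "\<And>x. x \<in> K \<Longrightarrow> x \<noteq> 0 \<Longrightarrow> \<exists>k::int. v x = ereal (of_int k / real e)"
proof -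
  note KD = finite_extensionD[OF K]
  obtain \<gamma> \<pi> where g: "0 < \<gamma>" "\<pi> \<in> K" "v \<pi> = ereal \<gamma>"
    "\<And>x. x \<in> K \<Longrightarrow> x \<noteq> 0 \<Longrightarrow> \<exists>k::int. v x = ereal (\<gamma> * of_int k)"
    using value_group_generator[OF K] by metis
  have p0: "of_nat p \<noteq> (0::'a)" using p_gt_1 by simp
  obtain k :: int where k: "1 = \<gamma> * of_int k"
    using g(4)[OF KD(10)[of p] p0] v_p by (auto simp: one_ereal_def)
  have "k > 0"
  proof (rule ccontr)
    assume "\<not> k > 0"
    then have "\<gamma> * of_int k \<le> 0" using g(1) by (simp add: mult_le_0_iff)
    then show False using k by simp
  qed
  define e' where "e' = nat k"
  have e': "e' > 0" "\<gamma> * real e' = 1" using k \<open>k > 0\<close> by (auto simp: e'_def)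
  have scale: "(\<lambda>x. a * x) ` val_ring v K = (\<lambda>x. b * x) ` val_ring v K \<longleftrightarrow> v a = v b"
    if ab: "a \<in> K" "b \<in> K" "a \<noteq> 0" "b \<noteq> 0" for a b
  proof -
    have sub: "(\<lambda>x. a * x) ` val_ring v K \<subseteq> (\<lambda>x. b * x) ` val_ring v K \<longleftrightarrow> v b \<le> v a"
      if ab: "a \<in> K" "b \<in> K" "a \<noteq> 0" "b \<noteq> 0" for a b
    proof
      assume L: "(\<lambda>x. a * x) ` val_ring v K \<subseteq> (\<lambda>x. b * x) ` val_ring v K"
      have "1 \<in> val_ring v K" using KD by (simp add: val_ring_def)
      then have "a * 1 \<in> (\<lambda>x. b * x) ` val_ring v K" using L by blast
      then obtain x where "a = b * x" "0 \<le> v x" by (auto simp: val_ring_def)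
      then show "v b \<le> v a" using v_mult_ge_left[of "v b" b x] by simp
    next
      assume R: "v b \<le> v a"
      show "(\<lambda>x. a * x) ` val_ring v K \<subseteq> (\<lambda>x. b * x) ` val_ring v K"
      proof
        fix y assume "y \<in> (\<lambda>x. a * x) ` val_ring v K"
        then obtain x where x: "y = a * x" "x \<in> K" "0 \<le> v x" by (auto simp: val_ring_def)
        obtain r where r: "v b = ereal r" using ab(4) by (rule v_real)
        have "ereal (0 + r) \<le> v a" using R r by simp
        then have "0 \<le> v (a / b)" using v_divide_ge[OF r] by (metis zero_ereal_def)
        then have "0 \<le> v (a / b * x)" using x by (intro v_mult_nonneg)
        moreover have "a / b * x \<in> K" by (intro KD ab x)
        ultimately have "a / b * x \<in> val_ring v K" by (simp only: val_ring_def mem_Collect_eq simp_thms)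
        moreover have "y = b * (a / b * x)" using x ab by simp
        ultimately show "y \<in> (\<lambda>x. b * x) ` val_ring v K" by (rule rev_image_eqI)
      qed
    qed
    show ?thesis using sub[OF ab] sub[OF ab(2,1,4,3)] by (auto simp: set_eq_subset intro: antisym)
  qed
  have unif: "uniformizer v K \<pi>' \<longleftrightarrow> \<pi>' \<in> K \<and> v \<pi>' = ereal \<gamma>" for \<pi>'
  proof -
    have pi: "val_ideal v K = (\<lambda>x. \<pi> * x) ` val_ring v K"
    proof (intro equalityI subsetI)
      fix x assume x: "x \<in> val_ideal v K"
      have pi0: "\<pi> \<noteq> 0" using g by auto
      have "0 \<le> v (x / \<pi>)"
      proof (cases "x = 0")
        case False
        then obtain j :: int where j: "v x = ereal (\<gamma> * of_int j)"
          using g(4) x by (auto simp: val_ideal_def)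
        then have "0 < \<gamma> * of_int j" using x by (simp add: val_ideal_def)
        then have "j \<ge> 1" using g(1) by (simp add: zero_less_mult_iff)
        then have "\<gamma> * 1 \<le> \<gamma> * of_int j" using g(1) by (intro mult_left_mono) auto
        then have "ereal (0 + \<gamma>) \<le> v x" using j by simp
        then show ?thesis using v_divide_ge[OF g(3), of 0 x] by (simp add: zero_ereal_def)
      qed simp
      then have "x / \<pi> \<in> val_ring v K" using x KD g by (auto simp: val_ring_def val_ideal_def)
      moreover have "x = \<pi> * (x / \<pi>)" using pi0 by simp
      ultimately show "x \<in> (\<lambda>x. \<pi> * x) ` val_ring v K" by blast
    next
      fix y assume "y \<in> (\<lambda>x. \<pi> * x) ` val_ring v K"
      then obtain x where x: "y = \<pi> * x" "x \<in> K" "0 \<le> v x" by (auto simp: val_ring_def)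
      have "0 < v \<pi>" using g by simp
      also have "v \<pi> \<le> v y" unfolding x(1) using x by (intro v_mult_ge_left) auto
      finally show "y \<in> val_ideal v K" using x KD g by (auto simp: val_ideal_def)
    qed
    show ?thesis
    proof (cases "\<pi>' = 0")
      case True
      have "\<pi> \<in> val_ideal v K" using g by (simp add: val_ideal_def)
      moreover have "\<pi> \<noteq> 0" using g by auto
      ultimately show ?thesis using True by (auto simp: uniformizer_def)
    next
      case False
      then show ?thesis unfolding uniformizer_def pi
        using scale[of \<pi> \<pi>'] g by force
    qed
  qed
  have ram: "(\<lambda>x. of_nat p * x) ` val_ring v K = (\<lambda>x. \<pi>' ^ n * x) ` val_ring v K \<longleftrightarrow> n = e'"
    if "uniformizer v K \<pi>'" for \<pi>' n
  proof -
    have pi': "\<pi>' \<in> K" "v \<pi>' = ereal \<gamma>" "\<pi>' \<noteq> 0" using that unif by auto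
    have "v (of_nat p) = v (\<pi>' ^ n) \<longleftrightarrow> \<gamma> * real n = \<gamma> * real e'"
      using e'(2) pi' v_p by (auto simp: v_power one_ereal_def mult.commute)
    also have "\<dots> \<longleftrightarrow> n = e'" using g(1) by simp
    finally show ?thesis using scale[OF KD(10) KD(9)[OF pi'(1)] p0] pi'(3) by simp
  qed
  have "ramification_index p v K = e'"
    unfolding ramification_index_def
    using ram unif g by (intro the_equality) blast+
  then have ee: "e = e'" using e by simp
  have ge: "\<gamma> = 1 / real e" using e' unfolding ee by (simp add: field_simps)
  show ?thesis
    by (rule that[of \<pi>]) (use e' ee g in \<open>auto simp: ge\<close>)
qed

text \<open>
  Linear independence of the residue classes over the residue field of \<open>Qp\<close>, expressed with lifts
  of vectors and scalars.
\<close>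

definition independent_mod :: "'a set \<Rightarrow> bool" where
  "independent_mod X \<longleftrightarrow>
     (\<forall>c. (\<forall>x\<in>X. c x \<in> val_ring v Qp) \<longrightarrow> 0 < v (\<Sum>x\<in>X. c x * x) \<longrightarrow> (\<forall>x\<in>X. 0 < v (c x)))"

text \<open>
  A linear relation over \<open>Qp\<close> becomes a nontrivial relation between the residue classes after
  division by its coefficient of smallest valuation.
\<close>

lemma card_independent_mod_le:
  assumes D: "\<forall>X. finite X \<longrightarrow> X \<subseteq> K \<longrightarrow> D < card X \<longrightarrow>
    (\<exists>d. (\<forall>x\<in>X. d x \<in> Qp) \<and> (\<exists>x\<in>X. d x \<noteq> 0) \<and> (\<Sum>x\<in>X. d x * x) = 0)"
    and X: "finite X" "X \<subseteq> K" "independent_mod X"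
  shows "card X \<le> D"
proof (rule ccontr)
  assume "\<not> card X \<le> D"
  then obtain d where d: "\<forall>x\<in>X. d x \<in> Qp" "\<exists>x\<in>X. d x \<noteq> 0" "(\<Sum>x\<in>X. d x * x) = 0"
    using D[rule_format, OF X(1,2)] by (auto simp: not_le)
  have "X \<noteq> {}" using d by auto
  then have "Min ((\<lambda>x. v (d x)) ` X) \<in> (\<lambda>x. v (d x)) ` X" using X by (intro Min_in) auto
  then obtain x0 where x0: "x0 \<in> X" "v (d x0) = Min ((\<lambda>x. v (d x)) ` X)" by auto
  have min: "v (d x0) \<le> v (d x)" if "x \<in> X" for x
    unfolding x0(2) using X that by (intro Min_le) auto
  have nz: "d x0 \<noteq> 0"
  proof
    assume "d x0 = 0"
    then have "d x = 0" if "x \<in> X" for x using min[OF that] v_infinity[of "d x"] by simp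
    then show False using d by blast
  qed
  then obtain r where r: "v (d x0) = ereal r" by (rule v_real)
  have "0 \<le> v (d x / d x0)" if "x \<in> X" for x
    using v_divide_ge[OF r, of 0 "d x"] min[OF that] r by (simp add: zero_ereal_def)
  moreover have "d x / d x0 \<in> Qp" if "x \<in> X" for x
    unfolding divide_inverse using d(1) that x0(1) by (intro Qp_mult Qp_inverse) auto
  ultimately have "\<forall>x\<in>X. d x / d x0 \<in> val_ring v Qp" by (simp add: val_ring_def)
  moreover have "(\<Sum>x\<in>X. d x / d x0 * x) = (\<Sum>x\<in>X. d x * x) / d x0"
    by (simp add: sum_divide_distrib)
  then have "0 < v (\<Sum>x\<in>X. d x / d x0 * x)" using d(3) by simp
  ultimately have "\<forall>x\<in>X. 0 < v (d x / d x0)"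
    using X(3)[unfolded independent_mod_def, THEN spec, of "\<lambda>x. d x / d x0"] by simp
  then have "0 < v (d x0 / d x0)" using x0(1) by (rule bspec)
  then show False using nz by simp
qed

text \<open>
  A maximal independent set of residue classes spans. The residue degree is the least size of a
  spanning set and is meaningful only because a finite one exists.
\<close>

lemma residue_field_finitely_generated:
  assumes K: "finite_extension_Qp K"
  shows "\<exists>X. finite X \<and> X \<subseteq> val_ring v K \<and>
        (\<forall>x\<in>val_ring v K. \<exists>c. (\<forall>b\<in>X. c b \<in> val_ring v Qp) \<and>
           x - (\<Sum>b\<in>X. c b * b) \<in> val_ideal v K)"
proof -
  note KD = finite_extensionD[OF K]
  obtain D where D: "\<forall>X. finite X \<longrightarrow> X \<subseteq> K \<longrightarrow> D < card X \<longrightarrow>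
    (\<exists>d. (\<forall>x\<in>X. d x \<in> Qp) \<and> (\<exists>x\<in>X. d x \<noteq> 0) \<and> (\<Sum>x\<in>X. d x * x) = 0)"
    by (rule exE[OF finite_extension_dimension_bound[OF K]])
  define P where "P X \<longleftrightarrow> finite X \<and> X \<subseteq> val_ring v K \<and> independent_mod X" for X
  have "P {}" by (auto simp: P_def independent_mod_def)
  moreover have "\<forall>X. P X \<longrightarrow> card X < Suc D"
    using card_independent_mod_le[OF D] by (force simp: P_def val_ring_def)
  ultimately obtain X where X: "P X" "\<And>Y. P Y \<Longrightarrow> card Y \<le> card X"
    using ex_has_greatest_nat[of P "{}" card "Suc D"] by (metis less_imp_le)
  have Xf: "finite X" "X \<subseteq> val_ring v K" "independent_mod X" using X(1) by (auto simp: P_def)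
  have Q0: "0 \<in> val_ring v Qp" "1 \<in> val_ring v Qp"
    using Rats_Qp[of 0] Rats_Qp[of 1] by (auto simp: val_ring_def)
  have "\<exists>c. (\<forall>b\<in>X. c b \<in> val_ring v Qp) \<and> y - (\<Sum>b\<in>X. c b * b) \<in> val_ideal v K"
    if y: "y \<in> val_ring v K" for y
  proof (cases "y \<in> X")
    case True
    have "(\<Sum>b\<in>X. (if b = y then 1 else 0) * b) = y"
      using True Xf(1) by (simp add: if_distrib[of "\<lambda>c. c * _"] cong: if_cong)
    then show ?thesis using Q0 KD(7) by (intro exI[of _ "\<lambda>b. if b = y then 1 else 0"]) (auto simp: val_ideal_def)
  next
    case False
    have "\<not> P (insert y X)" using X(2)[of "insert y X"] False Xf(1) by auto
    then have "\<not> independent_mod (insert y X)" using Xf y by (auto simp: P_def)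
    then obtain c where c: "\<forall>x\<in>insert y X. c x \<in> val_ring v Qp" "0 < v (\<Sum>x\<in>insert y X. c x * x)"
       "\<not> (\<forall>x\<in>insert y X. 0 < v (c x))"
      unfolding independent_mod_def by blast
    have S: "(\<Sum>x\<in>insert y X. c x * x) = c y * y + (\<Sum>x\<in>X. c x * x)" using False Xf(1) by simp
    have cy: "v (c y) = 0"
    proof (rule ccontr)
      assume "v (c y) \<noteq> 0"
      then have pos: "0 < v (c y)" using c(1) by (simp add: val_ring_def less_le)
      then have "0 < v (c y * y)" using y v_mult_ge_left[of "v (c y)" "c y" y] less_le_trans
        by (auto simp: val_ring_def)
      then have "0 < v ((\<Sum>x\<in>insert y X. c x * x) - c y * y)" using c(2) by (rule v_diff_gt[rotated])
      then have "0 < v (\<Sum>x\<in>X. c x * x)" unfolding S by simp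
      then have "\<forall>x\<in>X. 0 < v (c x)" using Xf(3) c(1) unfolding independent_mod_def by blast
      then show False using c(3) pos by blast
    qed
    then have cy0: "c y \<noteq> 0" by auto
    define c' where "c' x = - (c x / c y)" for x
    have viy: "v (inverse (c y)) = 0" by (rule v_inverse_unit[OF cy])
    have "c' x \<in> val_ring v Qp" if "x \<in> X" for x
    proof -
      have "c x * inverse (c y) \<in> Qp" "0 \<le> v (c x * inverse (c y))"
        using c(1) that viy by (auto simp: val_ring_def v_mult intro: Qp_mult Qp_inverse)
      then show ?thesis using Qp_diff[of 0 "c x * inverse (c y)"] Q0
        by (simp add: c'_def val_ring_def divide_inverse)
    qed
    moreover have "(\<Sum>x\<in>X. c' x * x) = - ((\<Sum>x\<in>X. c x * x) * inverse (c y))"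
      unfolding sum_distrib_right sum_negf[symmetric]
      by (intro sum.cong) (auto simp: c'_def divide_inverse)
    then have "y - (\<Sum>x\<in>X. c' x * x) = (c y * y + (\<Sum>x\<in>X. c x * x)) * inverse (c y)"
      using cy0 by (simp add: distrib_right mult.assoc mult.left_commute)
    then have "0 < v (y - (\<Sum>x\<in>X. c' x * x))" using c(2) viy by (simp add: S v_mult)
    moreover have "y - (\<Sum>x\<in>X. c' x * x) \<in> K"
      using y Xf(2) calculation(1) KD(1)
      by (intro KD(3) sum_in_extension[OF K] KD(4)) (auto simp: val_ring_def)
    ultimately show ?thesis by (intro exI[of _ c']) (auto simp: val_ideal_def)
  qed
  then show ?thesis using Xf by blast
qed

text \<open>
  The combinations with coefficients \<open>0, ..., p - 1\<close> of a spanning set of least size represent all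
  residue classes. They represent each class once: from two combinations in the same class one
  could express one vector of the spanning set by the others and remove it.
\<close>

lemma residue_system:
  assumes K: "finite_extension_Qp K" and f: "f = residue_degree v K"
  obtains R where "finite R" "card R = p ^ f" "0 \<in> R" "R \<subseteq> val_ring v K"
    "\<And>x. x \<in> val_ring v K \<Longrightarrow> \<exists>r\<in>R. 0 < v (x - r)"
    "\<And>r s. r \<in> R \<Longrightarrow> s \<in> R \<Longrightarrow> 0 < v (r - s) \<Longrightarrow> r = s"
proof -
  note KD = finite_extensionD[OF K]
  define spans where "spans X \<longleftrightarrow> finite X \<and> X \<subseteq> val_ring v K \<and>
        (\<forall>x\<in>val_ring v K. \<exists>c. (\<forall>b\<in>X. c b \<in> val_ring v Qp) \<and>
           x - (\<Sum>b\<in>X. c b * b) \<in> val_ideal v K)" for X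
  have f': "f = (LEAST d. \<exists>X. spans X \<and> card X = d)"
    unfolding f residue_degree_def spans_def by (rule arg_cong[where f = Least]) auto
  obtain X0 where "spans X0" using residue_field_finitely_generated[OF K] unfolding spans_def by blast
  then have "\<exists>X. spans X \<and> card X = f" unfolding f' by (rule_tac LeastI_ex) blast
  then obtain X where X: "spans X" "card X = f" by blast
  have minimal: "f \<le> card Y" if "spans Y" for Y
    unfolding f' using that by (intro Least_le) blast
  have Xf: "finite X" "X \<subseteq> val_ring v K" using X by (auto simp: spans_def)
  define comb :: "('a \<Rightarrow> nat) \<Rightarrow> 'a" where "comb n = (\<Sum>b\<in>X. of_nat (n b) * b)" for n
  define N where "N = PiE X (\<lambda>_. {..<p})"
  have distinct: "n = n'" if n: "n \<in> N" "n' \<in> N" "0 < v (comb n - comb n')" for n n'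
  proof (rule ccontr)
    assume "n \<noteq> n'"
    then obtain b0 where b0: "b0 \<in> X" "n b0 \<noteq> n' b0"
      using n(1,2) unfolding N_def by (metis PiE_ext)
    define w where "w b = (of_int (int (n b) - int (n' b)) :: 'a)" for b
    have diff: "comb n - comb n' = (\<Sum>b\<in>X. w b * b)"
      by (simp add: comb_def w_def sum_subtractf left_diff_distrib)
    have wQ: "w b \<in> Qp" "0 \<le> v (w b)" for b
      unfolding w_def by (rule Rats_Qp, simp) (rule v_of_int_nonneg)
    have lt: "n b0 < p" "n' b0 < p" using n b0 by (auto simp: N_def PiE_def Pi_def)
    have "\<not> int p dvd (int (n b0) - int (n' b0))"
    proof
      assume "int p dvd (int (n b0) - int (n' b0))"
      then have "int p \<le> \<bar>int (n b0) - int (n' b0)\<bar>"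
        using b0(2) dvd_imp_le_int[of "int (n b0) - int (n' b0)" "int p"] by simp
      then show False using lt by linarith
    qed
    then have wb0: "v (w b0) = 0" unfolding w_def by (rule v_of_int_coprime)
    then have w0: "w b0 \<noteq> 0" by auto
    have viw: "v (inverse (w b0)) = 0" by (rule v_inverse_unit[OF wb0])
    let ?Y = "X - {b0}"
    have "spans ?Y" unfolding spans_def
    proof (intro conjI ballI)
      fix x assume x: "x \<in> val_ring v K"
      obtain c where c: "\<forall>b\<in>X. c b \<in> val_ring v Qp" "x - (\<Sum>b\<in>X. c b * b) \<in> val_ideal v K"
        using X(1) x unfolding spans_def by blast
      define q where "q = c b0 * inverse (w b0)"
      have q: "q \<in> Qp" "0 \<le> v q"
        using c(1) b0(1) viw wQ by (auto simp: q_def val_ring_def v_mult intro: Qp_mult Qp_inverse)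
      \<comment> \<open>Subtracting a multiple of the relation \<open>comb n - comb n'\<close> eliminates \<open>b0\<close> from the combination.\<close>
      define c' where "c' b = c b - q * w b" for b
      have c': "c' b \<in> val_ring v Qp" if "b \<in> X" for b
        using c(1) that q wQ[of b] unfolding c'_def val_ring_def
        by (auto intro!: Qp_diff Qp_mult v_diff_ge v_mult_nonneg)
      have "c' b0 = 0" using w0 by (simp add: c'_def q_def)
      then have "(\<Sum>b\<in>?Y. c' b * b) = (\<Sum>b\<in>X. c' b * b)"
        using Xf(1) b0(1) by (simp add: sum.remove[of X b0])
      also have "\<dots> = (\<Sum>b\<in>X. c b * b) - q * (comb n - comb n')"
        unfolding diff c'_def by (simp add: left_diff_distrib sum_subtractf sum_distrib_left mult.assoc)
      finally have eq: "x - (\<Sum>b\<in>?Y. c' b * b) = (x - (\<Sum>b\<in>X. c b * b)) + q * (comb n - comb n')"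
        by simp
      have "0 < v (q * (comb n - comb n'))"
        using n(3) v_mult_ge_right[OF q(2) order_refl] less_le_trans by blast
      then have "0 < v (x - (\<Sum>b\<in>?Y. c' b * b))"
        unfolding eq using c(2) by (intro v_add_gt) (auto simp: val_ideal_def)
      moreover have "x - (\<Sum>b\<in>?Y. c' b * b) \<in> K"
        using x Xf(2) c' KD(1)
        by (intro KD(3) sum_in_extension[OF K] KD(4)) (auto simp: val_ring_def)
      ultimately show "\<exists>c. (\<forall>b\<in>?Y. c b \<in> val_ring v Qp) \<and> x - (\<Sum>b\<in>?Y. c b * b) \<in> val_ideal v K"
        using c' by (intro exI[of _ c']) (auto simp: val_ideal_def)
    qed (use Xf in auto)
    then have "f \<le> card ?Y" by (rule minimal)
    moreover have "card ?Y < card X" using Xf(1) b0(1) by (rule card_Diff1_less)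
    ultimately show False using X(2) by simp
  qed
  have inj: "inj_on comb N" by (rule inj_onI) (use distinct in force)
  show ?thesis
  proof (rule that[of "comb ` N"])
    show "finite (comb ` N)" unfolding N_def using Xf(1) by (intro finite_imageI finite_PiE) auto
    show "card (comb ` N) = p ^ f"
      using Xf(1) X(2) inj by (simp add: card_image N_def card_PiE)
    have "restrict (\<lambda>_. 0) X \<in> N" using p_gt_1 by (auto simp: N_def)
    moreover have "comb (restrict (\<lambda>_. 0) X) = 0" unfolding comb_def by (intro sum.neutral) simp
    ultimately show "0 \<in> comb ` N" by (metis imageI)
    have combK: "comb n \<in> K" for n
      unfolding comb_def using Xf(2) KD(10) by (intro sum_in_extension[OF K] KD(4)) (auto simp: val_ring_def)
    have comb0: "0 \<le> v (comb n)" for n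
      unfolding comb_def using Xf(2) v_of_nat_nonneg by (intro v_sum_ge v_mult_nonneg) (auto simp: val_ring_def)
    show "comb ` N \<subseteq> val_ring v K" using combK comb0 by (auto simp: val_ring_def)
    show "r = s" if rs: "r \<in> comb ` N" "s \<in> comb ` N" "0 < v (r - s)" for r s
    proof -
      obtain n n' where "n \<in> N" "r = comb n" "n' \<in> N" "s = comb n'" using rs(1,2) by blast
      then show ?thesis using distinct[of n n'] rs(3) by simp
    qed
    fix x assume x: "x \<in> val_ring v K"
    obtain c where c: "\<forall>b\<in>X. c b \<in> val_ring v Qp" "x - (\<Sum>b\<in>X. c b * b) \<in> val_ideal v K"
      using X(1) x unfolding spans_def by blast
    have "\<forall>b\<in>X. \<exists>k<p. 0 < v (c b - of_nat k)" using c(1) Qp_residue by (auto simp: val_ring_def)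
    then obtain k where k: "\<forall>b\<in>X. k b < p \<and> 0 < v (c b - of_nat (k b))" by metis
    have "restrict k X \<in> N" using k by (auto simp: N_def)
    moreover have "0 < v (x - comb (restrict k X))"
    proof -
      have eq: "comb (restrict k X) = (\<Sum>b\<in>X. of_nat (k b) * b)"
        unfolding comb_def by (intro sum.cong) auto
      have "0 < v ((c b - of_nat (k b)) * b)" if "b \<in> X" for b
      proof -
        have "0 < v (c b - of_nat (k b))" using k that by blast
        also have "\<dots> \<le> v ((c b - of_nat (k b)) * b)"
          using Xf(2) that by (intro v_mult_ge_left) (auto simp: val_ring_def)
        finally show ?thesis .
      qed
      then have "0 < v (\<Sum>b\<in>X. (c b - of_nat (k b)) * b)" by (intro v_sum_gt) auto
      then have "0 < v ((x - (\<Sum>b\<in>X. c b * b)) + (\<Sum>b\<in>X. (c b - of_nat (k b)) * b))"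
        using c(2) by (intro v_add_gt) (auto simp: val_ideal_def)
      then show ?thesis unfolding eq by (simp add: left_diff_distrib sum_subtractf)
    qed
    ultimately show "\<exists>r\<in>comb ` N. 0 < v (x - r)" by blast
  qed
qed

end

section \<open>The numerical functions, and digit expansions\<close>

text \<open>
  The properties of the functions \<open>alpha p f\<close> and \<open>alpha' p f\<close> on which the bound depends.
  Unboundedness makes the least index in the definition of \<open>beta_sum\<close> exist.
\<close>

locale superadditive =
  fixes \<alpha> :: "nat \<Rightarrow> nat"
  assumes zero: "\<alpha> 0 = 0"
    and superadd: "\<alpha> n + \<alpha> j \<le> \<alpha> (n + j)"
    and unbounded: "\<exists>j. m \<le> \<alpha> j"
begin

definition beta_sum :: "nat \<Rightarrow> nat" where
  "beta_sum s = (\<Sum>m=1..s. LEAST j. \<alpha> j \<ge> m)"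

lemma mono: "n \<le> j \<Longrightarrow> \<alpha> n \<le> \<alpha> j"
  using superadd[of n "j - n"] by simp

text \<open>
  The least \<open>j\<close> with \<open>m \<le> \<alpha> j\<close> is the number of \<open>k\<close> with \<open>\<alpha> k < m\<close>, so \<open>beta_sum s\<close> counts the
  pairs of \<open>k\<close> and \<open>m \<le> s\<close> with \<open>\<alpha> k < m\<close>. For \<open>alpha p f\<close> and \<open>alpha' p f\<close> this is the colength of the
  lattice of the integral polynomials whose values on the ring of integers, or on its maximal ideal,
  are divisible by the \<open>s\<close>-th power of a uniformizer.
\<close>

lemma beta_sum_eq:
  assumes "s \<le> \<alpha> D" shows "beta_sum s = (\<Sum>k<D. s - \<alpha> k)"
proof -
  have 1: "(LEAST j. \<alpha> j \<ge> m) = (\<Sum>k<D. if \<alpha> k < m then 1 else 0)" if "m \<in> {1..s}" for m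
  proof -
    let ?b = "LEAST j. \<alpha> j \<ge> m"
    have b: "m \<le> \<alpha> ?b" using unbounded[of m] by (rule LeastI_ex)
    have lt: "\<alpha> k < m \<longleftrightarrow> k < ?b" for k
      using not_less_Least[of k "\<lambda>j. \<alpha> j \<ge> m"] mono[of ?b k] b by (meson leD leI le_trans)
    have "?b \<le> D" using assms that by (intro Least_le) auto
    then have "{k \<in> {..<D}. \<alpha> k < m} = {..<?b}" unfolding lt by auto
    moreover have "(\<Sum>k<D. if \<alpha> k < m then 1 else 0) = card {k \<in> {..<D}. \<alpha> k < m}"
      by (simp add: sum.inter_filter[symmetric])
    ultimately show ?thesis by simp
  qed
  have 2: "(\<Sum>m=1..s. if \<alpha> k < m then 1 else 0) = s - \<alpha> k" for k
  proof -
    have "{m \<in> {1..s}. \<alpha> k < m} = {Suc (\<alpha> k)..s}" by auto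
    moreover have "(\<Sum>m=1..s. if \<alpha> k < m then 1 else 0) = card {m \<in> {1..s}. \<alpha> k < m}"
      by (simp add: sum.inter_filter[symmetric])
    ultimately show ?thesis by simp
  qed
  have "beta_sum s = (\<Sum>m=1..s. \<Sum>k<D. if \<alpha> k < m then 1 else 0)"
    unfolding beta_sum_def using 1 by (intro sum.cong) auto
  also have "\<dots> = (\<Sum>k<D. \<Sum>m=1..s. if \<alpha> k < m then 1 else 0)" by (rule sum.swap)
  finally show ?thesis unfolding 2 .
qed

text \<open>
  The determinant bound has sums over \<open>n + m\<close>, \<open>m\<close> and \<open>n\<close> indices in place of the full sums of
  \<open>beta_sum_eq\<close>. The part of the first sum from \<open>n + m\<close> on is compared termwise with the part of
  the second one from \<open>m\<close> on, by \<open>s + \<alpha> j \<le> \<alpha> (n + j)\<close>.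
\<close>

lemma beta_sum_truncation:
  assumes "s \<le> \<alpha> n"
  shows "beta_sum (s + t) + (\<Sum>j<m. t - \<alpha> j) + (\<Sum>i<n. t - \<alpha> i)
           \<le> (\<Sum>k<n + m. s + t - \<alpha> k) + 2 * beta_sum t"
proof -
  obtain D where D: "s + t \<le> \<alpha> D" using unbounded by blast
  define E where "E = D + n + m"
  have E: "s + t \<le> \<alpha> (n + E)" "t \<le> \<alpha> E"
    using D mono[of D "n + E"] mono[of D E] by (auto simp: E_def)
  have "beta_sum (s + t) = (\<Sum>k<n + E. s + t - \<alpha> k)" by (rule beta_sum_eq[OF E(1)])
  also have "\<dots> = (\<Sum>k<n + m. s + t - \<alpha> k) + (\<Sum>k=n+m..<n+E. s + t - \<alpha> k)"
    using sum.atLeastLessThan_concat[of 0 "n + m" "n + E" "\<lambda>k. s + t - \<alpha> k"]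
    by (simp add: E_def atLeast0LessThan)
  also have "(\<Sum>k=n+m..<n+E. s + t - \<alpha> k) = (\<Sum>j=m..<E. s + t - \<alpha> (n + j))"
    using sum.shift_bounds_nat_ivl[of "\<lambda>k. s + t - \<alpha> k" m n E] by (simp add: add.commute)
  also have "\<dots> \<le> (\<Sum>j=m..<E. t - \<alpha> j)"
  proof (rule sum_mono)
    fix j show "s + t - \<alpha> (n + j) \<le> t - \<alpha> j" using superadd[of n j] assms by simp
  qed
  finally have 1: "beta_sum (s + t) \<le> (\<Sum>k<n + m. s + t - \<alpha> k) + (\<Sum>j=m..<E. t - \<alpha> j)" by simp
  have "beta_sum t = (\<Sum>j<E. t - \<alpha> j)" by (rule beta_sum_eq[OF E(2)])
  also have "\<dots> = (\<Sum>j<m. t - \<alpha> j) + (\<Sum>j=m..<E. t - \<alpha> j)"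
    using sum.atLeastLessThan_concat[of 0 m E "\<lambda>k. t - \<alpha> k"]
    by (simp add: E_def atLeast0LessThan)
  finally have 2: "beta_sum t = (\<Sum>j<m. t - \<alpha> j) + (\<Sum>j=m..<E. t - \<alpha> j)" .
  have "(\<Sum>i<n. t - \<alpha> i) \<le> (\<Sum>j<E. t - \<alpha> j)" by (intro sum_mono2) (auto simp: E_def)
  then have 3: "(\<Sum>i<n. t - \<alpha> i) \<le> beta_sum t" unfolding beta_sum_eq[OF E(2)] .
  show ?thesis using 1 2 3 by linarith
qed

end

text \<open>
  As \<open>j < 2 ^ Suc l\<close> for \<open>l \<ge> j\<close>, the terms vanish from index \<open>j\<close> on.
\<close>

lemma alpha_eq_sum:
  assumes "2 \<le> p ^ f" "j \<le> L" shows "alpha p f j = (\<Sum>l<L. j div (p ^ f) ^ Suc l)"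
proof -
  have eq: "p ^ (Suc k * f) = (p ^ f) ^ Suc k" for k
    unfolding power_mult[symmetric] by (simp only: mult.commute)
  show ?thesis unfolding alpha_def eq
  proof (rule suminf_finite)
    fix l assume "l \<notin> {..<L}"
    then have "j < 2 ^ Suc l" using assms(2) less_exp[of "Suc l"] by simp
    also have "2 ^ Suc l \<le> (p ^ f) ^ Suc l" using assms(1) by (rule power_mono) simp
    finally show "j div (p ^ f) ^ Suc l = 0" by simp
  qed simp
qed

lemma div_superadditive: "a div m + b div m \<le> (a + b) div (m::nat)"
proof (cases "m = 0")
  case False
  have "(a div m + b div m) * m \<le> a + b"
    by (simp add: add_mult_distrib add_mono)
  then show ?thesis using False by (simp add: less_eq_div_iff_mult_less_eq)
qed simp

lemma superadditive_alpha: assumes "2 \<le> p ^ f" shows "superadditive (alpha p f)"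
proof
  show "alpha p f 0 = 0" using alpha_eq_sum[OF assms, of 0 0] by simp
  show "alpha p f n + alpha p f j \<le> alpha p f (n + j)" for n j
    using alpha_eq_sum[OF assms, of _ "n + j"]
    by (simp add: sum.distrib[symmetric] sum_mono div_superadditive)
  show "\<exists>j. m \<le> alpha p f j" for m
  proof (cases "m = 0")
    case False
    let ?q = "p ^ f"
    have "?q \<noteq> 0" using assms by linarith
    then have "(m * ?q) div ?q ^ Suc 0 = m"
      by (simp only: power_Suc power_0 mult_1_right nonzero_mult_div_cancel_right not_False_eq_True)
    then have "m = (\<Sum>l<1. (m * ?q) div ?q ^ Suc l)" by simp
    also have "\<dots> \<le> (\<Sum>l<m * ?q. (m * ?q) div ?q ^ Suc l)"
      using False assms by (intro sum_mono2) auto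
    also have "\<dots> = alpha p f (m * ?q)" by (rule alpha_eq_sum[OF assms order_refl, symmetric])
    finally show ?thesis by blast
  qed auto
qed

lemma alpha'_eq: "alpha' p f j = j + alpha p f j"
  by (simp add: alpha'_def alpha_def)

lemma superadditive_alpha': assumes "2 \<le> p ^ f" shows "superadditive (alpha' p f)"
proof -
  interpret superadditive "alpha p f" by (rule superadditive_alpha[OF assms])
  show ?thesis
  proof
    show "alpha' p f n + alpha' p f j \<le> alpha' p f (n + j)" for n j
      using superadd[of n j] by (simp add: alpha'_eq)
    show "\<exists>j. m \<le> alpha' p f j" for m unfolding alpha'_eq by (intro exI[of _ m]) simp
  qed (simp add: alpha'_eq zero)
qed

lemma card_residue_class_ge:
  assumes "0 < (M::nat)" shows "k div M \<le> card {i \<in> {..<k}. i mod M = i0 mod M}"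
proof -
  have "(\<lambda>j. i0 mod M + M * j) ` {..<k div M} \<subseteq> {i \<in> {..<k}. i mod M = i0 mod M}"
  proof
    fix i assume "i \<in> (\<lambda>j. i0 mod M + M * j) ` {..<k div M}"
    then obtain j where j: "j < k div M" "i = i0 mod M + M * j" by auto
    have "i < M * Suc j" using j assms by simp
    also have "\<dots> \<le> M * (k div M)" using j by (intro mult_left_mono) auto
    also have "\<dots> \<le> k" by simp
    finally show "i \<in> {i \<in> {..<k}. i mod M = i0 mod M}" using j by simp
  qed
  then have "card ((\<lambda>j. i0 mod M + M * j) ` {..<k div M}) \<le> card {i \<in> {..<k}. i mod M = i0 mod M}"
    by (intro card_mono) auto
  moreover have "card ((\<lambda>j. i0 mod M + M * j) ` {..<k div M}) = k div M"
    using assms by (subst card_image) (auto intro: inj_onI)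
  ultimately show ?thesis by simp
qed

lemma card_residue_class_eq:
  assumes "0 < (M::nat)" shows "card {i \<in> {..<k}. i mod M = k mod M} = k div M"
proof (rule antisym)
  have "{i \<in> {..<k}. i mod M = k mod M} \<subseteq> (\<lambda>j. k mod M + M * j) ` {..<k div M}"
  proof
    fix i assume i: "i \<in> {i \<in> {..<k}. i mod M = k mod M}"
    then have eq: "i = k mod M + M * (i div M)" using mult_div_mod_eq[of M i] by simp
    moreover have "k = k mod M + M * (k div M)" using mult_div_mod_eq[of M k] by simp
    moreover have "i < k" using i by simp
    ultimately have "M * (i div M) < M * (k div M)" by linarith
    then have "i div M < k div M" by simp
    then show "i \<in> (\<lambda>j. k mod M + M * j) ` {..<k div M}" using eq by blast
  qed
  then have "card {i \<in> {..<k}. i mod M = k mod M} \<le> card ((\<lambda>j. k mod M + M * j) ` {..<k div M})"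
    by (intro card_mono) auto
  also have "\<dots> \<le> card {..<k div M}" by (rule card_image_le) simp
  finally show "card {i \<in> {..<k}. i mod M = k mod M} \<le> k div M" by simp
qed (rule card_residue_class_ge[OF assms])

text \<open>
  The expansion of \<open>i\<close> in base \<open>q\<close>, with the digits replaced by their images under \<open>\<rho>\<close> and the powers
  of \<open>q\<close> by powers of \<open>\<pi>\<close>. Stopping at \<open>i = 0\<close> is consistent with the recursion if \<open>\<rho> 0 = 0\<close>.
\<close>

function digit_expansion :: "nat \<Rightarrow> (nat \<Rightarrow> 'a::comm_semiring_1) \<Rightarrow> 'a \<Rightarrow> nat \<Rightarrow> 'a" where
  "digit_expansion q \<rho> \<pi> i =
     (if i = 0 \<or> q < 2 then 0 else \<rho> (i mod q) + \<pi> * digit_expansion q \<rho> \<pi> (i div q))"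
  by auto
termination
proof (relation "Wellfounded.measure (\<lambda>(q, \<rho>, \<pi>, i). i)")
  fix q i :: nat and \<rho> :: "nat \<Rightarrow> 'a" and \<pi> :: 'a
  assume "\<not> (i = 0 \<or> q < 2)"
  then have "i div q < i" by (intro div_less_dividend) auto
  then show "((q, \<rho>, \<pi>, i div q), (q, \<rho>, \<pi>, i)) \<in> Wellfounded.measure (\<lambda>(q, \<rho>, \<pi>, i). i)"
    by simp
qed simp

declare digit_expansion.simps [simp del]

context Cp
begin

lemma digit_expansion_rec:
  assumes "2 \<le> q" "\<rho> 0 = 0"
  shows "digit_expansion q \<rho> \<pi> i = \<rho> (i mod q) + \<pi> * digit_expansion q \<rho> \<pi> (i div q)"
  using assms by (cases "i = 0") (auto simp: digit_expansion.simps[of _ _ _ i] digit_expansion.simps[of _ _ _ 0])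

lemma digit_expansion_in_ring:
  assumes K: "finite_extension_Qp K" and "2 \<le> q" "\<rho> 0 = 0" "\<rho> ` {..<q} \<subseteq> val_ring v K"
    "\<pi> \<in> val_ring v K"
  shows "digit_expansion q \<rho> \<pi> i \<in> val_ring v K"
proof (induction i rule: less_induct)
  case (less i)
  show ?case
  proof (cases "i = 0")
    case True then show ?thesis
      using finite_extensionD(7)[OF K] by (simp add: digit_expansion.simps val_ring_def)
  next
    case False
    then have "i div q < i" using assms(2) by simp
    moreover have "\<rho> (i mod q) \<in> val_ring v K" using assms(2,4) by auto
    ultimately show ?thesis using less assms(5) finite_extensionD(2,4)[OF K]
      unfolding digit_expansion_rec[of q \<rho>, OF assms(2,3), of \<pi> i]
      by (auto simp: val_ring_def intro: v_add_ge v_mult_nonneg)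
  qed
qed

text \<open>
  The lowest digit decides congruence modulo \<open>\<pi>\<close>, because \<open>\<rho>\<close> is injective modulo \<open>\<pi>\<close>; if the
  lowest digits agree, the remaining digits are compared with one power of \<open>\<pi>\<close> less.
\<close>

lemma digit_expansion_congruent_iff:
  assumes K: "finite_extension_Qp K" and q: "2 \<le> q" "\<rho> 0 = 0" "\<rho> ` {..<q} \<subseteq> val_ring v K"
    and distinct: "\<And>i j. i < q \<Longrightarrow> j < q \<Longrightarrow> 0 < v (\<rho> i - \<rho> j) \<Longrightarrow> i = j"
    and pi: "\<pi> \<in> K" "v \<pi> = ereal \<gamma>" "0 < \<gamma>"
  shows "ereal (real l * \<gamma>) \<le> v (digit_expansion q \<rho> \<pi> i - digit_expansion q \<rho> \<pi> j)
    \<longleftrightarrow> i mod q ^ l = j mod q ^ l"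
proof -
  let ?b = "digit_expansion q \<rho> \<pi>"
  have "\<pi> \<in> val_ring v K" using pi by (simp add: val_ring_def)
  note ring = digit_expansion_in_ring[OF K q this]
  have b0: "0 \<le> v (?b i - ?b j)" for i j
    using ring[of i] ring[of j] by (auto simp: val_ring_def intro: v_diff_ge)
  have diff: "?b i - ?b j = (\<rho> (i mod q) - \<rho> (j mod q)) + \<pi> * (?b (i div q) - ?b (j div q))" for i j
    using digit_expansion_rec[of q \<rho>, OF q(1,2), of \<pi>] by (metis (no_types, lifting) add_diff_add right_diff_distrib)
  have piv: "ereal (real (Suc l) * \<gamma>) \<le> v (\<pi> * x) \<longleftrightarrow> ereal (real l * \<gamma>) \<le> v x" for l x
    using pi by (cases "v x") (auto simp: v_mult algebra_simps)
  show ?thesis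
  proof (induction l arbitrary: i j)
    case 0 then show ?case using b0 by (simp add: zero_ereal_def[symmetric])
  next
    case (Suc l)
    have "i mod q ^ Suc l = j mod q ^ Suc l \<longleftrightarrow>
        i mod q = j mod q \<and> (i div q) mod q ^ l = (j div q) mod q ^ l"
    proof
      assume *: "i mod q ^ Suc l = j mod q ^ Suc l"
      have "x mod q ^ Suc l mod q = x mod q" "(x mod q ^ Suc l) div q = (x div q) mod q ^ l" for x
        using q(1) mod_mult2_eq[of x q "q ^ l"] by auto
      then show "i mod q = j mod q \<and> (i div q) mod q ^ l = (j div q) mod q ^ l"
        using * by metis
    qed (simp add: mod_mult2_eq)
    moreover have "ereal (real (Suc l) * \<gamma>) \<le> v (?b i - ?b j) \<longleftrightarrow>
        i mod q = j mod q \<and> ereal (real l * \<gamma>) \<le> v (?b (i div q) - ?b (j div q))"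
    proof (cases "i mod q = j mod q")
      case True
      then show ?thesis unfolding diff[of i j] using piv by simp
    next
      case False
      have "\<not> 0 < v (?b i - ?b j)"
      proof
        assume *: "0 < v (?b i - ?b j)"
        have "0 < v \<pi>" using pi by simp
        also have "v \<pi> \<le> v (\<pi> * (?b (i div q) - ?b (j div q)))" using b0 by (intro v_mult_ge_left) auto
        finally have "0 < v ((?b i - ?b j) - \<pi> * (?b (i div q) - ?b (j div q)))" by (rule v_diff_gt[OF *])
        then have "0 < v (\<rho> (i mod q) - \<rho> (j mod q))" unfolding diff[of i j] by simp
        then show False using distinct[of "i mod q" "j mod q"] False q(1) by simp
      qed
      moreover have "0 < ereal (real (Suc l) * \<gamma>)" using pi by simp
      ultimately show ?thesis using False less_le_trans by blast
    qed
    ultimately show ?case using Suc by simp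
  qed
qed

text \<open>
  The digits of \<open>i\<close> are found one at a time, starting with the residue class of \<open>x\<close>.
\<close>

lemma digit_expansion_approximates:
  assumes K: "finite_extension_Qp K" and q: "2 \<le> q" "\<rho> 0 = 0" "\<rho> ` {..<q} \<subseteq> val_ring v K"
    and complete: "\<And>x. x \<in> val_ring v K \<Longrightarrow> \<exists>i<q. 0 < v (x - \<rho> i)"
    and pi: "\<pi> \<in> K" "v \<pi> = ereal \<gamma>" "0 < \<gamma>" "\<And>x. x \<in> K \<Longrightarrow> 0 < v x \<Longrightarrow> ereal \<gamma> \<le> v x"
    and x: "x \<in> val_ring v K"
  shows "\<exists>i. ereal (real l * \<gamma>) \<le> v (x - digit_expansion q \<rho> \<pi> i)"
  using x
proof (induction l arbitrary: x)
  case 0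
  have "digit_expansion q \<rho> \<pi> 0 = 0" by (simp add: digit_expansion.simps)
  then show ?case using 0 by (intro exI[of _ 0]) (simp add: val_ring_def zero_ereal_def[symmetric])
next
  case (Suc l)
  note KD = finite_extensionD[OF K]
  have pi0: "\<pi> \<noteq> 0" using pi by auto
  obtain d where d: "d < q" "0 < v (x - \<rho> d)" using complete Suc.prems by blast
  have rd: "\<rho> d \<in> K" using q(3) d by (auto simp: val_ring_def)
  then have xd: "x - \<rho> d \<in> K" using Suc.prems KD by (auto simp: val_ring_def)
  have "ereal (0 + \<gamma>) \<le> v (x - \<rho> d)" using pi(4)[OF xd d(2)] by simp
  then have "ereal 0 \<le> v ((x - \<rho> d) / \<pi>)" by (rule v_divide_ge[OF pi(2)])
  then have "(x - \<rho> d) / \<pi> \<in> val_ring v K" using xd KD pi by (auto simp: val_ring_def zero_ereal_def)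
  then obtain i where i: "ereal (real l * \<gamma>) \<le> v ((x - \<rho> d) / \<pi> - digit_expansion q \<rho> \<pi> i)"
    using Suc.IH by blast
  have "(d + q * i) mod q = d" "(d + q * i) div q = i" using d(1) by auto
  then have eq: "x - digit_expansion q \<rho> \<pi> (d + q * i) = \<pi> * ((x - \<rho> d) / \<pi> - digit_expansion q \<rho> \<pi> i)"
    using pi0 digit_expansion_rec[of q \<rho>, OF q(1,2), of \<pi> "d + q * i"]
    by (simp add: right_diff_distrib[of \<pi> "(x - \<rho> d) / \<pi>"])
  have "ereal (\<gamma> + real l * \<gamma>) \<le> v (\<pi> * ((x - \<rho> d) / \<pi> - digit_expansion q \<rho> \<pi> i))"
    using i pi by (intro v_mult_ge) auto
  then have "ereal (real (Suc l) * \<gamma>) \<le> v (x - digit_expansion q \<rho> \<pi> (d + q * i))"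
    unfolding eq by (simp add: distrib_right)
  then show ?case by blast
qed

text \<open>
  In units of \<open>\<gamma>\<close>, the valuation is at least the number of the levels \<open>\<gamma>, 2 * \<gamma>, ...\<close> that it
  reaches. The count is written as a sum over the levels, in order to be exchanged with a sum over
  points.
\<close>

lemma v_ge_level_count:
  assumes "0 < \<gamma>" "0 \<le> v y"
  shows "ereal (\<gamma> * real (\<Sum>l<L. if ereal (real (Suc l) * \<gamma>) \<le> v y then 1 else 0)) \<le> v y"
proof (cases "y = 0")
  case False
  then obtain r where r: "v y = ereal r" by (rule v_real)
  then have r0: "0 \<le> r" using assms by simp
  define m where "m = nat \<lfloor>r / \<gamma>\<rfloor>"
  have m: "real m * \<gamma> \<le> r"
  proof -
    have "0 \<le> r / \<gamma>" using r0 assms by simp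
    then have "real m \<le> r / \<gamma>" unfolding m_def by linarith
    then show ?thesis using assms by (simp add: field_simps)
  qed
  have "{l \<in> {..<L}. real (Suc l) * \<gamma> \<le> r} \<subseteq> {..<m}"
  proof
    fix l assume "l \<in> {l \<in> {..<L}. real (Suc l) * \<gamma> \<le> r}"
    then have "real (Suc l) \<le> r / \<gamma>" using assms by (simp add: field_simps)
    then have "int (Suc l) \<le> \<lfloor>r / \<gamma>\<rfloor>" by (simp add: le_floor_iff)
    then show "l \<in> {..<m}" unfolding m_def by simp
  qed
  then have "card {l \<in> {..<L}. real (Suc l) * \<gamma> \<le> r} \<le> m"
    using card_mono[of "{..<m}"] by fastforce
  then have "\<gamma> * real (card {l \<in> {..<L}. real (Suc l) * \<gamma> \<le> r}) \<le> \<gamma> * real m"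
    using assms by (intro mult_left_mono) auto
  also have "\<dots> \<le> r" using m by (simp add: mult.commute)
  finally show ?thesis unfolding r by (simp add: sum.inter_filter[symmetric])
qed simp

lemma v_eq_level_count:
  assumes "0 < \<gamma>" "v y = ereal (\<gamma> * real j)" "j \<le> L"
  shows "v y = ereal (\<gamma> * real (\<Sum>l<L. if ereal (real (Suc l) * \<gamma>) \<le> v y then 1 else 0))"
proof -
  have "real (Suc l) * \<gamma> \<le> \<gamma> * real j \<longleftrightarrow> Suc l \<le> j" for l
    using assms(1) by (subst mult.commute) (simp only: mult_le_cancel_left_pos of_nat_le_iff)
  then have "ereal (real (Suc l) * \<gamma>) \<le> v y \<longleftrightarrow> l < j" for l
    unfolding assms(2) ereal_less_eq Suc_le_eq .
  then have "(\<Sum>l<L. if ereal (real (Suc l) * \<gamma>) \<le> v y then 1 else 0) = (\<Sum>l<L. if l < j then 1 else 0 :: nat)"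
    by (simp only:)
  also have "\<dots> = card {l \<in> {..<L}. l < j}" by (simp add: sum.inter_filter[symmetric])
  also have "{l \<in> {..<L}. l < j} = {..<j}" using assms(3) by auto
  finally have "(\<Sum>l<L. if ereal (real (Suc l) * \<gamma>) \<le> v y then 1 else 0) = j" by simp
  then show ?thesis using assms(2) by (simp only:)
qed

end

section \<open>Test sequences for the ring of integers and for its maximal ideal\<close>

context Cp
begin

text \<open>
  On \<open>A\<close>, the Newton polynomials with nodes in such a sequence have their least valuation at the next
  node. This is Bhargava's ordering of the set \<open>A\<close>, and \<open>\<alpha> k\<close> is the valuation of its \<open>k\<close>-th
  factorial.
\<close>

definition test_sequence :: "real \<Rightarrow> 'a set \<Rightarrow> (nat \<Rightarrow> nat) \<Rightarrow> (nat \<Rightarrow> 'a) \<Rightarrow> bool" where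
  "test_sequence \<gamma> A \<alpha> a \<longleftrightarrow> (\<forall>k. a k \<in> A) \<and>
     (\<forall>k. \<forall>x\<in>A. ereal (\<gamma> * real (\<alpha> k)) \<le> v (\<Prod>i<k. x - a i)) \<and>
     (\<forall>k. v (\<Prod>i<k. a k - a i) = ereal (\<gamma> * real (\<alpha> k)))"

lemma residue_enumeration:
  assumes K: "finite_extension_Qp K" and f: "f = residue_degree v K"
  obtains \<rho> where "\<rho> 0 = 0" "\<rho> ` {..<p ^ f} \<subseteq> val_ring v K"
    "\<And>x. x \<in> val_ring v K \<Longrightarrow> \<exists>i<p ^ f. 0 < v (x - \<rho> i)"
    "\<And>i j. i < p ^ f \<Longrightarrow> j < p ^ f \<Longrightarrow> 0 < v (\<rho> i - \<rho> j) \<Longrightarrow> i = j"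
proof -
  obtain R where R: "finite R" "card R = p ^ f" "0 \<in> R" "R \<subseteq> val_ring v K"
    "\<And>x. x \<in> val_ring v K \<Longrightarrow> \<exists>r\<in>R. 0 < v (x - r)"
    "\<And>r s. r \<in> R \<Longrightarrow> s \<in> R \<Longrightarrow> 0 < v (r - s) \<Longrightarrow> r = s"
    by (rule residue_system[OF K f]) blast
  \<comment> \<open>The enumeration has to start with the representative \<open>0\<close>.\<close>
  have "card {1..<p ^ f} = card (R - {0})" using R by simp
  then obtain h where h: "bij_betw h {1..<p ^ f} (R - {0})"
    using finite_same_card_bij[of "{1..<p ^ f}" "R - {0}"] R(1) by auto
  define \<rho> where "\<rho> i = (if i = 0 then 0 else h i)" for i
  have img: "\<rho> ` {..<p ^ f} = R"
  proof -
    have "{..<p ^ f} = insert 0 {1..<p ^ f}" using p_gt_1 by auto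
    then have "\<rho> ` {..<p ^ f} = insert 0 (h ` {1..<p ^ f})" by (auto simp: \<rho>_def)
    then show ?thesis using h R(3) by (auto simp: bij_betw_def)
  qed
  then have inj: "inj_on \<rho> {..<p ^ f}" using R(2) by (intro eq_card_imp_inj_on) auto
  show ?thesis
  proof (rule that[of \<rho>])
    show "\<rho> 0 = 0" by (simp add: \<rho>_def)
    show "\<rho> ` {..<p ^ f} \<subseteq> val_ring v K" using img R(4) by simp
    show "\<exists>i<p ^ f. 0 < v (x - \<rho> i)" if "x \<in> val_ring v K" for x
      using R(5)[OF that] unfolding img[symmetric] by auto
    show "i = j" if "i < p ^ f" "j < p ^ f" "0 < v (\<rho> i - \<rho> j)" for i j
    proof -
      have "\<rho> i = \<rho> j" using R(6)[of "\<rho> i" "\<rho> j"] that img by blast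
      then show ?thesis using inj that by (auto dest: inj_onD)
    qed
  qed
qed

text \<open>
  \<open>0\<close> and \<open>1\<close> are in distinct residue classes.
\<close>

lemma residue_field_card_ge:
  assumes K: "finite_extension_Qp K" and f: "f = residue_degree v K"
  shows "2 \<le> p ^ f"
proof (rule ccontr)
  assume "\<not> 2 \<le> p ^ f"
  then have small: "i = 0" if "i < p ^ f" for i using that by linarith
  obtain \<rho> where rho: "\<rho> 0 = 0" "\<And>x. x \<in> val_ring v K \<Longrightarrow> \<exists>i<p ^ f. 0 < v (x - \<rho> i)"
    by (rule residue_enumeration[OF K f]) blast
  have "1 \<in> val_ring v K" using finite_extensionD[OF K] by (simp add: val_ring_def)
  then obtain i where "i < p ^ f" "0 < v (1 - \<rho> i)" using rho(2) by blast
  then show False using small[of i] rho(1) by simp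
qed

text \<open>
  The nodes are \<open>x0\<close> plus digit expansions in base \<open>q = p ^ f\<close>. Counting by levels as in Legendre's
  formula for factorials, it suffices to know how many of the first \<open>k\<close> nodes are congruent to \<open>x\<close>
  modulo a power of the uniformizer with exponent \<open>l\<close>: every residue class has a node in each block
  of \<open>q ^ l\<close> consecutive indices, so there are at least \<open>k div q ^ l\<close>; and if \<open>x\<close> is the node with
  index \<open>k\<close>, there are exactly that many.
\<close>

lemma test_sequence_ring:
  assumes K: "finite_extension_Qp K" and e: "e = ramification_index p v K"
    and f: "f = residue_degree v K" and x0: "x0 \<in> val_ring v K"
  obtains a where "a 0 = x0" "test_sequence (1 / real e) (val_ring v K) (alpha p f) a"
proof -
  note KD = finite_extensionD[OF K]
  obtain \<pi> where e0: "e > 0" and pi: "\<pi> \<in> K" "v \<pi> = ereal (1 / real e)"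
    and discrete: "\<And>x. x \<in> K \<Longrightarrow> x \<noteq> 0 \<Longrightarrow> \<exists>k::int. v x = ereal (of_int k / real e)"
    by (rule ramification_index_value_group[OF K e]) blast
  obtain \<rho> where rho: "\<rho> 0 = 0" "\<rho> ` {..<p ^ f} \<subseteq> val_ring v K"
    and complete: "\<And>x. x \<in> val_ring v K \<Longrightarrow> \<exists>i<p ^ f. 0 < v (x - \<rho> i)"
    and distinct: "\<And>i j. i < p ^ f \<Longrightarrow> j < p ^ f \<Longrightarrow> 0 < v (\<rho> i - \<rho> j) \<Longrightarrow> i = j"
    by (rule residue_enumeration[OF K f]) blast
  define \<gamma> where "\<gamma> = 1 / real e"
  have g0: "0 < \<gamma>" using e0 by (simp add: \<gamma>_def)
  note pi' = pi(1) pi(2)[folded \<gamma>_def] g0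
  define q where "q = p ^ f"
  have q2: "2 \<le> q" unfolding q_def by (rule residue_field_card_ge[OF K f])
  define b where "b = digit_expansion q \<rho> \<pi>"
  note rho' = rho(1) rho(2)[folded q_def]
  have b0: "b 0 = 0" by (simp add: b_def digit_expansion.simps)
  have "\<pi> \<in> val_ring v K" using pi' by (simp add: val_ring_def)
  note bring = digit_expansion_in_ring[OF K q2 rho' this, folded b_def]
  note congr = digit_expansion_congruent_iff[OF K q2 rho' distinct[folded q_def] pi', folded b_def]
  have pos: "ereal \<gamma> \<le> v x" if x: "x \<in> K" "0 < v x" for x
  proof (cases "x = 0")
    case False
    then obtain k :: int where k: "v x = ereal (of_int k / real e)" using discrete x(1) by blast
    then have "0 < of_int k / real e" using x(2) by simp
    then have "1 \<le> k" using e0 by (simp add: zero_less_divide_iff)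
    then have "\<gamma> \<le> of_int k / real e" unfolding \<gamma>_def using e0 by (intro divide_right_mono) auto
    then show ?thesis using k by simp
  qed simp
  note approx = digit_expansion_approximates[OF K q2 rho' complete[folded q_def] pi' pos, folded b_def]
  define a where "a i = x0 + b i" for i
  have aring: "a i \<in> val_ring v K" for i
    using bring[of i] x0 KD unfolding a_def by (auto simp: val_ring_def intro: v_add_ge)
  have adiff: "a i - a j = b i - b j" for i j by (simp add: a_def)
  have alpha: "alpha p f k = (\<Sum>l<k. k div q ^ Suc l)" for k
    unfolding q_def using q2 by (intro alpha_eq_sum) (auto simp: q_def)
  have swap: "(\<Sum>i<k. \<Sum>l<k. if ereal (real (Suc l) * \<gamma>) \<le> v (x - a i) then 1 else 0)
      = (\<Sum>l<k. card {i \<in> {..<k}. ereal (real (Suc l) * \<gamma>) \<le> v (x - a i)})" for x k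
  proof -
    have "(\<Sum>i<k. if ereal (real (Suc l) * \<gamma>) \<le> v (x - a i) then 1 else 0)
      = card {i \<in> {..<k}. ereal (real (Suc l) * \<gamma>) \<le> v (x - a i)}" for l
      using sum.inter_filter[of "{..<k}" "\<lambda>_. 1::nat" "\<lambda>i. ereal (real (Suc l) * \<gamma>) \<le> v (x - a i)"] by simp
    then show ?thesis by (subst sum.swap) (simp only:)
  qed
  have lower: "ereal (\<gamma> * real (alpha p f k)) \<le> v (\<Prod>i<k. x - a i)" if x: "x \<in> val_ring v K" for x k
  proof -
    have nonneg: "0 \<le> v (x - a i)" for i
      using x aring[of i] by (auto simp: val_ring_def intro: v_diff_ge)
    have count: "k div q ^ Suc l \<le> card {i \<in> {..<k}. ereal (real (Suc l) * \<gamma>) \<le> v (x - a i)}" for l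
    proof -
      have "x - x0 \<in> val_ring v K" using x x0 KD by (auto simp: val_ring_def intro: v_diff_ge)
      \<comment> \<open>The class of \<open>x - x0\<close> modulo this power of \<open>\<pi>\<close> is the class of a digit expansion.\<close>
      then obtain i0 where i0: "ereal (real (Suc l) * \<gamma>) \<le> v (x - x0 - b i0)"
        using approx by blast
      have "k div q ^ Suc l \<le> card {i \<in> {..<k}. i mod q ^ Suc l = i0 mod q ^ Suc l}"
        using q2 by (intro card_residue_class_ge) simp
      also have "\<dots> \<le> card {i \<in> {..<k}. ereal (real (Suc l) * \<gamma>) \<le> v (x - a i)}"
      proof (rule card_mono)
        show "{i \<in> {..<k}. i mod q ^ Suc l = i0 mod q ^ Suc l}
           \<subseteq> {i \<in> {..<k}. ereal (real (Suc l) * \<gamma>) \<le> v (x - a i)}"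
        proof
          fix i assume i: "i \<in> {i \<in> {..<k}. i mod q ^ Suc l = i0 mod q ^ Suc l}"
          then have "ereal (real (Suc l) * \<gamma>) \<le> v (b i0 - b i)"
            using congr[of "Suc l" i0 i] by simp
          with i0 have "ereal (real (Suc l) * \<gamma>) \<le> v ((x - x0 - b i0) + (b i0 - b i))"
            by (rule v_add_ge)
          also have "(x - x0 - b i0) + (b i0 - b i) = x - a i" by (simp add: a_def)
          finally show "i \<in> {i \<in> {..<k}. ereal (real (Suc l) * \<gamma>) \<le> v (x - a i)}"
            using i by simp
        qed
      qed simp
      finally show ?thesis .
    qed
    have "alpha p f k \<le> (\<Sum>l<k. card {i \<in> {..<k}. ereal (real (Suc l) * \<gamma>) \<le> v (x - a i)})"
      unfolding alpha by (intro sum_mono count)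
    then have "ereal (\<gamma> * real (alpha p f k)) \<le> ereal (\<gamma> * real (\<Sum>l<k. card {i \<in> {..<k}. ereal (real (Suc l) * \<gamma>) \<le> v (x - a i)}))"
      using g0 by (simp only: ereal_less_eq mult_le_cancel_left_pos of_nat_le_iff)
    also have "\<dots> = (\<Sum>i<k. ereal (\<gamma> * real (\<Sum>l<k. if ereal (real (Suc l) * \<gamma>) \<le> v (x - a i) then 1 else 0)))"
      unfolding swap[symmetric] by (simp add: sum_distrib_left)
    also have "\<dots> \<le> (\<Sum>i<k. v (x - a i))" by (intro sum_mono v_ge_level_count g0 nonneg)
    finally show ?thesis by (simp add: v_prod)
  qed
  have eq: "v (\<Prod>i<k. a k - a i) = ereal (\<gamma> * real (alpha p f k))" for k
  proof -
    have cong_k: "ereal (real (Suc l) * \<gamma>) \<le> v (a k - a i) \<longleftrightarrow> i mod q ^ Suc l = k mod q ^ Suc l" for i l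
      unfolding adiff using congr[of "Suc l" k i] eq_commute[of "i mod q ^ Suc l"] by (simp only:)
    have "v (a k - a i) = ereal (\<gamma> * real (\<Sum>l<k. if ereal (real (Suc l) * \<gamma>) \<le> v (a k - a i) then 1 else 0))"
      if i: "i < k" for i
    proof -
      have "k < 2 ^ Suc k" using less_exp[of "Suc k"] by simp
      also have "2 ^ Suc k \<le> q ^ Suc k" using q2 by (rule power_mono) simp
      \<comment> \<open>Distinct indices up to \<open>k\<close> are incongruent modulo \<open>q ^ Suc k\<close>, so \<open>k\<close> levels suffice for the
        count.\<close>
      finally have far: "\<not> ereal (real (Suc k) * \<gamma>) \<le> v (a k - a i)"
        unfolding cong_k using i by simp
      then have "a k - a i \<noteq> 0" by auto
      moreover have "a k - a i \<in> K" using aring KD by (auto simp: val_ring_def)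
      ultimately obtain j :: int where j: "v (a k - a i) = ereal (of_int j / real e)"
        using discrete by blast
      have "0 \<le> v (a k - a i)" using aring[of k] aring[of i] by (auto simp: val_ring_def intro: v_diff_ge)
      then have "0 \<le> of_int j / real e" using j by simp
      then have j0: "0 \<le> j" using e0 by (simp add: zero_le_divide_iff)
      have "\<gamma> * of_int j < real (Suc k) * \<gamma>" using far j by (simp add: \<gamma>_def)
      then have "of_int j < real (Suc k)" using g0 by (simp only: mult.commute[of _ \<gamma>] mult_less_cancel_left_pos)
      then have "nat j \<le> k" by linarith
      moreover have "v (a k - a i) = ereal (\<gamma> * real (nat j))" using j j0 by (simp add: \<gamma>_def)
      ultimately show ?thesis by (rule v_eq_level_count[OF g0, rotated])
    qed
    then have "(\<Sum>i<k. v (a k - a i))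
        = (\<Sum>i<k. ereal (\<gamma> * real (\<Sum>l<k. if ereal (real (Suc l) * \<gamma>) \<le> v (a k - a i) then 1 else 0)))"
      by (intro sum.cong) auto
    also have "\<dots> = ereal (\<gamma> * real (\<Sum>l<k. card {i \<in> {..<k}. ereal (real (Suc l) * \<gamma>) \<le> v (a k - a i)}))"
      unfolding swap[symmetric] by (simp add: sum_distrib_left)
    also have "(\<Sum>l<k. card {i \<in> {..<k}. ereal (real (Suc l) * \<gamma>) \<le> v (a k - a i)}) = alpha p f k"
      unfolding alpha cong_k using q2 by (intro sum.cong refl card_residue_class_eq) simp
    finally show ?thesis by (simp add: v_prod)
  qed
  show ?thesis
    by (rule that[of a]) (use aring lower eq b0 in \<open>auto simp: test_sequence_def a_def \<gamma>_def\<close>)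
qed

text \<open>
  The substitution of \<open>x0 + \<pi> * y\<close> for \<open>x\<close> reduces this to the ring of integers. Every factor gains
  the valuation of \<open>\<pi>\<close>, which accounts for the summand \<open>k\<close> of \<open>alpha' p f k\<close>.
\<close>

lemma test_sequence_ideal:
  assumes K: "finite_extension_Qp K" and e: "e = ramification_index p v K"
    and f: "f = residue_degree v K" and x0: "x0 \<in> val_ideal v K"
  obtains a where "a 0 = x0" "test_sequence (1 / real e) (val_ideal v K) (alpha' p f) a"
proof -
  note KD = finite_extensionD[OF K]
  obtain \<pi> where e0: "e > 0" and pi: "\<pi> \<in> K" "v \<pi> = ereal (1 / real e)"
    and discrete: "\<And>x. x \<in> K \<Longrightarrow> x \<noteq> 0 \<Longrightarrow> \<exists>k::int. v x = ereal (of_int k / real e)"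
    by (rule ramification_index_value_group[OF K e]) blast
  have pi0: "\<pi> \<noteq> 0" using pi by auto
  have "0 \<in> val_ring v K" using KD by (simp add: val_ring_def)
  then obtain b where b: "b 0 = 0" "test_sequence (1 / real e) (val_ring v K) (alpha p f) b"
    by (rule test_sequence_ring[OF K e f])
  define a where "a i = x0 + \<pi> * b i" for i
  have bring: "b i \<in> val_ring v K" for i using b(2) by (simp add: test_sequence_def)
  have v_pi_mult: "0 < v (\<pi> * y)" if "0 \<le> v y" for y
  proof -
    have "0 < v \<pi>" using pi e0 by simp
    also have "v \<pi> \<le> v (\<pi> * y)" using that by (intro v_mult_ge_left) auto
    finally show ?thesis .
  qed
  have aideal: "a i \<in> val_ideal v K" for i
    using bring[of i] x0 KD pi v_pi_mult unfolding a_def by (auto simp: val_ideal_def val_ring_def intro: v_add_gt)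
  have prod: "v (\<Prod>i<k. \<pi> * (y - b i)) = ereal (real k / real e) + v (\<Prod>i<k. y - b i)" for y k
    using pi by (simp add: prod.distrib v_mult v_power)
  have split: "ereal (1 / real e * real (alpha' p f k)) = ereal (real k / real e) + ereal (1 / real e * real (alpha p f k))" for k
    by (simp add: alpha'_eq add_divide_distrib)
  have lower: "ereal (1 / real e * real (alpha' p f k)) \<le> v (\<Prod>i<k. x - a i)" if x: "x \<in> val_ideal v K" for x k
  proof -
    define y where "y = (x - x0) / \<pi>"
    have "0 < v (x - x0)" "x - x0 \<in> K" using x x0 KD by (auto simp: val_ideal_def intro: v_diff_gt)
    have "ereal (0 + 1 / real e) \<le> v (x - x0)"
    proof (cases "x - x0 = 0")
      case False
      then obtain j :: int where j: "v (x - x0) = ereal (of_int j / real e)" using discrete \<open>x - x0 \<in> K\<close> by blast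
      then have "0 < of_int j / real e" using \<open>0 < v (x - x0)\<close> by simp
      then have "1 \<le> j" using e0 by (simp add: zero_less_divide_iff)
      then have "1 / real e \<le> of_int j / real e" using e0 by (intro divide_right_mono) auto
      then show ?thesis using j by simp
    qed simp
    then have "ereal 0 \<le> v y" unfolding y_def by (rule v_divide_ge[OF pi(2)])
    then have y: "y \<in> val_ring v K" using \<open>x - x0 \<in> K\<close> KD pi by (simp add: y_def val_ring_def zero_ereal_def)
    have "x - a i = \<pi> * (y - b i)" for i using pi0 by (simp add: y_def a_def field_simps)
    then have P: "v (\<Prod>i<k. x - a i) = ereal (real k / real e) + v (\<Prod>i<k. y - b i)"
      using prod[of y k] by (simp only:)
    have "ereal (1 / real e * real (alpha p f k)) \<le> v (\<Prod>i<k. y - b i)"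
      using b(2) y unfolding test_sequence_def by blast
    then show ?thesis unfolding split P by (rule add_left_mono)
  qed
  have eq: "v (\<Prod>i<k. a k - a i) = ereal (1 / real e * real (alpha' p f k))" for k
  proof -
    have "a k - a i = \<pi> * (b k - b i)" for i by (simp add: a_def algebra_simps)
    moreover have "v (\<Prod>i<k. b k - b i) = ereal (1 / real e * real (alpha p f k))"
      using b(2) unfolding test_sequence_def by blast
    ultimately show ?thesis unfolding split using prod[of "b k" k] by simp
  qed
  show ?thesis
    by (rule that[of a]) (use aideal lower eq b in \<open>auto simp: test_sequence_def a_def\<close>)
qed

end

section \<open>The determinant bound for monic polynomials\<close>

lemma det_triangular_product:
  fixes R D T :: "nat \<Rightarrow> nat \<Rightarrow> 'a::idom"
  assumes R: "\<And>i j. i < j \<Longrightarrow> R i j = 0" "\<And>i. R i i = 1"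
    and D: "\<And>i j. j < i \<Longrightarrow> D i j = 0"
    and T: "\<And>i j. i < j \<Longrightarrow> T i j = 0" "\<And>i. T i i = 1"
  shows "det (mat N N (\<lambda>(r, k). \<Sum>i<N. \<Sum>j<N. R r i * D i j * T j k)) = (\<Prod>i<N. D i i)"
proof -
  let ?R = "mat N N (\<lambda>(i, j). R i j)" and ?D = "mat N N (\<lambda>(i, j). D i j)" and ?T = "mat N N (\<lambda>(i, j). T i j)"
  have eq: "mat N N (\<lambda>(r, k). \<Sum>i<N. \<Sum>j<N. R r i * D i j * T j k) = ?R * (?D * ?T)"
    by (rule eq_matI) (auto simp: scalar_prod_def atLeast0LessThan sum_distrib_left mult.assoc intro!: sum.cong)
  have "det ?R = prod_list (diag_mat ?R)" by (rule det_lower_triangular[of N]) (auto simp: R)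
  then have 1: "det ?R = 1" by (simp add: prod_list_diag_prod R)
  have "det ?T = prod_list (diag_mat ?T)" by (rule det_lower_triangular[of N]) (auto simp: T)
  then have 2: "det ?T = 1" by (simp add: prod_list_diag_prod T)
  have "det ?D = prod_list (diag_mat ?D)" by (rule det_upper_triangular[of _ N]) (auto simp: D)
  then have 3: "det ?D = (\<Prod>i<N. D i i)" by (simp add: prod_list_diag_prod atLeast0LessThan)
  have "det (?R * (?D * ?T)) = det ?R * (det ?D * det ?T)"
    using det_mult[of ?R N "?D * ?T"] det_mult[of ?D N ?T] by (simp add: mult_carrier_mat[of _ N N])
  then show ?thesis unfolding eq using 1 2 3 by simp
qed

definition newton_poly :: "(nat \<Rightarrow> 'a::comm_ring_1) \<Rightarrow> nat \<Rightarrow> 'a poly" where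
  "newton_poly y k = (\<Prod>i<k. [:- y i, 1:])"

lemma poly_newton: "poly (newton_poly y k) x = (\<Prod>i<k. x - y i)"
  by (simp add: newton_poly_def poly_prod)

lemma newton_poly_Suc: "newton_poly y (Suc k) = newton_poly y k * [:- y k, 1:]"
  by (simp add: newton_poly_def del: mult_pCons_right)

lemma newton_poly_add: "newton_poly y (k + l) = newton_poly y k * newton_poly (\<lambda>i. y (k + i)) l"
  by (induction l) (simp_all add: newton_poly_Suc mult.assoc del: mult_pCons_right, simp add: newton_poly_def)

lemma newton_poly_monic:
  fixes y :: "nat \<Rightarrow> 'a::idom"
  shows "degree (newton_poly y k) = k \<and> lead_coeff (newton_poly y k) = 1"
proof (induction k)
  case (Suc k)
  then have "newton_poly y k \<noteq> 0" by auto
  then show ?case using Suc unfolding newton_poly_Suc by (subst degree_mult_eq) (auto simp: lead_coeff_mult simp del: mult_pCons_right)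
qed (simp add: newton_poly_def)

context Cp
begin

lemma newton_poly_integral:
  assumes "\<And>i. 0 \<le> v (y i)" shows "0 \<le> v (coeff (newton_poly y k) i)"
proof (induction k arbitrary: i)
  case 0 then show ?case by (simp add: newton_poly_def coeff_1)
next
  case (Suc k)
  have "0 \<le> v (coeff [:- y k, 1:] i)" for i using assms by (auto simp: coeff_pCons split: nat.splits)
  then show ?case unfolding newton_poly_Suc using Suc by (intro coeff_mult_ge)
qed

text \<open>
  The expansion in the Newton basis with nodes \<open>y\<close>, by repeated removal of the leading term. The
  last coefficient is the leading one, and nothing is divided.
\<close>

lemma newton_expansion:
  assumes "\<And>i. i \<ge> d \<Longrightarrow> coeff h i = 0"
  shows "\<exists>c. h = (\<Sum>k<d. Polynomial.smult (c k) (newton_poly y k)) \<and> (\<forall>k\<ge>d. c k = 0) \<and>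
    (d > 0 \<longrightarrow> c (d - 1) = coeff h (d - 1)) \<and>
    ((\<forall>i. 0 \<le> v (coeff h i)) \<longrightarrow> (\<forall>i. 0 \<le> v (y i)) \<longrightarrow> (\<forall>k. 0 \<le> v (c k)))"
  using assms
proof (induction d arbitrary: h)
  case 0
  then have "h = 0" by (intro poly_eqI) simp
  then show ?case by (intro exI[of _ "\<lambda>_. 0"]) simp
next
  case (Suc d)
  define h' where "h' = h - Polynomial.smult (coeff h d) (newton_poly y d)"
  have nm: "degree (newton_poly y d) = d" "coeff (newton_poly y d) d = 1" using newton_poly_monic[of y d] by auto
  have "coeff h' i = 0" if "i \<ge> d" for i
  proof (cases "i = d")
    case False
    then have "coeff (newton_poly y d) i = 0" using that nm by (intro coeff_eq_0) simp
    then show ?thesis using Suc.prems[of i] that False by (simp add: h'_def)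
  qed (simp add: h'_def nm)
  then have "\<exists>c. h' = (\<Sum>k<d. Polynomial.smult (c k) (newton_poly y k)) \<and> (\<forall>k\<ge>d. c k = 0) \<and>
    (d > 0 \<longrightarrow> c (d - 1) = coeff h' (d - 1)) \<and>
    ((\<forall>i. 0 \<le> v (coeff h' i)) \<longrightarrow> (\<forall>i. 0 \<le> v (y i)) \<longrightarrow> (\<forall>k. 0 \<le> v (c k)))"
    by (rule Suc.IH)
  then obtain c where c: "h' = (\<Sum>k<d. Polynomial.smult (c k) (newton_poly y k))" "\<forall>k\<ge>d. c k = 0"
     "(\<forall>i. 0 \<le> v (coeff h' i)) \<longrightarrow> (\<forall>i. 0 \<le> v (y i)) \<longrightarrow> (\<forall>k. 0 \<le> v (c k))"
    by (elim exE conjE)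
  let ?c = "c(d := coeff h d)"
  have "h = (\<Sum>k<Suc d. Polynomial.smult (?c k) (newton_poly y k))"
  proof -
    have "(\<Sum>k<d. Polynomial.smult (?c k) (newton_poly y k)) = h'" unfolding c(1) by (intro sum.cong) auto
    then show ?thesis by (simp add: h'_def)
  qed
  moreover have "\<forall>k. 0 \<le> v (?c k)" if "\<forall>i. 0 \<le> v (coeff h i)" "\<forall>i. 0 \<le> v (y i)"
  proof -
    have "0 \<le> v (coeff h' i)" for i
      unfolding h'_def coeff_diff coeff_smult using that newton_poly_integral by (intro v_diff_ge v_mult_nonneg) auto
    then show ?thesis using c(3) that by simp
  qed
  ultimately show ?case using c(2) by (intro exI[of _ ?c]) auto
qed

lemma v_signof: "v (signof (\<sigma> :: nat \<Rightarrow> nat)) = 0"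
  by (simp add: sign_def)

text \<open>
  Every term of the Leibniz expansion takes one entry from each row and each column.
\<close>

lemma v_det_ge:
  fixes cl rw :: "nat \<Rightarrow> real"
  assumes "\<And>r k. r < N \<Longrightarrow> k < N \<Longrightarrow> ereal (cl k - rw r) \<le> v (c r k)"
  shows "ereal ((\<Sum>k<N. cl k) - (\<Sum>r<N. rw r)) \<le> v (det (mat N N (\<lambda>(r, k). c r k)))"
proof -
  let ?C = "mat N N (\<lambda>(r, k). c r k)"
  have "det ?C = (\<Sum>\<sigma> | \<sigma> permutes {0..<N}. signof \<sigma> * (\<Prod>i = 0..<N. ?C $$ (i, \<sigma> i)))"
    by (rule det_def') simp
  moreover have "ereal ((\<Sum>k<N. cl k) - (\<Sum>r<N. rw r)) \<le> v (signof \<sigma> * (\<Prod>i = 0..<N. ?C $$ (i, \<sigma> i)))"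
    if "\<sigma> \<in> {\<sigma>. \<sigma> permutes {0..<N}}" for \<sigma>
  proof -
    have p: "\<sigma> permutes {0..<N}" using that by simp
    then have lt: "\<sigma> i < N" if "i < N" for i using that permutes_in_image[OF p, of i] by simp
    have "(\<Sum>k<N. cl k) - (\<Sum>r<N. rw r) = (\<Sum>i=0..<N. cl (\<sigma> i) - rw i)"
      using sum.permute[OF p, of cl] by (simp add: sum_subtractf atLeast0LessThan o_def)
    then have "ereal ((\<Sum>k<N. cl k) - (\<Sum>r<N. rw r)) = (\<Sum>i=0..<N. ereal (cl (\<sigma> i) - rw i))" by simp
    also have "\<dots> \<le> (\<Sum>i=0..<N. v (?C $$ (i, \<sigma> i)))"
      using assms lt by (intro sum_mono) simp
    also have "\<dots> = v (signof \<sigma> * (\<Prod>i = 0..<N. ?C $$ (i, \<sigma> i)))"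
      by (simp add: v_mult v_signof v_prod)
    finally show ?thesis .
  qed
  ultimately show ?thesis by (simp only: v_sum_ge)
qed

text \<open>
  Newton interpolation: at the node \<open>a k\<close> the terms after the \<open>k\<close>-th vanish, and those before it are
  bounded by induction, so the bound for the value \<open>h (a k)\<close> passes to the \<open>k\<close>-th term.
\<close>

lemma newton_coefficient_ge:
  assumes a: "test_sequence \<gamma> A \<alpha> a"
    and h: "\<And>x. x \<in> A \<Longrightarrow> h x = (\<Sum>k<N. c k * (\<Prod>i<k. x - a i))"
    and \<sigma>: "\<And>x. x \<in> A \<Longrightarrow> ereal \<sigma> \<le> v (h x)" and "k < N"
  shows "ereal (\<sigma> - \<gamma> * real (\<alpha> k)) \<le> v (c k)"
  using \<open>k < N\<close>
proof (induction k rule: less_induct)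
  case (less k)
  have aA: "a k \<in> A" for k using a by (simp add: test_sequence_def)
  let ?P = "\<lambda>j. \<Prod>i<j. a k - a i"
  have zero: "?P j = 0" if "j > k" for j using that by (intro prod_zero) auto
  have "h (a k) = (\<Sum>j<Suc k. c j * ?P j)"
    unfolding h[OF aA] using less.prems zero by (intro sum.mono_neutral_right) auto
  then have eq: "c k * ?P k = h (a k) - (\<Sum>j<k. c j * ?P j)" by simp
  have "ereal \<sigma> \<le> v (c j * ?P j)" if "j < k" for j
  proof -
    have "ereal (\<sigma> - \<gamma> * real (\<alpha> j)) \<le> v (c j)" using less that by simp
    moreover have "ereal (\<gamma> * real (\<alpha> j)) \<le> v (?P j)" using a aA unfolding test_sequence_def by blast
    ultimately show ?thesis using v_mult_ge by fastforce
  qed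
  then have "ereal \<sigma> \<le> v (c k * ?P k)" unfolding eq using \<sigma>[OF aA] by (intro v_diff_ge v_sum_ge) auto
  moreover have "v (?P k) = ereal (\<gamma> * real (\<alpha> k))" using a unfolding test_sequence_def by blast
  ultimately show ?case by (cases "v (c k)") (auto simp: v_mult)
qed


text \<open>
  The product of the \<open>poly g (z i)\<close> is the resultant of \<open>f\<close>, the polynomial with roots \<open>z i\<close>, and
  \<open>g\<close>. It is the determinant of the matrix of coordinates of the polynomials \<open>?P i * g\<close> for \<open>i < n\<close>
  and \<open>?P j * f\<close> for \<open>j < m\<close> with respect to \<open>?P 0, ..., ?P (n + m - 1)\<close>, where \<open>?P\<close> is the Newton
  basis with nodes \<open>a\<close>. The lower bound for the entries comes from the values of these polynomials
  on \<open>A\<close>, the evaluation of the determinant from a second Newton basis with nodes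
  \<open>z 0, ..., z (n - 1), a 0, a 1, ...\<close>.
\<close>

lemma resultant_lower_bound:
  fixes g :: "'a poly" and z :: "nat \<Rightarrow> 'a" and s S t n m :: nat
  assumes sup: "superadditive \<alpha>" and g0: "0 < \<gamma>" and a: "test_sequence \<gamma> A \<alpha> a"
    and A: "\<And>x. x \<in> A \<Longrightarrow> 0 \<le> v x" and z: "\<And>i. 0 \<le> v (z i)"
    and g: "lead_coeff g = 1" "degree g = m" "\<And>i. 0 \<le> v (coeff g i)"
    and s: "\<And>x. x \<in> A \<Longrightarrow> ereal (\<gamma> * real s) \<le> v (poly (newton_poly z n) x)"
      "\<And>x. x \<in> A \<Longrightarrow> ereal (\<gamma> * real s) \<le> v (poly g x)"
    and S: "ereal (\<gamma> * real S) \<le> v (poly (newton_poly z n) (a 0))"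
      "ereal (\<gamma> * real S) \<le> v (poly g (a 0))"
  shows "ereal (\<gamma> * (real S - real s + real (superadditive.beta_sum \<alpha> (s + t))
            - 2 * real (superadditive.beta_sum \<alpha> t))) \<le> v (\<Prod>i<n. poly g (z i))"
proof -
  interpret superadditive \<alpha> by (rule sup)
  define N where "N = n + m"
  define f where "f = newton_poly z n"
  let ?P = "newton_poly a"
  have aA: "a k \<in> A" for k using a by (simp add: test_sequence_def)
  then have a0: "0 \<le> v (a k)" for k using A by blast
  \<comment> \<open>The second Newton basis starts with the partial products of \<open>f\<close> and continues with the
    polynomials \<open>f * ?P j\<close>.\<close>
  define y where "y i = (if i < n then z i else a (i - n))" for i
  have y0: "0 \<le> v (y i)" for i using z a0 by (simp add: y_def)
  let ?Y = "newton_poly y"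
  have Yn: "?Y n = f" unfolding newton_poly_def f_def by (intro prod.cong) (auto simp: y_def)
  have Ynj: "?Y (n + j) = f * ?P j" for j
    unfolding newton_poly_add Yn by (simp add: newton_poly_def y_def)
  have f_monic: "degree f = n" "coeff f n = 1" using newton_poly_monic[of z n] by (auto simp: f_def)
  have deg: "coeff (newton_poly u k) i = 0" if "i \<ge> Suc k" for u :: "nat \<Rightarrow> 'a" and k i
    using newton_poly_monic[of u k] that by (intro coeff_eq_0) simp
  have top: "coeff (newton_poly u k) k = 1" for u :: "nat \<Rightarrow> 'a" and k
    by (metis newton_poly_monic)
  have change: "\<exists>c. newton_poly u k = (\<Sum>i<Suc k. Polynomial.smult (c i) (newton_poly w i)) \<and>
      (\<forall>i>k. c i = 0) \<and> c k = 1 \<and> (\<forall>i. 0 \<le> v (c i))"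
    if "\<forall>i. 0 \<le> v (u i)" "\<forall>i. 0 \<le> v (w i)" for u w k
    using newton_expansion[of "Suc k" "newton_poly u k" w] deg[of k _ u] top[of u k] that newton_poly_integral[of u]
    by (auto simp: Suc_le_eq)
  \<comment> \<open>The coordinate of the monic polynomial \<open>f\<close> at \<open>?P n\<close> is \<open>1\<close>.\<close>
  have s_le: "s \<le> \<alpha> n"
  proof -
    obtain c where c: "f = (\<Sum>i<Suc n. Polynomial.smult (c i) (?P i))" "c n = 1"
      using change[of z a n] z a0 unfolding f_def by blast
    have "ereal (\<gamma> * real s - \<gamma> * real (\<alpha> n)) \<le> v (c n)"
    proof (rule newton_coefficient_ge[OF a])
      show "poly f x = (\<Sum>k<Suc n. c k * (\<Prod>i<k. x - a i))" for x
        by (subst c(1)) (simp add: poly_sum poly_newton)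
    qed (use s in \<open>auto simp: f_def\<close>)
    then have "\<gamma> * real s \<le> \<gamma> * real (\<alpha> n)" using c(2) by simp
    then show ?thesis using g0 by simp
  qed
  show ?thesis
  proof (cases "N = 0")
    case True
    then have "n = 0" by (simp add: N_def)
    then have "\<gamma> * real S \<le> 0" using S(1) by (simp add: newton_poly_def)
    then have "S = 0" using g0 by (simp add: mult_le_0_iff)
    moreover have "s = 0" using s_le \<open>n = 0\<close> zero by simp
    ultimately show ?thesis using \<open>n = 0\<close> g0 by (simp add: mult_le_0_iff)
  next
    case False
    have "\<forall>r. \<exists>c. ?P r = (\<Sum>i<Suc r. Polynomial.smult (c i) (?Y i)) \<and>
      (\<forall>i>r. c i = 0) \<and> c r = 1 \<and> (\<forall>i. 0 \<le> v (c i))" using change a0 y0 by blast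
    then obtain U where U: "\<And>r. ?P r = (\<Sum>i<Suc r. Polynomial.smult (U r i) (?Y i))"
      "\<And>r i. i > r \<Longrightarrow> U r i = 0" "\<And>r. U r r = 1" "\<And>r i. 0 \<le> v (U r i)" by metis
    have "\<forall>r. \<exists>c. ?Y r = (\<Sum>i<Suc r. Polynomial.smult (c i) (?P i)) \<and>
      (\<forall>i>r. c i = 0) \<and> c r = 1 \<and> (\<forall>i. 0 \<le> v (c i))" using change a0 y0 by blast
    then obtain T where T: "\<And>r. ?Y r = (\<Sum>i<Suc r. Polynomial.smult (T r i) (?P i))"
      "\<And>r i. i > r \<Longrightarrow> T r i = 0" "\<And>r. T r r = 1" "\<And>r i. 0 \<le> v (T r i)" by metis
    have "\<exists>c. g = (\<Sum>l<N - k. Polynomial.smult (c l) (newton_poly (\<lambda>i. y (k + i)) l)) \<and> (\<forall>l. 0 \<le> v (c l))"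
      if "k < n" for k
      using newton_expansion[of "N - k" g "\<lambda>i. y (k + i)"] g y0 that by (auto simp: N_def coeff_eq_0)
    then obtain G where G: "\<And>k. k < n \<Longrightarrow> g = (\<Sum>l<N - k. Polynomial.smult (G k l) (newton_poly (\<lambda>i. y (k + i)) l))"
      "\<And>k l. k < n \<Longrightarrow> 0 \<le> v (G k l)" by metis
    have G0: "G k 0 = poly g (z k)" if k: "k < n" for k
    proof -
      have "poly g (y k) = (\<Sum>l<N - k. G k l * (\<Prod>i<l. y k - y (k + i)))"
        by (subst G(1)[OF k]) (simp add: poly_sum poly_newton)
      also have "\<dots> = (\<Sum>l\<in>{0}. G k l * (\<Prod>i<l. y k - y (k + i)))"
      proof (intro sum.mono_neutral_right ballI)
        fix l assume "l \<in> {..<N - k} - {0}"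
        then have "(\<Prod>i<l. y k - y (k + i)) = 0" by (intro prod_zero bexI[of _ 0]) auto
        then show "G k l * (\<Prod>i<l. y k - y (k + i)) = 0" by simp
      qed (use k in \<open>auto simp: N_def\<close>)
      finally show ?thesis using k by (simp add: y_def)
    qed
    \<comment> \<open>\<open>R\<close> expresses the rows \<open>?P i * g\<close> by the products \<open>?Y i * g\<close>, \<open>D\<close> expresses these in the basis
      \<open>?Y\<close>, and \<open>T\<close> passes from \<open>?Y\<close> to \<open>?P\<close>. The product \<open>?Y k * g\<close> is divisible by \<open>?Y k\<close>, so \<open>D\<close> is upper
      triangular, with the value of \<open>g\<close> at the node \<open>z k\<close> on the diagonal. The rows \<open>?P j * f\<close> are
      elements of the basis \<open>?Y\<close>.\<close>
    define D where "D k l = (if k < n then (if l < k then 0 else G k (l - k)) else if k = l then 1 else 0)" for k l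
    define R where "R r k = (if r < n then U r k else if r = k then 1 else 0)" for r k
    define C where "C r k = (\<Sum>i<N. \<Sum>j<N. R r i * D i j * T j k)" for r k
    define w where "w i = (if i < n then ?Y i * g else ?Y i)" for i
    define J where "J r = (if r < n then r else r - n)" for r
    define h where "h r = ?P (J r) * (if r < n then g else f)" for r
    have R0: "0 \<le> v (R r k)" and D0: "0 \<le> v (D r k)" for r k
      using U(4) G(2) by (simp_all add: R_def D_def)
    have C0: "0 \<le> v (C r k)" for r k
      unfolding C_def by (intro v_sum_ge v_mult_nonneg R0 D0 T(4))
    have detC: "det (mat N N (\<lambda>(r, k). C r k)) = (\<Prod>i<n. poly g (z i))"
    proof -
      have "det (mat N N (\<lambda>(r, k). C r k)) = (\<Prod>i<N. D i i)"
        unfolding C_def by (rule det_triangular_product) (auto simp: R_def D_def U T)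
      also have "\<dots> = (\<Prod>i<n. poly g (z i))"
        by (intro prod.mono_neutral_cong_right) (auto simp: N_def D_def G0)
      finally show ?thesis .
    qed
    have step1: "poly (h r) x = (\<Sum>i<N. R r i * poly (w i) x)" if r: "r < N" for r x
    proof (cases "r < n")
      case True
      have "poly (h r) x = poly (?P r) x * poly g x" using True by (simp add: h_def J_def)
      also have "\<dots> = (\<Sum>i<Suc r. U r i * poly (?Y i) x * poly g x)"
        by (subst U(1)) (simp only: poly_sum poly_smult sum_distrib_right)
      also have "\<dots> = (\<Sum>i<N. R r i * poly (w i) x)"
        using True r U(2) by (intro sum.mono_neutral_cong_left) (auto simp: R_def w_def)
      finally show ?thesis .
    next
      case False
      then have "w r = h r" using Ynj[of "r - n"] by (simp add: w_def h_def J_def mult.commute)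
      then show ?thesis using False r
        by (simp add: R_def if_distrib[of "\<lambda>c. c * _"] cong: if_cong)
    qed
    have step2: "poly (w i) x = (\<Sum>j<N. D i j * poly (?Y j) x)" if i: "i < N" for i x
    proof (cases "i < n")
      case True
      have "poly (w i) x = (\<Sum>l<N - i. G i l * (poly (?Y i) x * poly (newton_poly (\<lambda>j. y (i + j)) l) x))"
        using True unfolding w_def by (subst G(1)[OF True]) (simp add: poly_sum sum_distrib_left mult_ac)
      also have "\<dots> = (\<Sum>l<N - i. G i l * poly (?Y (i + l)) x)" by (simp add: newton_poly_add)
      also have "\<dots> = (\<Sum>j\<in>{i..<N}. G i (j - i) * poly (?Y j) x)"
        using i by (intro sum.reindex_bij_witness[of _ "\<lambda>j. j - i" "\<lambda>l. i + l"]) auto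
      also have "\<dots> = (\<Sum>j<N. D i j * poly (?Y j) x)"
        using True by (intro sum.mono_neutral_cong_left) (auto simp: D_def)
      finally show ?thesis .
    next
      case False
      then show ?thesis using i
        by (simp add: D_def w_def if_distrib[of "\<lambda>c. c * _"] cong: if_cong)
    qed
    have step3: "poly (?Y j) x = (\<Sum>k<N. T j k * poly (?P k) x)" if j: "j < N" for j x
    proof -
      have "poly (?Y j) x = (\<Sum>k<Suc j. T j k * poly (?P k) x)"
        by (subst T(1)) (simp only: poly_sum poly_smult)
      also have "\<dots> = (\<Sum>k<N. T j k * poly (?P k) x)"
        using j T(2) by (intro sum.mono_neutral_cong_left) auto
      finally show ?thesis .
    qed
    have hC: "poly (h r) x = (\<Sum>k<N. C r k * (\<Prod>i<k. x - a i))" if r: "r < N" for r x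
    proof -
      have "poly (h r) x = (\<Sum>i<N. R r i * (\<Sum>j<N. D i j * (\<Sum>k<N. T j k * poly (?P k) x)))"
        unfolding step1[OF r] using step2 step3 by (intro sum.cong refl arg_cong2[of _ _ _ _ "(*)"]) auto
      also have "\<dots> = (\<Sum>i<N. \<Sum>j<N. \<Sum>k<N. R r i * D i j * T j k * poly (?P k) x)"
        by (simp add: sum_distrib_left mult.assoc)
      also have "\<dots> = (\<Sum>i<N. \<Sum>k<N. \<Sum>j<N. R r i * D i j * T j k * poly (?P k) x)"
        by (intro sum.cong refl sum.swap)
      also have "\<dots> = (\<Sum>k<N. \<Sum>i<N. \<Sum>j<N. R r i * D i j * T j k * poly (?P k) x)"
        by (rule sum.swap)
      also have "\<dots> = (\<Sum>k<N. C r k * (\<Prod>i<k. x - a i))"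
        by (simp add: C_def sum_distrib_right poly_newton)
      finally show ?thesis .
    qed
    \<comment> \<open>In units of \<open>\<gamma>\<close>: the row with Newton factor \<open>?P j\<close>, scaled by a power of exponent \<open>t - \<alpha> j\<close>, has
      values on \<open>A\<close> of valuation at least \<open>s + t\<close>. Its coordinate at \<open>?P k\<close> then has valuation at least
      \<open>s + t - \<alpha> k\<close>, and at least \<open>0\<close> as it is integral; truncated subtraction combines both. Column
      \<open>0\<close> consists of the values at \<open>a 0\<close>, where \<open>S\<close> replaces \<open>s\<close>.\<close>
    define cl where "cl k = \<gamma> * (if k = 0 then real (S + t) else real (s + t - \<alpha> k))" for k
    define rw where "rw r = \<gamma> * real (t - \<alpha> (J r))" for r
    have bound: "ereal (cl k - rw r) \<le> v (C r k)" if r: "r < N" and k: "k < N" for r k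
    proof (cases "k = 0")
      case True
      have "(\<Sum>k<N. C r k * (\<Prod>i<k. a 0 - a i)) = (\<Sum>k\<in>{0}. C r k * (\<Prod>i<k. a 0 - a i))"
      proof (intro sum.mono_neutral_right ballI)
        fix l assume "l \<in> {..<N} - {0}"
        then have "(\<Prod>i<l. a 0 - a i) = 0" by (intro prod_zero bexI[of _ 0]) auto
        then show "C r l * (\<Prod>i<l. a 0 - a i) = 0" by simp
      qed (use False in auto)
      then have C: "C r 0 = poly (h r) (a 0)" unfolding hC[OF r] by simp
      show ?thesis
      proof (cases "J r = 0")
        case J: True
        have "poly (h r) (a 0) = poly (if r < n then g else f) (a 0)" by (simp add: h_def J newton_poly_def)
        then have "ereal (\<gamma> * real S) \<le> v (C r 0)" unfolding C using S by (simp add: f_def)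
        then show ?thesis using True J zero by (simp add: cl_def rw_def right_diff_distrib[symmetric])
      next
        case J: False
        have "poly (?P (J r)) (a 0) = 0" unfolding poly_newton using J by (intro prod_zero) auto
        then have "C r 0 = 0" unfolding C by (simp add: h_def)
        then show ?thesis using True by simp
      qed
    next
      case k0: False
      have "ereal (\<gamma> * real (\<alpha> (J r)) + \<gamma> * real s - \<gamma> * real (\<alpha> k)) \<le> v (C r k)"
      proof (rule newton_coefficient_ge[OF a hC[OF r] _ k])
        fix x assume x: "x \<in> A"
        have "ereal (\<gamma> * real (\<alpha> (J r))) \<le> v (poly (?P (J r)) x)"
          using a x unfolding test_sequence_def poly_newton by blast
        moreover have "ereal (\<gamma> * real s) \<le> v (poly (if r < n then g else f) x)"
          using s[OF x] by (simp add: f_def)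
        ultimately show "ereal (\<gamma> * real (\<alpha> (J r)) + \<gamma> * real s) \<le> v (poly (h r) x)"
          unfolding h_def poly_mult by (rule v_mult_ge)
      qed
      moreover have "ereal 0 \<le> v (C r k)" using C0 by (simp add: zero_ereal_def[symmetric])
      moreover have "cl k - rw r \<le> 0 \<or> cl k - rw r \<le> \<gamma> * real (\<alpha> (J r)) + \<gamma> * real s - \<gamma> * real (\<alpha> k)"
      proof (cases "s + t \<le> \<alpha> k")
        case True
        then have "cl k = 0" using k0 by (simp add: cl_def)
        moreover have "0 \<le> rw r" unfolding rw_def using g0 by simp
        ultimately show ?thesis by simp
      next
        case False
        then have "real (s + t - \<alpha> k) - real (t - \<alpha> (J r)) \<le> real (\<alpha> (J r)) + real s - real (\<alpha> k)" by linarith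
        then have "\<gamma> * (real (s + t - \<alpha> k) - real (t - \<alpha> (J r))) \<le> \<gamma> * (real (\<alpha> (J r)) + real s - real (\<alpha> k))"
          using g0 by (intro mult_left_mono) auto
        then show ?thesis using k0 by (simp add: cl_def rw_def algebra_simps)
      qed
      ultimately show ?thesis by (meson ereal_less_eq(3) order_trans)
    qed
    have "ereal ((\<Sum>k<N. cl k) - (\<Sum>r<N. rw r)) \<le> v (\<Prod>i<n. poly g (z i))"
      using v_det_ge[of N cl rw C] bound unfolding detC by blast
    moreover have "\<gamma> * (real S - real s + real (beta_sum (s + t)) - 2 * real (beta_sum t))
        \<le> (\<Sum>k<N. cl k) - (\<Sum>r<N. rw r)"
    proof -
      have "(\<Sum>k<N. cl k) = cl 0 + (\<Sum>k\<in>{..<N} - {0}. cl k)" using False by (intro sum.remove) auto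
      also have "(\<Sum>k\<in>{..<N} - {0}. cl k) = (\<Sum>k\<in>{..<N} - {0}. \<gamma> * real (s + t - \<alpha> k))"
        by (intro sum.cong) (auto simp: cl_def)
      also have "cl 0 + \<dots> = \<gamma> * (real S - real s) + (\<Sum>k<N. \<gamma> * real (s + t - \<alpha> k))"
        using False sum.remove[of "{..<N}" 0 "\<lambda>k. \<gamma> * real (s + t - \<alpha> k)"]
        by (simp add: cl_def zero algebra_simps)
      finally have cl: "(\<Sum>k<N. cl k) = \<gamma> * (real S - real s + real (\<Sum>k<N. s + t - \<alpha> k))"
        by (simp add: distrib_left sum_distrib_left)
      have "(\<Sum>r<N. rw r) = (\<Sum>r<n. rw r) + (\<Sum>r\<in>{n..<N}. rw r)"
        using sum.atLeastLessThan_concat[of 0 n N rw] by (simp add: N_def atLeast0LessThan)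
      also have "(\<Sum>r\<in>{n..<N}. rw r) = (\<Sum>j<m. rw (n + j))"
        by (intro sum.reindex_bij_witness[of _ "\<lambda>j. n + j" "\<lambda>r. r - n"]) (auto simp: N_def)
      finally have rw: "(\<Sum>r<N. rw r) = \<gamma> * (real (\<Sum>i<n. t - \<alpha> i) + real (\<Sum>j<m. t - \<alpha> j))"
        by (simp add: rw_def J_def distrib_left sum_distrib_left)
      have "real (beta_sum (s + t)) + real (\<Sum>j<m. t - \<alpha> j) + real (\<Sum>i<n. t - \<alpha> i)
           \<le> real (\<Sum>k<N. s + t - \<alpha> k) + 2 * real (beta_sum t)"
        using beta_sum_truncation[OF s_le, of t m] unfolding N_def by linarith
      then have "real S - real s + real (beta_sum (s + t)) - 2 * real (beta_sum t)
         \<le> (real S - real s + real (\<Sum>k<N. s + t - \<alpha> k)) - (real (\<Sum>i<n. t - \<alpha> i) + real (\<Sum>j<m. t - \<alpha> j))"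
        by linarith
      then have "\<gamma> * (real S - real s + real (beta_sum (s + t)) - 2 * real (beta_sum t))
         \<le> \<gamma> * ((real S - real s + real (\<Sum>k<N. s + t - \<alpha> k)) - (real (\<Sum>i<n. t - \<alpha> i) + real (\<Sum>j<m. t - \<alpha> j)))"
        using g0 by (intro mult_left_mono) auto
      then show ?thesis unfolding cl rw right_diff_distrib[of \<gamma> "_ + real (\<Sum>k<N. _ k)"] .
    qed
    ultimately show ?thesis by (meson ereal_less_eq(3) order_trans)
  qed
qed

end

section \<open>From polynomials to power series\<close>

context Cp
begin

text \<open>
  The value is a limit of elements of \<open>K\<close>, which eventually have the same valuation as the limit.
\<close>

lemma v_fps_value_in_value_group:
  assumes K: "finite_extension_Qp K" and e: "e = ramification_index p v K"
    and F: "\<And>i. fps_nth F i \<in> K" and x: "x \<in> K" and conv: "null (\<lambda>i. fps_nth F i * x ^ i)"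
    and nz: "fps_value F x \<noteq> 0"
  shows "\<exists>k::int. v (fps_value F x) = ereal (of_int k / real e)"
proof -
  note KD = finite_extensionD[OF K]
  let ?s = "\<lambda>n. \<Sum>i<n. fps_nth F i * x ^ i"
  obtain r where r: "v (fps_value F x) = ereal r" using nz by (rule v_real)
  obtain N :: nat where N: "r < real N" using reals_Archimedean2 by blast
  have "?s \<longlonglongrightarrow> fps_value F x" unfolding fps_value_def by (rule suminf_tendsto[OF conv])
  then have "\<forall>\<^sub>F n in sequentially. ereal (real N) \<le> v (?s n - fps_value F x)"
    unfolding tendsto_iff_v by blast
  then obtain n where n: "ereal (real N) \<le> v (?s n - fps_value F x)"
    unfolding eventually_sequentially by blast
  have "v (fps_value F x) < ereal (real N)" using r N by simp
  then have "v (fps_value F x) < v (fps_value F x - ?s n)"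
    using n v_minus_commute[of "?s n"] by simp
  then have eq: "v (?s n) = v (fps_value F x)" by (rule v_eqI)
  then have "?s n \<noteq> 0" using r by auto
  moreover have "?s n \<in> K" by (intro sum_in_extension[OF K] KD F x)
  ultimately show ?thesis
    using ramification_index_value_group[OF K e] eq by metis
qed

lemma linear_prod_eq_newton_poly:
  "linear_prod zs = newton_poly (\<lambda>i. if i < length zs then zs ! i else 0) (length zs)"
  unfolding newton_poly_def prod.list_conv_set_nth by (intro prod.cong) auto

text \<open>
  By the factorizations, \<open>F\<close> and \<open>G\<close> have the same valuations on the disc as their monic polynomials,
  so that \<open>resultant_lower_bound\<close> applies. Its instance with \<open>s = t = 0\<close> bounds all values of the
  minimum of the two valuations by the valuation of the resultant, which is finite. As these values
  are multiples of \<open>1 / e\<close>, the greatest and the least of them exist.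
\<close>

lemma resultant_bound_on_subset:
  assumes K: "finite_extension_Qp K" and e: "e = ramification_index p v K"
    and sup: "superadditive \<alpha>"
    and seq: "\<And>x0. x0 \<in> A \<Longrightarrow> \<exists>a. a 0 = x0 \<and> test_sequence (1 / real e) A \<alpha> a"
    and A: "A \<noteq> {}" "A \<subseteq> K" "A \<subseteq> D" and D: "\<And>x. x \<in> D \<Longrightarrow> 0 \<le> v x"
    and coeffs: "\<And>i. fps_nth F i \<in> K" "\<And>i. fps_nth G i \<in> K"
    and conv: "fps_converges_on F D" "fps_converges_on G D"
    and F: "factors_on D F zs U" and G: "factors_on D G ws W"
    and ncr: "no_common_root D F G"
    and res: "v r = v (prod_over_roots D F G)"
  shows "\<exists>S s :: nat.
          ereal (real S) = ereal (real e) * max_phi v F G A \<and>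
          ereal (real s) = ereal (real e) * min_phi v F G A \<and>
          (\<forall>t :: nat.
             ereal (real e) * v r - ereal (real S)
               \<ge> ereal (real (superadditive.beta_sum \<alpha> (s + t)) - 2 * real (superadditive.beta_sum \<alpha> t) - real s) \<and>
             v r - max_phi v F G A
               \<ge> ereal (1 / real e * (real (superadditive.beta_sum \<alpha> (s + t)) - 2 * real (superadditive.beta_sum \<alpha> t) - real s)))"
proof -
  interpret superadditive \<alpha> by (rule sup)
  have e0: "e > 0" using ramification_index_value_group[OF K e] by metis
  let ?\<gamma> = "1 / real e"
  define n where "n = length zs"
  define z where "z i = (if i < length zs then zs ! i else 0)" for i
  define g where "g = linear_prod ws"
  have f: "linear_prod zs = newton_poly z n" unfolding n_def z_def[abs_def] by (rule linear_prod_eq_newton_poly)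
  have zsD: "set zs \<subseteq> D" and wsD: "set ws \<subseteq> D" using F G by (auto simp: factors_on_def)
  have ziD: "z i \<in> D" if "i < n" for i
    using that zsD nth_mem unfolding z_def n_def by (auto simp del: nth_mem)
  have z0: "0 \<le> v (z i)" for i using ziD[of i] D by (auto simp: z_def n_def)
  have int: "0 \<le> v (coeff (linear_prod zs) i)" "0 \<le> v (coeff g i)" for i
    unfolding g_def using zsD wsD D by (auto intro!: linear_prod_integral)
  have g: "lead_coeff g = 1" "degree g = length ws"
    unfolding g_def linear_prod_eq_newton_poly[of ws] using newton_poly_monic by blast+
  have vF: "v (fps_value F x) = v (poly (newton_poly z n) x)" if "x \<in> D" for x
    using factors_on_value(2)[OF F that] f by simp
  have vG: "v (fps_value G x) = v (poly g x)" if "x \<in> D" for x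
    using factors_on_value(2)[OF G that] by (simp add: g_def)
  have "prod_over_roots D F G = (\<Prod>i<n. fps_value G (z i))"
    unfolding prod_over_roots_factors[OF F] prod.list_conv_set_nth n_def z_def by (intro prod.cong) auto
  then have vr: "v r = v (\<Prod>i<n. poly g (z i))"
    using res ziD vG by (auto simp: v_prod intro!: sum.cong)
  have "fps_value G y \<noteq> 0" if "y \<in> set zs" for y
    using that zsD ncr factors_on_value(3)[OF F, of y] by (auto simp: no_common_root_def)
  then have "prod_over_roots D F G \<noteq> 0"
    unfolding prod_over_roots_factors[OF F] by (auto simp: prod_list_zero_iff)
  then obtain \<rho> where rho: "v r = ereal \<rho>" using v_real[of "prod_over_roots D F G"] res by metis
  define ph where "ph x = phi v F G x" for x
  have ph_val: "\<exists>k::nat. ph x = ereal (?\<gamma> * real k)" if x: "x \<in> A" for x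
  proof -
    have xD: "x \<in> D" "x \<in> K" using x A by auto
    have nonneg: "0 \<le> v (fps_value F x)" "0 \<le> v (fps_value G x)"
      unfolding vF[OF xD(1)] vG[OF xD(1)] f[symmetric]
      using int D[OF xD(1)] by (auto intro: poly_ge)
    have val: "\<exists>k::nat. v (fps_value H x) = ereal (?\<gamma> * real k)"
      if H: "\<And>i. fps_nth H i \<in> K" "fps_converges_on H D" "fps_value H x \<noteq> 0" "0 \<le> v (fps_value H x)" for H
    proof -
      obtain k :: int where k: "v (fps_value H x) = ereal (of_int k / real e)"
        using v_fps_value_in_value_group[OF K e H(1) xD(2) _ H(3)] H(2) xD(1) by (auto simp: converges_iff)
      then have "0 \<le> of_int k / real e" using H(4) by simp
      then have "0 \<le> k" using e0 by (simp add: zero_le_divide_iff)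
      then show ?thesis using k by (intro exI[of _ "nat k"]) simp
    qed
    have nz: "fps_value F x \<noteq> 0 \<or> fps_value G x \<noteq> 0" using ncr xD(1) by (auto simp: no_common_root_def)
    show ?thesis
    proof (cases "fps_value F x = 0 \<or> fps_value G x = 0")
      case True
      then show ?thesis using val[of F] val[of G] coeffs conv nonneg nz
        by (auto simp: ph_def phi_def)
    next
      case False
      then show ?thesis using val[of F] val[of G] coeffs conv nonneg
        by (auto simp: ph_def phi_def min_def)
    qed
  qed
  have core: "ereal (?\<gamma> * (real S - real s + real (beta_sum (s + t)) - 2 * real (beta_sum t))) \<le> v r"
    if x0: "x0 \<in> A" and S: "ereal (?\<gamma> * real S) \<le> ph x0"
      and s: "\<And>x. x \<in> A \<Longrightarrow> ereal (?\<gamma> * real s) \<le> ph x" for x0 S s t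
  proof -
    obtain a where a: "a 0 = x0" "test_sequence ?\<gamma> A \<alpha> a" using seq[OF x0] by blast
    show ?thesis unfolding vr
    proof (rule resultant_lower_bound[OF sup _ a(2) _ z0 g int(2)])
      show "0 < ?\<gamma>" using e0 by simp
      show "0 \<le> v x" if "x \<in> A" for x using that A D by blast
      show "ereal (?\<gamma> * real s) \<le> v (poly (newton_poly z n) x)" "ereal (?\<gamma> * real s) \<le> v (poly g x)"
        if "x \<in> A" for x
        using s[OF that] that A(3) by (auto simp: ph_def phi_def vF[symmetric] vG[symmetric])
      show "ereal (?\<gamma> * real S) \<le> v (poly (newton_poly z n) (a 0))" "ereal (?\<gamma> * real S) \<le> v (poly g (a 0))"
        using S x0 A(3) a(1) by (auto simp: ph_def phi_def vF[symmetric] vG[symmetric])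
    qed
  qed
  \<comment> \<open>The values of the minimum of the two valuations on \<open>A\<close>, in units of \<open>1 / e\<close>.\<close>
  define M where "M = {k::nat. \<exists>x\<in>A. ph x = ereal (?\<gamma> * real k)}"
  have "M \<subseteq> {..nat \<lfloor>real e * \<rho>\<rfloor>}"
  proof
    fix k assume "k \<in> M"
    then obtain x where x: "x \<in> A" "ph x = ereal (?\<gamma> * real k)" by (auto simp: M_def)
    have "0 \<le> ph y" if y: "y \<in> A" for y using ph_val[OF y] by auto
    then have "ereal (?\<gamma> * (real k - real 0 + real (beta_sum (0 + 0)) - 2 * real (beta_sum 0))) \<le> v r"
      using x by (intro core) (auto simp: zero_ereal_def[symmetric])
    then have "?\<gamma> * real k \<le> \<rho>" by (simp add: beta_sum_def rho)
    then have "real k \<le> real e * \<rho>" using e0 by (simp add: field_simps)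
    then show "k \<in> {..nat \<lfloor>real e * \<rho>\<rfloor>}" by (simp add: le_nat_floor)
  qed
  then have finM: "finite M" by (rule finite_subset) simp
  have neM: "M \<noteq> {}" using A(1) ph_val by (auto simp: M_def)
  define S where "S = Max M"
  define s where "s = Min M"
  obtain x1 where x1: "x1 \<in> A" "ph x1 = ereal (?\<gamma> * real S)" using Max_in[OF finM neM] by (auto simp: M_def S_def)
  obtain x2 where x2: "x2 \<in> A" "ph x2 = ereal (?\<gamma> * real s)" using Min_in[OF finM neM] by (auto simp: M_def s_def)
  have range: "ereal (?\<gamma> * real s) \<le> ph x \<and> ph x \<le> ereal (?\<gamma> * real S)" if x: "x \<in> A" for x
  proof -
    obtain k :: nat where k: "ph x = ereal (?\<gamma> * real k)" using ph_val[OF x] by blast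
    then have "k \<in> M" using x by (auto simp: M_def)
    then have "s \<le> k" "k \<le> S" using finM by (auto simp: s_def S_def)
    then show ?thesis unfolding k using e0 by (simp add: divide_right_mono)
  qed
  have phi: "phi v F G = ph" by (simp add: ph_def[abs_def])
  have max: "max_phi v F G A = ereal (?\<gamma> * real S)"
    unfolding max_phi_def phi x1(2)[symmetric]
  proof (rule Greatest_equality)
    show "ph x1 \<in> ph ` A" by (rule imageI[OF x1(1)])
  qed (use x1(2) range in auto)
  have min: "min_phi v F G A = ereal (?\<gamma> * real s)"
    unfolding min_phi_def phi x2(2)[symmetric]
  proof (rule Least_equality)
    show "ph x2 \<in> ph ` A" by (rule imageI[OF x2(1)])
  qed (use x2(2) range in auto)
  show ?thesis
  proof (rule exI[of _ S], rule exI[of _ s], intro conjI allI)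
    show "ereal (real S) = ereal (real e) * max_phi v F G A" "ereal (real s) = ereal (real e) * min_phi v F G A"
      unfolding max min using e0 by auto
    fix t :: nat
    let ?b = "real (beta_sum (s + t)) - 2 * real (beta_sum t) - real s"
    have "?\<gamma> * (real S - real s + real (beta_sum (s + t)) - 2 * real (beta_sum t)) \<le> \<rho>"
      using core[OF x1(1), of S s t] x1(2) range unfolding rho by simp
    then have 1: "?\<gamma> * ?b \<le> \<rho> - ?\<gamma> * real S" by (simp add: algebra_simps add_divide_distrib diff_divide_distrib)
    then have "real e * (?\<gamma> * ?b) \<le> real e * (\<rho> - ?\<gamma> * real S)" by (intro mult_left_mono) auto
    then have 2: "?b \<le> real e * \<rho> - real S" using e0 by (simp add: right_diff_distrib)
    show "ereal ?b \<le> ereal (real e) * v r - ereal (real S)" using 2 by (simp add: rho)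
    show "ereal (?\<gamma> * ?b) \<le> v r - max_phi v F G A" using 1 by (simp add: rho max)
  qed
qed

lemma v_unit: assumes "0 \<le> v x" "\<exists>u\<in>val_ring v UNIV. x * u = 1" shows "v x = 0"
proof -
  obtain u where u: "0 \<le> v u" "x * u = 1" using assms(2) by (auto simp: val_ring_def)
  then have "v x + v u = 0" using v_mult[of x u] by simp
  then show ?thesis using assms(1) u(1) by (cases "v x"; cases "v u") auto
qed

lemma wideg_unit:
  assumes "\<And>i. 0 \<le> v (fps_nth F i)" "wideg v F = enat n" "v (fps_nth F n) = 0" "i < n"
  shows "0 < v (fps_nth F i)"
proof (rule ccontr)
  assume "\<not> 0 < v (fps_nth F i)"
  then have "v (fps_nth F i) = 0" using assms(1)[of i] by simp
  then have "i \<in> min_indices v F" using assms(1) by (simp add: min_indices_def)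
  then have "wideg v F \<le> enat i" unfolding wideg_def by (intro Inf_lower) simp
  then show False using assms(2,4) by simp
qed

text \<open>
  Only finitely many coefficients are units, so the supremum is a maximum.
\<close>

lemma Lwideg_unit:
  assumes "\<And>i. 0 \<le> v (fps_nth F i)" "null (fps_nth F)" "v (fps_nth F n) = 0"
  obtains N where "Lwideg v F = enat N" "v (fps_nth F N) = 0" "\<And>i. i > N \<Longrightarrow> 0 < v (fps_nth F i)"
proof -
  have eq: "min_indices v F = {i. v (fps_nth F i) = 0}"
  proof (rule equalityI; rule subsetI)
    fix i assume "i \<in> min_indices v F"
    then have "v (fps_nth F i) \<le> v (fps_nth F n)" by (simp add: min_indices_def)
    then show "i \<in> {i. v (fps_nth F i) = 0}" using assms(1)[of i] assms(3) by simp
  qed (use assms(1) in \<open>simp add: min_indices_def\<close>)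
  obtain M where M: "\<And>i. i \<ge> M \<Longrightarrow> ereal (real 1) \<le> v (fps_nth F i)"
    using assms(2) unfolding null_def eventually_sequentially by blast
  have "min_indices v F \<subseteq> {..<M}"
  proof
    fix i assume "i \<in> min_indices v F"
    then have "\<not> M \<le> i" using M[of i] by (auto simp: eq)
    then show "i \<in> {..<M}" by simp
  qed
  then have fin: "finite (min_indices v F)" by (rule finite_subset) simp
  have ne: "min_indices v F \<noteq> {}" using assms(3) by (auto simp: eq)
  define N where "N = Max (min_indices v F)"
  have "Lwideg v F = Max (enat ` min_indices v F)"
    unfolding Lwideg_def using fin ne by (simp add: Sup_enat_def)
  also have "\<dots> = enat N"
    unfolding N_def using fin ne by (subst mono_Max_commute[of enat]) (auto simp: mono_def)
  finally have 1: "Lwideg v F = enat N" .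
  have 2: "v (fps_nth F N) = 0" using Max_in[OF fin ne] by (simp add: N_def eq)
  have 3: "0 < v (fps_nth F i)" if "i > N" for i
  proof (rule ccontr)
    assume "\<not> 0 < v (fps_nth F i)"
    then have "i \<in> min_indices v F" using assms(1)[of i] by (simp add: eq)
    then have "i \<le> N" unfolding N_def using fin by (intro Max_ge)
    then show False using that by simp
  qed
  show ?thesis by (rule that[OF 1 2 3])
qed

lemma series_c_null: assumes "fps_converges_on F (val_ring v UNIV)" shows "null (fps_nth F)"
proof -
  have "1 \<in> val_ring v UNIV" by (simp add: val_ring_def)
  then show ?thesis using assms unfolding converges_iff by fastforce
qed

end

theorem theorem3p4:
  fixes p e f n m :: nat
    and v :: "'a::{field_char_0, complete_space} \<Rightarrow> ereal"
    and K :: "'a set"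
    and F G :: "'a fps"
  assumes "Cp p v"
    and "finite_extension_Qp K"
    and "e = ramification_index p v K"
    and "f = residue_degree v K"
    and "\<And>i. fps_nth F i \<in> val_ring v K"
    and "\<And>i. fps_nth G i \<in> val_ring v K"
    and "wideg v F = enat n"
    and "wideg v G = enat m"
    and "\<exists>u\<in>val_ring v UNIV. fps_nth F n * u = 1"
    and "\<exists>u\<in>val_ring v UNIV. fps_nth G m * u = 1"
  shows
    "(F \<in> series_o v K \<and> G \<in> series_o v K \<and> no_common_root (val_ideal v UNIV) F G \<longrightarrow>
       (\<exists>S' s' :: nat.
          ereal (real S') = ereal (real e) * max_phi v F G (val_ideal v K) \<and>
          ereal (real s') = ereal (real e) * min_phi v F G (val_ideal v K) \<and>
          (\<forall>t :: nat.
             ereal (real e) * v (res_o v F G) - ereal (real S')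
               \<ge> ereal (real (B' p f (s' + t)) - 2 * real (B' p f t) - real s') \<and>
             v (res_o v F G) - max_phi v F G (val_ideal v K)
               \<ge> ereal (1 / real e * (real (B' p f (s' + t)) - 2 * real (B' p f t) - real s')))))
     \<and>
     (F \<in> series_c v K \<and> G \<in> series_c v K \<and> no_common_root (val_ring v UNIV) F G \<longrightarrow>
       (\<exists>S s :: nat.
          ereal (real S) = ereal (real e) * max_phi v F G (val_ring v K) \<and>
          ereal (real s) = ereal (real e) * min_phi v F G (val_ring v K) \<and>
          (\<forall>t :: nat.
             ereal (real e) * v (res_c v F G) - ereal (real S)
               \<ge> ereal (real (B p f (s + t)) - 2 * real (B p f t) - real s) \<and>
             v (res_c v F G) - max_phi v F G (val_ring v K)
               \<ge> ereal (1 / real e * (real (B p f (s + t)) - 2 * real (B p f t) - real s)))))"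
proof -
  interpret Cp p v by (rule assms(1))
  note K = assms(2) and e = assms(3) and f = assms(4) and n = assms(7) and m = assms(8)
  note q2 = residue_field_card_ge[OF K f]
  note sup = superadditive_alpha[OF q2] and sup' = superadditive_alpha'[OF q2]
  have bs: "superadditive.beta_sum (alpha p f) = B p f"
    by (rule ext) (simp add: superadditive.beta_sum_def[OF sup] B_def beta_def)
  have bs': "superadditive.beta_sum (alpha' p f) = B' p f"
    by (rule ext) (simp add: superadditive.beta_sum_def[OF sup'] B'_def beta'_def)
  have F0: "0 \<le> v (fps_nth F i)" and FK: "fps_nth F i \<in> K"
    and G0: "0 \<le> v (fps_nth G i)" and GK: "fps_nth G i \<in> K" for i
    using assms(5,6) by (auto simp: val_ring_def)
  have uF: "v (fps_nth F n) = 0" and uG: "v (fps_nth G m) = 0"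
    using v_unit F0 G0 assms(9,10) by auto
  show ?thesis
  proof (intro conjI impI, goal_cases)
    case 1
    note A = this
    obtain zs U where U: "length zs = n" "factors_on (val_ideal v UNIV) F zs U"
      using open_disc_factorization[OF F0 wideg_unit[OF F0 n uF] uF] by blast
    obtain ws W where W: "length ws = m" "factors_on (val_ideal v UNIV) G ws W"
      using open_disc_factorization[OF G0 wideg_unit[OF G0 m uG] uG] by blast
    have "v (res_o v F G) = v (prod_over_roots (val_ideal v UNIV) F G)"
      by (simp add: res_o_def n m v_mult v_power uF)
    then show ?case
      unfolding bs'[symmetric]
    proof (rule resultant_bound_on_subset[OF K e sup' _ _ _ _ _ FK GK _ _ U(2) W(2), rotated -1])
      show "\<exists>a. a 0 = x0 \<and> test_sequence (1 / real e) (val_ideal v K) (alpha' p f) a"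
        if "x0 \<in> val_ideal v K" for x0
        using test_sequence_ideal[OF K e f that] by blast
      show "val_ideal v K \<noteq> {}" using finite_extensionD(7)[OF K] by (auto simp: val_ideal_def)
    qed (use A in \<open>auto simp: series_o_def val_ideal_def\<close>)
  next
    case 2
    note A = this
    then have nF: "null (fps_nth F)" and nG: "null (fps_nth G)"
      using series_c_null by (auto simp: series_c_def)
    obtain N where N: "Lwideg v F = enat N" "v (fps_nth F N) = 0" "\<And>i. i > N \<Longrightarrow> 0 < v (fps_nth F i)"
      by (rule Lwideg_unit[OF F0 nF uF]) blast
    obtain M where M: "Lwideg v G = enat M" "v (fps_nth G M) = 0" "\<And>i. i > M \<Longrightarrow> 0 < v (fps_nth G i)"
      by (rule Lwideg_unit[OF G0 nG uG]) blast
    obtain zs U where U: "length zs = N" "factors_on (val_ring v UNIV) F zs U"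
      using closed_disc_factorization[OF F0 nF N(2,3)] by blast
    obtain ws W where W: "length ws = M" "factors_on (val_ring v UNIV) G ws W"
      using closed_disc_factorization[OF G0 nG M(2,3)] by blast
    have "v (res_c v F G) = v (prod_over_roots (val_ring v UNIV) F G)"
      by (simp add: res_c_def N(1) M(1) v_mult v_power N(2))
    then show ?case
      unfolding bs[symmetric]
    proof (rule resultant_bound_on_subset[OF K e sup _ _ _ _ _ FK GK _ _ U(2) W(2), rotated -1])
      show "\<exists>a. a 0 = x0 \<and> test_sequence (1 / real e) (val_ring v K) (alpha p f) a"
        if "x0 \<in> val_ring v K" for x0
        using test_sequence_ring[OF K e f that] by blast
      show "val_ring v K \<noteq> {}" using finite_extensionD(7)[OF K] by (auto simp: val_ring_def)
    qed (use A in \<open>auto simp: series_c_def val_ring_def\<close>)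
  qed
qed
end
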